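(* Let $X$ be a set, let $c\ge 1$, and let $\mathcal{U},\mathcal{V}:(\mathbb{R}_+,\le)\to\mathbf{Cov}(X)$ be persistent covers of $X$ that are $c$-approximated up to contiguity. Then the following pairs of persistence modules are $c$-approximated: (1) $H_*\mathrm{Nrv}\,\mathcal{U}$ and $H_*\mathrm{Nrv}\,\mathcal{V}$; (2) $H_*\mathrm{CoNrv}\,\mathcal{U}$ and $H_*\mathrm{CoNrv}\,\mathcal{V}$; (3) $H_*\mathrm{Nrv}\,\mathcal{U}$ and $H_*\mathrm{CoNrv}\,\mathcal{V}$.
   Context: $\mathbb{R}_+=[0,\infty)$. A cover of a set $X$ is an indexed family $\mathcal{U}=\{U_i\}_{i\in I}$ of sets with $X=\bigcup_{i\in I}U_i$. For covers $\mathcal{V}=\{V_j\}_{j\in J}$ and $\mathcal{U}=\{U_i\}_{i\in I}$ of $X$, a refinement map $f:\mathcal{V}\to\mathcal{U}$ is a function $f:J\to I$ with $V_j\subseteq U_{f(j)}$ for all $j\in J$. $\mathbf{Cov}(X)$ is the category whose objects are covers of $X$ and whose morphisms are refinement maps. A persistent cover is a functor $(\mathbb{R}_+,\le)\to\mathbf{Cov}(X)$. The nerve $\mathrm{Nrv}(\mathcal{U})$ is the simplicial complex whose simplices are the finite nonempty $\sigma\subseteq I$ with $\bigcap_{i\in\sigma}U_i\ne\emptyset$. The co-nerve $\mathrm{CoNrv}(\mathcal{U})$ is the simplicial complex whose simplices are the finite nonempty $\sigma\subseteq X$ with $\sigma\subseteq U_i$ for some $i\in I$. A refinement map $f$ induces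 simplicial maps $\mathrm{Nrv}(f)$ (acting on vertices by $j\mapsto f(j)$) and $\mathrm{CoNrv}(f)$ (acting as the identity on vertices), so $\mathrm{Nrv}$ and $\mathrm{CoNrv}$ are functors. $H_*$ is simplicial homology with coefficients in a fixed field. Two persistent covers $\mathcal{U},\mathcal{V}$ are $c$-approximated up to contiguity if for every $r$ there exist refinement maps $\mathcal{U}(r)\to\mathcal{V}(cr)$ and $\mathcal{V}(r)\to\mathcal{U}(cr)$ (no compatibility is required). A persistence module is a functor from $(\mathbb{R}_+,\le)$ to vector spaces. Persistence modules $F,G$ are $c$-approximated if there are natural transformations $\phi:F\Rightarrow G\circ S_c$ and $\psi:G\Rightarrow F\circ S_c$, with $S_c(r)=cr$, such that $\psi_{cr}\circ\phi_r=F(r\le c^2r)$ and $\phi_{cr}\circ\psi_r=G(r\le c^2r)$ for all $r$. *)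

theory Defs
  imports "Jordan_Normal_Form.VS_Connect" "HOL-Algebra.AbelCoset"
begin

section \<open>Covers and persistent covers\<close>

record ('i, 'a) cover =
  index_set :: "'i set"
  member :: "'i \<Rightarrow> 'a set"

definition is_cover :: "'a set \<Rightarrow> ('i, 'a) cover \<Rightarrow> bool" where
  "is_cover X U \<longleftrightarrow> X = (\<Union>i\<in>index_set U. member U i)"

definition refinement_map :: "('j, 'a) cover \<Rightarrow> ('i, 'a) cover \<Rightarrow> ('j \<Rightarrow> 'i) \<Rightarrow> bool" where
  "refinement_map V U f \<longleftrightarrow>
    (\<forall>j\<in>index_set V. f j \<in> index_set U \<and> member V j \<subseteq> member U (f j))"

text \<open>
  Functors on \<open>([0,\<infinity>), \<le>)\<close> are given by data on all of \<^typ>\<open>real\<close>, of which only the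
  parameters \<open>r \<ge> 0\<close> and the pairs \<open>0 \<le> r \<le> s\<close> matter; functions are likewise compared only
  on the index sets (below: on the carriers) between which they are morphisms. The index set may
  vary with \<open>r\<close>.
\<close>

record ('i, 'a) persistent_cover =
  cover_at :: "real \<Rightarrow> ('i, 'a) cover"
  cover_map :: "real \<Rightarrow> real \<Rightarrow> 'i \<Rightarrow> 'i"

definition is_persistent_cover :: "'a set \<Rightarrow> ('i, 'a) persistent_cover \<Rightarrow> bool" where
  "is_persistent_cover X U \<longleftrightarrow>
    (\<forall>r\<ge>0. is_cover X (cover_at U r)) \<and>
    (\<forall>r s. 0 \<le> r \<and> r \<le> s \<longrightarrow>
      refinement_map (cover_at U r) (cover_at U s) (cover_map U r s)) \<and>
    (\<forall>r\<ge>0. \<forall>i\<in>index_set (cover_at U r). cover_map U r r i = i) \<and>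
    (\<forall>r s t. 0 \<le> r \<and> r \<le> s \<and> s \<le> t \<longrightarrow>
      (\<forall>i\<in>index_set (cover_at U r). cover_map U s t (cover_map U r s i) = cover_map U r t i))"

definition approximated_up_to_contiguity ::
    "real \<Rightarrow> ('i, 'a) persistent_cover \<Rightarrow> ('j, 'a) persistent_cover \<Rightarrow> bool" where
  "approximated_up_to_contiguity c U V \<longleftrightarrow>
    (\<forall>r\<ge>0. (\<exists>f. refinement_map (cover_at U r) (cover_at V (c * r)) f) \<and>
           (\<exists>g. refinement_map (cover_at V r) (cover_at U (c * r)) g))"


section \<open>Nerve and co-nerve\<close>

definition nerve :: "('i, 'a) cover \<Rightarrow> 'i set set" where
  "nerve U = {\<sigma>. finite \<sigma> \<and> \<sigma> \<noteq> {} \<and> \<sigma> \<subseteq> index_set U \<and> (\<Inter>i\<in>\<sigma>. member U i) \<noteq> {}}"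

definition conerve :: "'a set \<Rightarrow> ('i, 'a) cover \<Rightarrow> 'a set set" where
  "conerve X U = {\<sigma>. finite \<sigma> \<and> \<sigma> \<noteq> {} \<and> \<sigma> \<subseteq> X \<and> (\<exists>i\<in>index_set U. \<sigma> \<subseteq> member U i)}"


section \<open>Simplicial homology over a field\<close>

text \<open>
  A simplicial complex is represented by its set of simplices. Oriented \<open>n\<close>-chains are, as usual,
  the finitely supported functions on the orderings \<open>v = [v\<^sub>0, \<dots>, v\<^sub>n]\<close> of the
  \<open>n\<close>-simplices that change sign under odd permutations of \<open>v\<close> (extended by \<open>0\<close> to all other lists).
\<close>

definition chains :: "nat \<Rightarrow> 'v set set \<Rightarrow> ('v list \<Rightarrow> 'k::field) set" where
  "chains n K = {c. finite {v. c v \<noteq> 0} \<and>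
    (\<forall>v. c v \<noteq> 0 \<longrightarrow> length v = Suc n \<and> distinct v \<and> set v \<in> K) \<and>
    (\<forall>v \<pi>. \<pi> permutes {..<length v} \<longrightarrow> c (permute_list \<pi> v) = of_int (sign \<pi>) * c v)}"

text \<open>
  The oriented simplex \<open>[v\<^sub>0, \<dots>, v\<^sub>n]\<close>: the value is the sign of the permutation taking \<open>v\<close> to
  \<open>w\<close>, and the sum is \<open>0\<close> when \<open>v\<close> has a repeated vertex. These span the chains.
\<close>

definition oriented_simplex :: "'v list \<Rightarrow> 'v list \<Rightarrow> 'k::field" where
  "oriented_simplex v w =
    (\<Sum>\<pi> | \<pi> permutes {..<length v} \<and> permute_list \<pi> v = w. of_int (sign \<pi>))"

text \<open>
  The boundary \<open>\<partial>[v\<^sub>0, \<dots>, v\<^sub>n] = \<Sum>\<^sub>i (-1)\<^sup>i [v\<^sub>0, \<dots>, v\<^sub>i\<^sub>-\<^sub>1, v\<^sub>i\<^sub>+\<^sub>1, \<dots>, v\<^sub>n]\<close> and the chain map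
  \<open>[v\<^sub>0, \<dots>, v\<^sub>n] \<mapsto> [f v\<^sub>0, \<dots>, f v\<^sub>n]\<close> of a vertex map \<open>f\<close>, in terms of the values of a chain;
  lemmas \<open>boundary_oriented_simplex\<close> and \<open>chain_map_oriented_simplex\<close> below recover these
  formulas. The case \<open>w = []\<close> makes the boundary of \<open>0\<close>-chains vanish (homology is not reduced).
\<close>

definition boundary :: "('v list \<Rightarrow> 'k::field) \<Rightarrow> 'v list \<Rightarrow> 'k" where
  "boundary c w = (if w = [] then 0 else \<Sum>x | c (x # w) \<noteq> 0. c (x # w))"

definition chain_map :: "('v \<Rightarrow> 'w) \<Rightarrow> ('v list \<Rightarrow> 'k::field) \<Rightarrow> 'w list \<Rightarrow> 'k" where
  "chain_map f c w = (\<Sum>v | c v \<noteq> 0 \<and> map f v = w. c v)"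

definition cycles :: "nat \<Rightarrow> 'v set set \<Rightarrow> ('v list \<Rightarrow> 'k::field) set" where
  "cycles n K = {c \<in> chains n K. boundary c = (\<lambda>_. 0)}"

definition boundaries :: "nat \<Rightarrow> 'v set set \<Rightarrow> ('v list \<Rightarrow> 'k::field) set" where
  "boundaries n K = boundary ` chains (Suc n) K"

text \<open>
  The fields \<^const>\<open>mult\<close> and \<^const>\<open>one\<close> of a module record play no role for modules.
\<close>

definition cycle_space :: "nat \<Rightarrow> 'v set set \<Rightarrow> ('k::field, 'v list \<Rightarrow> 'k) module" where
  "cycle_space n K = \<lparr>carrier = cycles n K, mult = undefined, one = undefined,
    zero = (\<lambda>_. 0), add = (\<lambda>c d v. c v + d v), smult = (\<lambda>a c v. a * c v)\<rparr>"

definition quotient_space :: "('k, 'v) module \<Rightarrow> 'v set \<Rightarrow> ('k, 'v set) module" where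
  "quotient_space M N = \<lparr>carrier = a_rcosets\<^bsub>M\<^esub> N, mult = undefined, one = undefined,
    zero = N, add = set_add M, smult = (\<lambda>a A. \<Union>x\<in>A. N +>\<^bsub>M\<^esub> (a \<odot>\<^bsub>M\<^esub> x))\<rparr>"

definition homology :: "nat \<Rightarrow> 'v set set \<Rightarrow> ('k::field, ('v list \<Rightarrow> 'k) set) module" where
  "homology n K = quotient_space (cycle_space n K) (boundaries n K)"

text \<open>
  The map to \<open>H\<^sub>n(L)\<close> induced by a simplicial map with vertex map \<open>f\<close>: the class of \<open>z\<close> goes to
  the class of \<open>f\<^sub># z\<close>; the union is over the representatives \<open>z\<close> of the class \<open>A\<close>.
\<close>

definition homology_map ::
    "nat \<Rightarrow> 'w set set \<Rightarrow> ('v \<Rightarrow> 'w) \<Rightarrow> ('v list \<Rightarrow> 'k::field) set \<Rightarrow> ('w list \<Rightarrow> 'k) set" where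
  "homology_map n L f A = (\<Union>z\<in>A. boundaries n L +>\<^bsub>cycle_space n L\<^esub> chain_map f z)"


section \<open>Persistence modules\<close>

record ('k, 'v) persistence_module =
  space_at :: "real \<Rightarrow> ('k, 'v) module"
  space_map :: "real \<Rightarrow> real \<Rightarrow> 'v \<Rightarrow> 'v"

definition is_persistence_module :: "('k::field, 'v) persistence_module \<Rightarrow> bool" where
  "is_persistence_module F \<longleftrightarrow>
    (\<forall>r\<ge>0. vectorspace class_ring (space_at F r)) \<and>
    (\<forall>r s. 0 \<le> r \<and> r \<le> s \<longrightarrow>
      linear_map class_ring (space_at F r) (space_at F s) (space_map F r s)) \<and>
    (\<forall>r\<ge>0. \<forall>x\<in>carrier (space_at F r). space_map F r r x = x) \<and>
    (\<forall>r s t. 0 \<le> r \<and> r \<le> s \<and> s \<le> t \<longrightarrow>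
      (\<forall>x\<in>carrier (space_at F r). space_map F s t (space_map F r s x) = space_map F r t x))"

text \<open>The composite \<open>F \<circ> S\<^sub>c\<close>.\<close>

definition rescale ::
    "real \<Rightarrow> ('k, 'v) persistence_module \<Rightarrow> ('k, 'v) persistence_module" where
  "rescale c F = \<lparr>space_at = (\<lambda>r. space_at F (c * r)),
    space_map = (\<lambda>r s. space_map F (c * r) (c * s))\<rparr>"

definition natural_transformation ::
    "('k::field, 'v) persistence_module \<Rightarrow> ('k, 'w) persistence_module
      \<Rightarrow> (real \<Rightarrow> 'v \<Rightarrow> 'w) \<Rightarrow> bool" where
  "natural_transformation F G \<phi> \<longleftrightarrow>
    (\<forall>r\<ge>0. linear_map class_ring (space_at F r) (space_at G r) (\<phi> r)) \<and>
    (\<forall>r s. 0 \<le> r \<and> r \<le> s \<longrightarrow>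
      (\<forall>x\<in>carrier (space_at F r). \<phi> s (space_map F r s x) = space_map G r s (\<phi> r x)))"

definition approximated ::
    "real \<Rightarrow> ('k::field, 'v) persistence_module \<Rightarrow> ('k, 'w) persistence_module \<Rightarrow> bool" where
  "approximated c F G \<longleftrightarrow>
    is_persistence_module F \<and> is_persistence_module G \<and>
    (\<exists>\<phi> \<psi>. natural_transformation F (rescale c G) \<phi> \<and>
           natural_transformation G (rescale c F) \<psi> \<and>
           (\<forall>r\<ge>0. (\<forall>x\<in>carrier (space_at F r). \<psi> (c * r) (\<phi> r x) = space_map F r (c\<^sup>2 * r) x) \<and>
                  (\<forall>y\<in>carrier (space_at G r). \<phi> (c * r) (\<psi> r y) = space_map G r (c\<^sup>2 * r) y)))"

definition homology_nerve ::
    "nat \<Rightarrow> ('i, 'a) persistent_cover \<Rightarrow> ('k::field, ('i list \<Rightarrow> 'k) set) persistence_module" where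
  "homology_nerve n U = \<lparr>space_at = (\<lambda>r. homology n (nerve (cover_at U r))),
    space_map = (\<lambda>r s. homology_map n (nerve (cover_at U s)) (cover_map U r s))\<rparr>"

definition homology_conerve ::
    "nat \<Rightarrow> 'a set \<Rightarrow> ('i, 'a) persistent_cover
      \<Rightarrow> ('k::field, ('a list \<Rightarrow> 'k) set) persistence_module" where
  "homology_conerve n X U = \<lparr>space_at = (\<lambda>r. homology n (conerve X (cover_at U r))),
    space_map = (\<lambda>r s. homology_map n (conerve X (cover_at U s)) id)\<rparr>"


section \<open>Consistency of the definitions\<close>

lemma sum_oriented_simplex:
  "(\<Sum>u | oriented_simplex v u \<noteq> (0::'k::field) \<and> P u. oriented_simplex v u) =
   (\<Sum>\<pi> | \<pi> permutes {..<length v} \<and> P (permute_list \<pi> v). of_int (sign \<pi>) :: 'k)"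
proof -
  let ?Q = "{\<pi>. \<pi> permutes {..<length v} \<and> P (permute_list \<pi> v)}"
  let ?S = "(\<lambda>\<pi>. permute_list \<pi> v) ` ?Q"
  have finQ: "finite ?Q"
    by (rule finite_subset[OF _ finite_permutations[of "{..<length v}"]]) auto
  have sub: "{u. oriented_simplex v u \<noteq> (0::'k) \<and> P u} \<subseteq> ?S"
  proof
    fix u assume u: "u \<in> {u. oriented_simplex v u \<noteq> (0::'k) \<and> P u}"
    then have "{\<pi>. \<pi> permutes {..<length v} \<and> permute_list \<pi> v = u} \<noteq> {}"
      unfolding oriented_simplex_def by (metis (mono_tags, lifting) mem_Collect_eq sum.empty)
    with u show "u \<in> ?S" by auto
  qed
  have "(\<Sum>u | oriented_simplex v u \<noteq> (0::'k) \<and> P u. oriented_simplex v u) =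
        (\<Sum>u\<in>?S. oriented_simplex v u :: 'k)"
    using finQ sub by (intro sum.mono_neutral_left) auto
  also have "\<dots> = (\<Sum>u\<in>?S. \<Sum>\<pi> | \<pi> \<in> ?Q \<and> permute_list \<pi> v = u. of_int (sign \<pi>))"
    unfolding oriented_simplex_def by (intro sum.cong refl) auto
  also have "\<dots> = (\<Sum>\<pi>\<in>?Q. of_int (sign \<pi>))"
    using finQ by (intro sum.group) auto
  finally show ?thesis .
qed

lemma oriented_simplex_eq_0:
  assumes "\<not> distinct v"
  shows "oriented_simplex v w = (0::'k::field)"
proof -
  from assms obtain i j where ij: "i < length v" "j < length v" "i \<noteq> j" "v ! i = v ! j"
    by (auto simp: distinct_conv_nth)
  let ?t = "transpose i j"
  let ?Q = "{\<pi>. \<pi> permutes {..<length v} \<and> permute_list \<pi> v = w}"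
  have finQ: "finite ?Q"
    by (rule finite_subset[OF _ finite_permutations[of "{..<length v}"]]) auto
  have t: "?t permutes {..<length v}" using ij by (auto intro: permutes_swap_id)
  have vt: "v ! ?t k = v ! k" for k using ij by (auto simp: transpose_def)
  have tQ: "?t \<circ> \<pi> \<in> ?Q" if "\<pi> \<in> ?Q" for \<pi>
    using that t by (auto simp: permute_list_def vt intro: permutes_compose)
  have perm: "permutation \<pi>" if "\<pi> \<in> ?Q" for \<pi>
    using that by (auto intro: permutation_permutes[THEN iffD2])
  have even: "evenperm (?t \<circ> \<pi>) \<longleftrightarrow> \<not> evenperm \<pi>" if "\<pi> \<in> ?Q" for \<pi>
    using perm[OF that] ij by (simp add: evenperm_comp permutation_swap_id evenperm_swap)
  have "(\<Sum>\<pi>\<in>?Q. of_int (sign \<pi>) :: 'k) = (\<Sum>\<pi>\<in>?Q. if evenperm \<pi> then 1 else - 1)"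
    by (intro sum.cong refl) (simp add: sign_def)
  also have "\<dots> = (\<Sum>\<pi>\<in>?Q \<inter> Collect evenperm. 1) + (\<Sum>\<pi>\<in>?Q \<inter> - Collect evenperm. - 1)"
    by (rule sum.If_cases[OF finQ])
  also have "(\<Sum>\<pi>\<in>?Q \<inter> - Collect evenperm. - 1 :: 'k) = (\<Sum>\<pi>\<in>?Q \<inter> Collect evenperm. - 1)"
  proof (rule sum.reindex_bij_witness[of _ "\<lambda>\<pi>. ?t \<circ> \<pi>" "\<lambda>\<pi>. ?t \<circ> \<pi>"])
    show "?t \<circ> \<pi> \<in> ?Q \<inter> Collect evenperm" if "\<pi> \<in> ?Q \<inter> - Collect evenperm" for \<pi>
      using tQ[of \<pi>] even[of \<pi>] that by blast
    show "?t \<circ> \<pi> \<in> ?Q \<inter> - Collect evenperm" if "\<pi> \<in> ?Q \<inter> Collect evenperm" for \<pi>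
      using tQ[of \<pi>] even[of \<pi>] that by blast
  qed (simp_all add: fun_eq_iff)
  finally show ?thesis unfolding oriented_simplex_def by (simp add: sum_negf)
qed

lemma oriented_simplex_in_chains:
  assumes v: "length v = Suc n" "distinct v" "set v \<in> K"
  shows "(oriented_simplex v :: _ \<Rightarrow> 'k::field) \<in> chains n K"
proof -
  let ?P = "{\<pi>. \<pi> permutes {..<length v}}"
  have ex: "\<exists>\<pi>. \<pi> permutes {..<length v} \<and> permute_list \<pi> v = w"
    if "oriented_simplex v w \<noteq> (0::'k)" for w
    using that unfolding oriented_simplex_def
    by (metis (mono_tags, lifting) mem_Collect_eq sum.neutral)
  have "{w. oriented_simplex v w \<noteq> (0::'k)} \<subseteq> (\<lambda>\<pi>. permute_list \<pi> v) ` ?P"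
    using ex by blast
  then have "finite {w. oriented_simplex v w \<noteq> (0::'k)}"
    by (rule finite_subset) (simp add: finite_permutations)
  moreover have "length w = Suc n \<and> distinct w \<and> set w \<in> K"
    if "oriented_simplex v w \<noteq> (0::'k)" for w
    using ex[OF that] v by auto
  moreover have "oriented_simplex v (permute_list \<rho> w) = of_int (sign \<rho>) * (oriented_simplex v w :: 'k)"
    if \<rho>: "\<rho> permutes {..<length w}" for \<rho> w
  proof (cases "length w = length v")
    case False
    then have "permute_list \<pi> v \<noteq> u" if "length u = length w" for \<pi> and u :: "'a list"
      using that by (metis length_permute_list)
    then show ?thesis unfolding oriented_simplex_def by simp
  next
    case True
    have "oriented_simplex v (permute_list \<rho> w) =
        (\<Sum>\<pi> | \<pi> permutes {..<length v} \<and> permute_list \<pi> v = w. of_int (sign (\<pi> \<circ> \<rho>)) :: 'k)"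
      unfolding oriented_simplex_def
    proof (rule sum.reindex_bij_witness[of _ "\<lambda>\<pi>. \<pi> \<circ> \<rho>" "\<lambda>\<pi>. \<pi> \<circ> inv_into UNIV \<rho>"])
      fix \<pi> assume "\<pi> \<in> {\<pi>. \<pi> permutes {..<length v} \<and> permute_list \<pi> v = permute_list \<rho> w}"
      then have \<pi>: "\<pi> permutes {..<length v}" "permute_list \<pi> v = permute_list \<rho> w" by auto
      have r: "inv_into UNIV \<rho> permutes {..<length v}" using \<rho> True by (simp add: permutes_inv)
      show "\<pi> \<circ> inv_into UNIV \<rho> \<circ> \<rho> = \<pi>" using permutes_inv_o(2)[OF \<rho>] by (simp add: o_assoc[symmetric])
      then show "of_int (sign (\<pi> \<circ> inv_into UNIV \<rho> \<circ> \<rho>)) = (of_int (sign \<pi>) :: 'k)" by simp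
      have "permute_list (\<pi> \<circ> inv_into UNIV \<rho>) v = permute_list (\<rho> \<circ> inv_into UNIV \<rho>) w"
        using permute_list_compose[of "inv_into UNIV \<rho>" v \<pi>] permute_list_compose[of "inv_into UNIV \<rho>" w \<rho>] r \<pi> True by simp
      then show "\<pi> \<circ> inv_into UNIV \<rho> \<in> {\<pi>. \<pi> permutes {..<length v} \<and> permute_list \<pi> v = w}"
        using \<pi> r permutes_inv_o(1)[OF \<rho>] by (auto intro: permutes_compose)
    next
      fix \<pi> assume \<pi>: "\<pi> \<in> {\<pi>. \<pi> permutes {..<length v} \<and> permute_list \<pi> v = w}"
      show "\<pi> \<circ> \<rho> \<circ> inv_into UNIV \<rho> = \<pi>" using permutes_inv_o(1)[OF \<rho>] by (simp add: o_assoc[symmetric])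
      show "\<pi> \<circ> \<rho> \<in> {\<pi>. \<pi> permutes {..<length v} \<and> permute_list \<pi> v = permute_list \<rho> w}"
        using \<pi> \<rho> True by (auto intro: permutes_compose simp: permute_list_compose)
    qed
    also have "\<dots> = (\<Sum>\<pi> | \<pi> permutes {..<length v} \<and> permute_list \<pi> v = w.
        of_int (sign \<rho>) * of_int (sign \<pi>))"
      using \<rho> by (intro sum.cong refl)
        (auto simp: sign_compose permutation_permutes[THEN iffD2, OF exI[of _ "{..<length v}"]]
          permutation_permutes[THEN iffD2, OF exI[of _ "{..<length w}"]])
    finally show ?thesis unfolding oriented_simplex_def by (simp add: sum_distrib_left)
  qed
  ultimately show ?thesis unfolding chains_def by simp
qed

lemma chain_map_oriented_simplex:
  "chain_map f (oriented_simplex v) = (oriented_simplex (map f v) :: _ \<Rightarrow> 'k::field)"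
proof
  fix w
  show "chain_map f (oriented_simplex v) w = (oriented_simplex (map f v) w :: 'k)"
    unfolding chain_map_def sum_oriented_simplex
    unfolding oriented_simplex_def
    by (intro sum.cong refl) (auto simp: permute_list_map)
qed

lemma permute_list_permutation_insert:
  assumes v: "length v = Suc m" and i: "i < Suc m" and p: "p permutes {..<m}"
  shows "permute_list (permutation_insert 0 i p) v =
         v ! i # permute_list p (take i v @ drop (Suc i) v)"
proof (rule nth_equalityI)
  fix k assume k: "k < length (permute_list (permutation_insert 0 i p) v)"
  show "permute_list (permutation_insert 0 i p) v ! k =
        (v ! i # permute_list p (take i v @ drop (Suc i) v)) ! k"
  proof (cases k)
    case 0
    then show ?thesis using v by (simp add: permute_list_def del: upt_Suc)
  next
    case (Suc l)
    with k v have l: "l < m" by simp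
    then have pl: "p l < m" using permutes_in_image[OF p] by auto
    show ?thesis
      using Suc l pl v i
      by (auto simp: permute_list_def permutation_insert_expand nth_append nth_Cons
          simp del: upt_Suc)
  qed
qed (use v i in auto)

lemma boundary_oriented_simplex:
  assumes "2 \<le> length v"
  shows "boundary (oriented_simplex v) w =
    (\<Sum>i<length v. (-1) ^ i * oriented_simplex (take i v @ drop (Suc i) v) w :: 'k::field)"
proof (cases "w = []")
  case True
  have "oriented_simplex (take i v @ drop (Suc i) v) [] = (0::'k)" if "i < length v" for i
  proof -
    from that assms have "0 < length (take i v @ drop (Suc i) v)" by simp
    then have "permute_list \<pi> (take i v @ drop (Suc i) v) \<noteq> []" for \<pi>
      by (metis length_0_conv length_permute_list less_irrefl)
    then show ?thesis unfolding oriented_simplex_def by simp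
  qed
  with True show ?thesis by (simp add: boundary_def)
next
  case False
  from assms obtain m where m: "length v = Suc m" by (cases v) auto
  have N: "{..<length v} = {0..<Suc m}" "{..<m} = {0..<m}" using m by auto
  have "(boundary (oriented_simplex v) w :: 'k) =
      (\<Sum>x | oriented_simplex v (x # w) \<noteq> (0::'k). oriented_simplex v (x # w))"
    using False by (simp add: boundary_def)
  also have "\<dots> = (\<Sum>u | oriented_simplex v u \<noteq> (0::'k) \<and> (u \<noteq> [] \<and> tl u = w). oriented_simplex v u)"
    by (rule sum.reindex_bij_witness[of _ hd "\<lambda>x. x # w"]) auto
  also have "\<dots> = (\<Sum>\<pi> | \<pi> permutes {..<length v} \<and>
      (permute_list \<pi> v \<noteq> [] \<and> tl (permute_list \<pi> v) = w). of_int (sign \<pi>))"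
    by (rule sum_oriented_simplex)
  also have "{\<pi>. \<pi> permutes {..<length v} \<and> (permute_list \<pi> v \<noteq> [] \<and> tl (permute_list \<pi> v) = w)} =
      (\<lambda>(i, p). permutation_insert 0 i p) `
        (SIGMA i:{..<length v}. {p. p permutes {..<m} \<and> permute_list p (take i v @ drop (Suc i) v) = w})"
    (is "?L = ?f ` ?R")
  proof (intro equalityI subsetI)
    fix \<pi> assume \<pi>: "\<pi> \<in> ?L"
    define i where "i = \<pi> 0"
    have i: "i < Suc m" using \<pi> permutes_in_image[of \<pi> "{..<length v}" 0] m by (auto simp: i_def)
    have "\<pi> \<in> {p. p permutes {0..<Suc m} \<and> p 0 = i}" using \<pi> N by (auto simp: i_def)
    then obtain p where p: "p permutes {0..<m}" "\<pi> = permutation_insert 0 i p"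
      unfolding permutation_fix[OF zero_less_Suc i] by auto
    then have "permute_list \<pi> v = v ! i # permute_list p (take i v @ drop (Suc i) v)"
      using permute_list_permutation_insert[OF m i] N by simp
    with \<pi> p i m N show "\<pi> \<in> ?f ` ?R" by (intro image_eqI[of _ _ "(i, p)"]) auto
  next
    fix \<pi> assume "\<pi> \<in> ?f ` ?R"
    then obtain i p where ip: "i < Suc m" "p permutes {..<m}"
        "permute_list p (take i v @ drop (Suc i) v) = w" "\<pi> = permutation_insert 0 i p"
      using m by auto
    then show "\<pi> \<in> ?L"
      using permute_list_permutation_insert[OF m ip(1,2)] N
        permutation_insert_permutes[of p m 0 i] by simp
  qed
  also have "(\<Sum>\<pi>\<in>?f ` ?R. of_int (sign \<pi>)) =
      (\<Sum>x\<in>?R. of_int (sign (?f x)) :: 'k)"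
  proof (rule sum.reindex_cong[OF _ refl])
    show "inj_on ?f ?R"
    proof (rule inj_onI, clarsimp)
      fix i p i' p'
      assume *: "permutation_insert 0 i p = permutation_insert 0 i' p'"
        "i < length v" "i' < length v" "p permutes {..<m}" "p' permutes {..<m}"
      from fun_cong[OF *(1), of 0] have "i = i'" by simp
      with * show "i = i' \<and> p = p'"
        using inj_onD[OF permutation_insert_inj_on[of 0 m i]] N m by auto
    qed
  qed simp
  also have "\<dots> = (\<Sum>x\<in>?R. case x of (i, p) \<Rightarrow> (-1) ^ i * of_int (sign p))"
    using signof_permutation_insert[of _ m 0, where 'a='k] m N by (intro sum.cong refl) auto
  also have "\<dots> = (\<Sum>i<length v. \<Sum>p | p permutes {..<m} \<and>
      permute_list p (take i v @ drop (Suc i) v) = w. (-1) ^ i * of_int (sign p))"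
    using finite_permutations[of "{..<m}"] by (intro sum.Sigma[symmetric]) auto
  also have "\<dots> = (\<Sum>i<length v. (-1) ^ i * oriented_simplex (take i v @ drop (Suc i) v) w)"
    unfolding oriented_simplex_def using m by (intro sum.cong refl) (auto simp: sum_distrib_left)
  finally show ?thesis .
qed

end

(* Dowker duality carries the proof. A cover of X is a relation R between indices and points; its
   nerve is the complex of finite sets of indices related to a common point, and its co-nerve is the
   same complex for the converse of R. Both receive a simplicial map, a projection, from the complex
   of bicliques of R, that is of finite sets S of pairs in R with fst S \<times> snd S \<subseteq> R. The fibre of
   a projection over a simplex is contractible, so by the method of acyclic carriers (Quillen's
   fibre lemma) each projection is a chain homotopy equivalence, and H Nrv is isomorphic to H CoNrv.
   A refinement map acts on bicliques compatibly with both projections and acts as the identity on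
   points, so the isomorphism is natural in all refinement maps. On co-nerves every refinement map
   induces an inclusion; hence H CoNrv U and H CoNrv V are c-approximated even though the
   refinement maps between U and V are not compatible with each other, and the other two
   approximations are transported along the isomorphism. *)

theory Submission
  imports Defs
begin

section \<open>Augmented alternating chains\<close>

text \<open>The two nerves live on unrelated vertex types, whereas co-nerves share the points of
  \<open>X\<close>, which removes every choice of refinement map; the price is that Dowker's
  isomorphism must be natural in \<open>r\<close>. Homotopy inverses of the projections are picked
  arbitrarily for each relation, so naturality cannot be expected for chains. It holds in homology,
  since an inverse of maps that commute strictly with refinements commutes with them there.
  Bicliques supply such maps: both projections are simplicial, so neither a subdivision nor a choice
  of common witnesses enters them. Two features of the chain model shape the algebra. Chains are
  alternating functions without chosen orientations, so a lift through a carrier is not defined on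
  generators; it is a linear operator, and acyclicity is recorded as a linear operator that bounds
  cycles. Moreover, carrier inductions want a uniform start, so complexes contain the empty simplex;
  the return to unreduced homology costs a separate look at dimension 0.\<close>

definition alternating :: "('v list \<Rightarrow> 'k::field) \<Rightarrow> bool" where
  "alternating c \<longleftrightarrow> (\<forall>xs x y ys. c (xs @ x # y # ys) = - c (xs @ y # x # ys))"

lemma alternatingD: "alternating c \<Longrightarrow> c (xs @ x # y # ys) = - c (xs @ y # x # ys)"
  unfolding alternating_def by blast

lemma alternating_move:
  assumes "alternating c"
  shows "c (xs @ ms @ y # zs) = (-1) ^ length ms * c (xs @ y # ms @ zs)"
proof (induction ms arbitrary: xs)
  case (Cons m ms)
  have "c (xs @ (m # ms) @ y # zs) = c ((xs @ [m]) @ ms @ y # zs)" by simp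
  also have "\<dots> = (-1) ^ length ms * c (xs @ m # y # ms @ zs)" unfolding Cons.IH by simp
  also have "c (xs @ m # y # ms @ zs) = - c (xs @ y # m # ms @ zs)"
    by (rule alternatingD[OF assms])
  finally show ?case by simp
qed simp

text \<open>Moving the later entry across \<open>ms\<close> makes the two entries adjacent on either
  side; both moves have the same sign, so only the sign of the adjacent swap remains.\<close>

lemma alternating_swap:
  assumes "alternating c"
  shows "c (xs @ x # ms @ y # zs) = - c (xs @ y # ms @ x # zs)"
proof -
  have "c (xs @ x # ms @ y # zs) = (-1) ^ length ms * c (xs @ x # y # ms @ zs)"
    using alternating_move[OF assms, of "xs @ [x]" ms y zs] by simp
  also have "c (xs @ x # y # ms @ zs) = - c (xs @ y # x # ms @ zs)"
    by (rule alternatingD[OF assms])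
  also have "c (xs @ y # ms @ x # zs) = (-1) ^ length ms * c (xs @ y # x # ms @ zs)"
    using alternating_move[OF assms, of "xs @ [y]" ms x zs] by simp
  ultimately show ?thesis by simp
qed

lemma permute_list_transpose_append:
  "permute_list (transpose (length xs) (Suc (length xs + length ms))) (xs @ x # ms @ y # zs) =
    xs @ y # ms @ x # zs"
  by (rule nth_equalityI)
    (auto simp: permute_list_def nth_append nth_Cons transpose_def split: nat.splits simp del: upt_Suc)

lemma list_split2:
  assumes "i < j" "j < length v"
  obtains xs x ms y zs where "v = xs @ x # ms @ y # zs" "i = length xs" "j = Suc (length xs + length ms)"
proof
  show "v = take i v @ v ! i # take (j - Suc i) (drop (Suc i) v) @ v ! j # drop (Suc j) v"
    using assms by (metis Cons_nth_drop_Suc append_take_drop_id drop_drop le_add_diff_inverse2 less_iff_Suc_add 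
        order.strict_trans Suc_leI)
  show "i = length (take i v)" "j = Suc (length (take i v) + length (take (j - Suc i) (drop (Suc i) v)))"
    using assms by auto
qed

text \<open>A permutation is a product of transpositions, and each transposition contributes one
  sign.\<close>

lemma alternating_permute:
  assumes c: "alternating c" and p: "p permutes {..<length v}"
  shows "c (permute_list p v) = of_int (sign p) * c v"
proof -
  have neg: "c (permute_list (transpose a b) v) = - c v"
    if ab: "a < b" "b < length v" for a b v
    using list_split2[OF ab] by (metis alternating_swap[OF c] permute_list_transpose_append)
  define n where "n = length v"
  have fin: "finite {..<n}" by simp
  have "p permutes {..<n}" using p n_def by simp
  then have "\<forall>v. length v = n \<longrightarrow> c (permute_list p v) = of_int (sign p) * c v"
  proof (induction p rule: permutes_induct[OF _ fin, consumes 1, case_names id swap])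
    case (swap a b p)
    show ?case
    proof (intro allI impI)
      fix v :: "'a list" assume v: "length v = n"
      have t: "c (permute_list (transpose a b) v) = - c v"
        using swap(1-3) v neg
        by (metis lessThan_iff linorder_neqE_nat transpose_commute)
      have "permutation p" using swap by (auto intro: permutation_permutes[THEN iffD2])
      then have "sign (transpose a b \<circ> p) = - sign p"
        using swap by (simp add: sign_compose permutation_swap_id sign_swap_id)
      then show "c (permute_list (transpose a b \<circ> p) v) = of_int (sign (transpose a b \<circ> p)) * c v"
        using swap v t by (simp add: permute_list_compose)
    qed
  qed simp
  then show ?thesis using n_def by simp
qed

text \<open>Adjacent transpositions generate the symmetric group, so the local condition is the sign
  rule of \<open>chains\<close>. The local form suits boundaries, cones and parts of chains; the
  global form suits chain maps.\<close>

lemma alternating_iff_permute: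
  fixes c :: "'v list \<Rightarrow> 'k::field"
  shows "alternating c \<longleftrightarrow>
    (\<forall>v \<pi>. \<pi> permutes {..<length v} \<longrightarrow> c (permute_list \<pi> v) = of_int (sign \<pi>) * c v)"
proof (intro iffI)
  assume *: "\<forall>v \<pi>. \<pi> permutes {..<length v} \<longrightarrow> c (permute_list \<pi> v) = of_int (sign \<pi>) * c v"
  show "alternating c" unfolding alternating_def
  proof (intro allI)
    fix xs ys :: "'v list" and x y
    let ?t = "transpose (length xs) (Suc (length xs))"
    have "?t permutes {..<length (xs @ y # x # ys)}" by (auto intro: permutes_swap_id)
    with * have "c (permute_list ?t (xs @ y # x # ys)) = of_int (sign ?t) * c (xs @ y # x # ys)"
      by blast
    then show "c (xs @ x # y # ys) = - c (xs @ y # x # ys)"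
      using permute_list_transpose_append[of xs "[]" y x ys] by (simp add: sign_swap_id)
  qed
qed (use alternating_permute in blast)

text \<open>
  Chains are graded here by the number of vertices, one more than the dimension, and complexes
  contain the empty simplex, so \<open>[]\<close> spans degree \<open>0\<close>. With \<open>aug_boundary\<close> below this is the augmented
  chain complex, in which coning needs no special case in the lowest dimension.
\<close>

definition alt_chains :: "nat \<Rightarrow> 'v set set \<Rightarrow> ('v list \<Rightarrow> 'k::field) set" where
  "alt_chains n K = {c. finite {v. c v \<noteq> 0} \<and>
    (\<forall>v. c v \<noteq> 0 \<longrightarrow> length v = n \<and> distinct v \<and> set v \<in> K) \<and> alternating c}"

text \<open>The lists in degree \<open>Suc n\<close> are nonempty, so adding the empty simplex adds
  no chain there.\<close>

lemma chains_eq_alt_chains: "chains n K = alt_chains (Suc n) (insert {} K)"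
  unfolding chains_def alt_chains_def alternating_iff_permute by fastforce

lemma alt_chainsI:
  assumes "finite {v. c v \<noteq> 0}" "\<And>v. c v \<noteq> 0 \<Longrightarrow> length v = n \<and> distinct v \<and> set v \<in> K"
    "alternating c"
  shows "c \<in> alt_chains n K"
  using assms unfolding alt_chains_def by blast

lemma alt_chainsD:
  assumes "c \<in> alt_chains n K"
  shows "finite {v. c v \<noteq> 0}" "alternating c"
    "c v \<noteq> 0 \<Longrightarrow> length v = n" "c v \<noteq> 0 \<Longrightarrow> distinct v" "c v \<noteq> 0 \<Longrightarrow> set v \<in> K"
  using assms unfolding alt_chains_def by blast+

lemma alt_chains_mono: "c \<in> alt_chains n K \<Longrightarrow> K \<subseteq> L \<Longrightarrow> c \<in> alt_chains n L"
  unfolding alt_chains_def by blast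

lemma zero_in_alt_chains [simp]: "(\<lambda>_. 0) \<in> alt_chains n K"
  unfolding alt_chains_def alternating_def by simp

lemma lincomb_in_alt_chains:
  assumes "c \<in> alt_chains n K" "d \<in> alt_chains n K"
  shows "(\<lambda>v. a * c v + b * d v) \<in> alt_chains n K"
proof (rule alt_chainsI)
  show "finite {v. a * c v + b * d v \<noteq> 0}"
    by (rule finite_subset[OF _ finite_UnI[OF alt_chainsD(1)[OF assms(1)] alt_chainsD(1)[OF assms(2)]]]) auto
  show "length v = n \<and> distinct v \<and> set v \<in> K" if "a * c v + b * d v \<noteq> 0" for v
  proof -
    from that have "c v \<noteq> 0 \<or> d v \<noteq> 0" by auto
    then show ?thesis using alt_chainsD(3-5)[OF assms(1)] alt_chainsD(3-5)[OF assms(2)] by blast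
  qed
  show "alternating (\<lambda>v. a * c v + b * d v)"
    unfolding alternating_def
  proof (intro allI)
    fix xs x y ys
    show "a * c (xs @ x # y # ys) + b * d (xs @ x # y # ys) =
      - (a * c (xs @ y # x # ys) + b * d (xs @ y # x # ys))"
      unfolding alternatingD[OF alt_chainsD(2)[OF assms(1)], of xs x y]
        alternatingD[OF alt_chainsD(2)[OF assms(2)], of xs x y] by simp
  qed
qed

lemma add_in_alt_chains:
  "c \<in> alt_chains n K \<Longrightarrow> d \<in> alt_chains n K \<Longrightarrow> (\<lambda>v. c v + d v) \<in> alt_chains n K"
  using lincomb_in_alt_chains[of c n K d 1 1] by simp

lemma diff_in_alt_chains:
  "c \<in> alt_chains n K \<Longrightarrow> d \<in> alt_chains n K \<Longrightarrow> (\<lambda>v. c v - d v) \<in> alt_chains n K"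
  using lincomb_in_alt_chains[of c n K d 1 "-1"] by simp

lemma sum_in_alt_chains:
  assumes "\<And>i. i \<in> S \<Longrightarrow> f i \<in> alt_chains n K"
  shows "(\<lambda>v. \<Sum>i\<in>S. f i v) \<in> alt_chains n K"
  using assms
proof (induction S rule: infinite_finite_induct)
  case (insert x F)
  then have "(\<lambda>v. f x v + (\<Sum>i\<in>F. f i v)) \<in> alt_chains n K"
    by (intro add_in_alt_chains) auto
  with insert.hyps show ?case by simp
qed simp_all

text \<open>Alternation moves a deleted vertex to the front, so summing over the first entry
  reproduces the usual signed faces. At \<open>[]\<close> the value is the sum of the coefficients
  of the vertices, the augmentation, which \<open>boundary\<close> replaces by 0.\<close>

definition aug_boundary :: "('v list \<Rightarrow> 'k::field) \<Rightarrow> 'v list \<Rightarrow> 'k" where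
  "aug_boundary c w = (\<Sum>x | c (x # w) \<noteq> 0. c (x # w))"

definition simplicial :: "'v set set \<Rightarrow> bool" where
  "simplicial K \<longleftrightarrow> (\<forall>\<sigma>\<in>K. \<forall>\<rho>\<subseteq>\<sigma>. \<rho> \<in> K)"

lemma finite_heads: "finite {v. c v \<noteq> (0::'k::zero)} \<Longrightarrow> finite {x. c (x # w) \<noteq> 0}"
  by (rule finite_subset[of _ "hd ` {v. c v \<noteq> 0}"]) force+

lemma aug_boundary_eq_sum:
  assumes "finite S" "\<And>x. c (x # w) \<noteq> 0 \<Longrightarrow> x \<in> S"
  shows "aug_boundary c w = (\<Sum>x\<in>S. c (x # w))"
  unfolding aug_boundary_def using assms by (intro sum.mono_neutral_left) auto

definition vertices :: "('v list \<Rightarrow> 'k::field) \<Rightarrow> 'v set" where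
  "vertices c = (\<Union>v\<in>{v. c v \<noteq> 0}. set v)"

lemma finite_vertices: "finite {v. c v \<noteq> 0} \<Longrightarrow> finite (vertices c)"
  unfolding vertices_def by auto

lemma in_vertices: "c v \<noteq> 0 \<Longrightarrow> x \<in> set v \<Longrightarrow> x \<in> vertices c"
  unfolding vertices_def by blast

lemma aug_boundary_lincomb:
  assumes "finite {v. c v \<noteq> 0}" "finite {v. d v \<noteq> 0}"
  shows "aug_boundary (\<lambda>v. a * c v + b * d v) w = a * aug_boundary c w + b * aug_boundary d w"
proof -
  let ?S = "{x. c (x # w) \<noteq> 0} \<union> {x. d (x # w) \<noteq> 0}"
  have fin: "finite ?S" using assms by (simp add: finite_heads)
  show ?thesis
    using fin by (subst (1 2 3) aug_boundary_eq_sum[of ?S])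
      (auto simp: sum.distrib sum_distrib_left)
qed

lemma aug_boundary_in_alt_chains:
  assumes c: "c \<in> alt_chains (Suc n) K" and K: "simplicial K"
  shows "aug_boundary c \<in> alt_chains n K"
proof (rule alt_chainsI)
  have nz: "\<exists>x. c (x # w) \<noteq> 0" if "aug_boundary c w \<noteq> 0" for w
    using that unfolding aug_boundary_def by (metis (mono_tags, lifting) mem_Collect_eq sum.neutral)
  then have "{w. aug_boundary c w \<noteq> 0} \<subseteq> tl ` {v. c v \<noteq> 0}" by force
  then show "finite {w. aug_boundary c w \<noteq> 0}"
    using alt_chainsD(1)[OF c] finite_surj by blast
  show "length w = n \<and> distinct w \<and> set w \<in> K" if "aug_boundary c w \<noteq> 0" for w
    using nz[OF that] alt_chainsD(3-5)[OF c] K unfolding simplicial_def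
    by (metis distinct.simps(2) length_Cons nat.inject set_subset_Cons)
  show "alternating (aug_boundary c)"
    unfolding alternating_def
  proof (intro allI)
    fix xs x y ys
    have *: "c (z # xs @ x # y # ys) = - c (z # xs @ y # x # ys)" for z
      using alternatingD[OF alt_chainsD(2)[OF c], of "z # xs" x y ys] by simp
    show "aug_boundary c (xs @ x # y # ys) = - aug_boundary c (xs @ y # x # ys)"
      unfolding aug_boundary_def * by (simp add: sum_negf)
  qed
qed

text \<open>The diagonal gets its own hypothesis because antisymmetry does not force it to vanish in
  characteristic 2.\<close>

lemma sum_antisymmetric_zero:
  fixes F :: "'v \<Rightarrow> 'v \<Rightarrow> 'k::ab_group_add"
  assumes "finite S" "\<And>x y. F x y = - F y x" "\<And>x. F x x = 0"
  shows "(\<Sum>x\<in>S. \<Sum>y\<in>S. F x y) = 0"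
  using assms(1)
proof induction
  case (insert a S)
  have "(\<Sum>y\<in>S. F a y) = (\<Sum>y\<in>S. - F y a)" by (rule sum.cong[OF refl]) (rule assms(2))
  then show ?case using insert assms(3) by (simp add: sum.distrib sum_negf)
qed simp

text \<open>The two deleted vertices form an ordered pair. Exchanging them changes the sign, and
  equal vertices do not occur because chains live on lists with distinct entries.\<close>

lemma aug_boundary_aug_boundary:
  assumes c: "c \<in> alt_chains n K"
  shows "aug_boundary (aug_boundary c) w = 0"
proof -
  have fin: "finite (vertices c)" using c by (simp add: alt_chainsD(1) finite_vertices)
  have 1: "aug_boundary c u = (\<Sum>x\<in>vertices c. c (x # u))" for u
    by (rule aug_boundary_eq_sum[OF fin]) (meson in_vertices list.set_intros(1))
  have "aug_boundary (aug_boundary c) w = (\<Sum>y\<in>vertices c. aug_boundary c (y # w))"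
  proof (rule aug_boundary_eq_sum[OF fin])
    fix y assume "aug_boundary c (y # w) \<noteq> 0"
    then obtain x where "c (x # y # w) \<noteq> 0" unfolding 1 by (meson sum.neutral)
    then show "y \<in> vertices c" by (meson in_vertices list.set_intros)
  qed
  also have "\<dots> = (\<Sum>y\<in>vertices c. \<Sum>x\<in>vertices c. c (x # y # w))" unfolding 1 ..
  also have "\<dots> = 0"
  proof (rule sum_antisymmetric_zero[OF fin])
    show "c (x # y # w) = - c (y # x # w)" for x y
      using alternatingD[OF alt_chainsD(2)[OF c], of "[]" x y w] by simp
    show "c (x # x # w) = 0" for x
      using alt_chainsD(4)[OF c, of "x # x # w"] by auto
  qed
  finally show ?thesis .
qed

text \<open>The join of the vertex \<open>a\<close> with the chain \<open>z\<close>: if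
  \<open>a\<close> occurs exactly once in a list, the value is that of \<open>z\<close> on the list
  without \<open>a\<close>, with sign given by the position of \<open>a\<close>; otherwise it is 0.
  Simplices of \<open>z\<close> that already contain \<open>a\<close> are thus sent to 0.\<close>

primrec cone :: "'v \<Rightarrow> ('v list \<Rightarrow> 'k::field) \<Rightarrow> 'v list \<Rightarrow> 'k" where
  "cone a z [] = 0"
| "cone a z (x # w) = (if x = a then if a \<in> set w then 0 else z w else - cone a (\<lambda>u. z (x # u)) w)"

lemma cone_lincomb: "cone a (\<lambda>v. s * c v + t * d v) w = s * cone a c w + t * cone a d w"
  by (induction w arbitrary: c d) (auto simp: algebra_simps)

lemma cone_zero [simp]: "cone a (\<lambda>_. 0) w = 0"
  by (induction w) auto

lemma cone_uminus: "cone a (\<lambda>v. - c v) w = - cone a c w"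
  using cone_lincomb[of a "-1" c 0 c w] by simp

lemma cone_sum: "cone a (\<lambda>v. \<Sum>i\<in>S. f i v) w = (\<Sum>i\<in>S. cone a (f i) w)"
  by (induction w arbitrary: f) (auto simp: sum_negf)

lemma cone_nonzero:
  "cone a z w \<noteq> 0 \<Longrightarrow> a \<in> set w \<and> a \<notin> set (remove1 a w) \<and> z (remove1 a w) \<noteq> 0"
  by (induction w arbitrary: z) (auto split: if_splits)

lemma alternating_Cons: "alternating z \<Longrightarrow> alternating (\<lambda>u. z (x # u))"
  unfolding alternating_def by (metis append_Cons)

lemma alternating_cone:
  assumes "alternating z" shows "alternating (cone a z)"
proof -
  have "cone a z (xs @ x # y # ys) = - cone a z (xs @ y # x # ys)" for xs x y ys
    using assms
  proof (induction xs arbitrary: z)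
    case Nil
    have "(\<lambda>u. z (x # y # u)) = (\<lambda>u. - z (y # x # u))"
      using alternatingD[OF Nil, of "[]" x y] by (intro ext) simp
    then show ?case by (auto simp: cone_uminus)
  next
    case (Cons b xs)
    then show ?case
      using Cons.IH[OF alternating_Cons[OF Cons.prems, of b]] alternatingD[OF Cons.prems, of xs x y ys]
      by auto
  qed
  then show ?thesis unfolding alternating_def by blast
qed

lemma cone_in_alt_chains:
  assumes z: "z \<in> alt_chains n D" and B: "\<And>\<tau>. \<tau> \<in> D \<Longrightarrow> insert a \<tau> \<in> B"
  shows "cone a z \<in> alt_chains (Suc n) B"
proof (rule alt_chainsI)
  have *: "length w = Suc n \<and> distinct w \<and> set w = insert a (set (remove1 a w)) \<and> z (remove1 a w) \<noteq> 0"
    if "cone a z w \<noteq> 0" for w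
  proof -
    from cone_nonzero[OF that] have w: "a \<in> set w" "a \<notin> set (remove1 a w)" "z (remove1 a w) \<noteq> 0" by auto
    then have "mset w = mset (a # remove1 a w)" by simp
    then have "length w = Suc (length (remove1 a w))" "set w = insert a (set (remove1 a w))"
      "distinct w = distinct (a # remove1 a w)"
      by (metis length_Cons mset_eq_length, metis list.simps(15) set_mset_mset,
          metis mset_eq_imp_distinct_iff)
    then show ?thesis using w alt_chainsD(3,4)[OF z w(3)] by simp
  qed
  have "{w. cone a z w \<noteq> 0} \<subseteq> {w. set w \<subseteq> insert a (vertices z) \<and> length w = Suc n}"
    using * in_vertices[of z] by blast
  then show "finite {w. cone a z w \<noteq> 0}"
    by (rule finite_subset) (simp add: finite_lists_length_eq finite_vertices alt_chainsD(1)[OF z])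
  show "length w = Suc n \<and> distinct w \<and> set w \<in> B" if "cone a z w \<noteq> 0" for w
    using *[OF that] alt_chainsD(5)[OF z] B by metis
  show "alternating (cone a z)" by (rule alternating_cone[OF alt_chainsD(2)[OF z]])
qed

text \<open>Coning puts \<open>a\<close> back at its place in \<open>w\<close>; the sign of this
  move cancels the sign of bringing \<open>a\<close> to the front of \<open>z\<close>.\<close>

lemma cone_Cons_same:
  assumes z: "z \<in> alt_chains n K"
  shows "cone a (\<lambda>u. z (a # u)) w = (if a \<in> set w then z w else 0)"
proof (cases "a \<in> set w")
  case False
  then have "cone a (\<lambda>u. z (a # u)) w = 0" using cone_nonzero by metis
  with False show ?thesis by simp
next
  case True
  then obtain xs ys where w: "w = xs @ a # ys" and xs: "a \<notin> set xs" by (meson split_list_first)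
  show ?thesis
  proof (cases "a \<in> set ys")
    case True
    then have "cone a (\<lambda>u. z (a # u)) w = 0" using cone_nonzero[of a _ w] w xs by (auto simp: remove1_append)
    moreover have "z w = 0" using True w alt_chainsD(4)[OF z, of w] by auto
    ultimately show ?thesis by simp
  next
    case False
    have "cone a u (xs @ a # ys) = (-1) ^ length xs * u (xs @ ys)" for u :: "'a list \<Rightarrow> 'b"
      using xs by (induction xs arbitrary: u) (auto simp: False)
    then show ?thesis using w alternating_move[OF alt_chainsD(2)[OF z], of "[]" xs a ys] by simp
  qed
qed

text \<open>The cone formula, valid in every degree thanks to the augmentation. The head
  \<open>a\<close> yields the part of \<open>z\<close> on lists without \<open>a\<close>. The other
  heads give the cone over the boundary of \<open>z\<close> except for its summand at
  \<open>a\<close>, and by \<open>cone_Cons_same\<close> this missing summand is the part of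
  \<open>z\<close> on lists with \<open>a\<close>.\<close>

lemma aug_boundary_cone:
  assumes z: "z \<in> alt_chains n K"
  shows "aug_boundary (cone a z) w = z w - cone a (aug_boundary z) w"
proof -
  let ?S = "insert a (vertices z)"
  have fin: "finite ?S" using z by (simp add: alt_chainsD(1) finite_vertices)
  have 1: "aug_boundary z = (\<lambda>u. \<Sum>x\<in>?S. z (x # u))"
    by (rule ext, rule aug_boundary_eq_sum[OF fin]) (meson in_vertices insertCI list.set_intros(1))
  have "aug_boundary (cone a z) w = (\<Sum>x\<in>?S. cone a z (x # w))"
  proof (rule aug_boundary_eq_sum[OF fin])
    fix x assume "cone a z (x # w) \<noteq> 0"
    then have "z (remove1 a (x # w)) \<noteq> 0" using cone_nonzero by metis
    then show "x \<in> ?S" using in_vertices[of z _ x] by (cases "x = a") auto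
  qed
  also have "\<dots> = (if a \<in> set w then 0 else z w) - (\<Sum>x\<in>?S - {a}. cone a (\<lambda>u. z (x # u)) w)"
    using fin by (subst sum.remove[of ?S a]) (auto simp: sum_negf[symmetric] intro!: sum.cong)
  also have "(\<Sum>x\<in>?S - {a}. cone a (\<lambda>u. z (x # u)) w) =
      (\<Sum>x\<in>?S. cone a (\<lambda>u. z (x # u)) w) - cone a (\<lambda>u. z (a # u)) w"
    using sum.remove[OF fin, of a "\<lambda>x. cone a (\<lambda>u. z (x # u)) w"] by simp
  also have "(\<Sum>x\<in>?S. cone a (\<lambda>u. z (x # u)) w) = cone a (aug_boundary z) w"
    unfolding 1 cone_sum ..
  also have "cone a (\<lambda>u. z (a # u)) w = (if a \<in> set w then z w else 0)"
    by (rule cone_Cons_same[OF z])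
  finally show ?thesis by simp
qed


section \<open>Chain maps\<close>

lemma chain_map_eq_sum:
  assumes "finite S" "\<And>v. c v \<noteq> 0 \<Longrightarrow> v \<in> S"
  shows "chain_map f c w = (\<Sum>v | v \<in> S \<and> map f v = w. c v)"
  unfolding chain_map_def using assms by (intro sum.mono_neutral_left) auto

lemma chain_map_nonzero:
  "chain_map f c w \<noteq> 0 \<Longrightarrow> \<exists>v. c v \<noteq> 0 \<and> map f v = w"
  unfolding chain_map_def by (metis (mono_tags, lifting) mem_Collect_eq sum.neutral)

lemma chain_map_cong:
  assumes "\<And>v. c v \<noteq> 0 \<Longrightarrow> map f v = map g v"
  shows "chain_map f c = chain_map g c"
  unfolding chain_map_def by (intro ext sum.cong) (auto simp: assms)

lemma chain_map_id [simp]: "chain_map id c = c"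
proof
  fix w
  have "{v. c v \<noteq> 0 \<and> map id v = w} = (if c w \<noteq> 0 then {w} else {})" by auto
  then show "chain_map id c w = c w" unfolding chain_map_def by simp
qed

lemma chain_map_lincomb:
  assumes "finite {v. c v \<noteq> 0}" "finite {v. d v \<noteq> 0}"
  shows "chain_map f (\<lambda>v. a * c v + b * d v) w = a * chain_map f c w + b * chain_map f d w"
proof -
  let ?S = "{v. c v \<noteq> 0} \<union> {v. d v \<noteq> 0}"
  have fin: "finite ?S" using assms by simp
  show ?thesis
    using fin by (subst (1 2 3) chain_map_eq_sum[of ?S]) (auto simp: sum.distrib sum_distrib_left)
qed

lemma chain_map_comp:
  assumes fin: "finite {v. c v \<noteq> 0}"
  shows "chain_map g (chain_map f c) = chain_map (g \<circ> f) c"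
proof
  fix w
  let ?S = "{v. c v \<noteq> 0}"
  have "chain_map g (chain_map f c) w = (\<Sum>u | u \<in> map f ` ?S \<and> map g u = w. chain_map f c u)"
    using fin chain_map_nonzero[of f c] by (intro chain_map_eq_sum) auto
  also have "\<dots> = (\<Sum>u | u \<in> map f ` ?S \<and> map g u = w.
      sum c {v \<in> {v. c v \<noteq> 0 \<and> map g (map f v) = w}. map f v = u})"
    unfolding chain_map_def by (intro sum.cong refl) (auto simp del: map_map)
  also have "\<dots> = sum c {v. c v \<noteq> 0 \<and> map g (map f v) = w}"
    using fin by (intro sum.group) auto
  finally show "chain_map g (chain_map f c) w = chain_map (g \<circ> f) c w"
    unfolding chain_map_def by (simp add: comp_def)
qed

lemma sum_split_head:
  fixes c :: "'v list \<Rightarrow> 'k::field"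
  assumes "finite {v. c v \<noteq> 0}" "finite S" "\<And>x u. c (x # u) \<noteq> 0 \<Longrightarrow> P (x # u) \<Longrightarrow> x \<in> S"
    "\<not> P []"
  shows "(\<Sum>v | c v \<noteq> 0 \<and> P v. c v) = (\<Sum>x\<in>S. \<Sum>u | c (x # u) \<noteq> 0 \<and> P (x # u). c (x # u))"
proof -
  let ?T = "{v. c v \<noteq> 0 \<and> P v}"
  have fin: "finite ?T" using assms(1) by (rule rev_finite_subset) auto
  have "(\<Sum>x\<in>S. \<Sum>u | c (x # u) \<noteq> 0 \<and> P (x # u). c (x # u)) =
      (\<Sum>x\<in>S. \<Sum>v | v \<in> ?T \<and> hd v = x. c v)"
  proof (rule sum.cong[OF refl])
    fix x
    have "{v \<in> ?T. hd v = x} = (#) x ` {u. c (x # u) \<noteq> 0 \<and> P (x # u)}"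
    proof (intro equalityI subsetI)
      fix v assume v: "v \<in> {v \<in> ?T. hd v = x}"
      then have "v \<noteq> []" using assms(4) by auto
      with v show "v \<in> (#) x ` {u. c (x # u) \<noteq> 0 \<and> P (x # u)}"
        by (intro image_eqI[of _ _ "tl v"]) auto
    qed auto
    then show "(\<Sum>u | c (x # u) \<noteq> 0 \<and> P (x # u). c (x # u)) = (\<Sum>v | v \<in> ?T \<and> hd v = x. c v)"
      by (simp add: sum.reindex)
  qed
  also have "\<dots> = sum c ?T"
  proof (rule sum.group[OF fin assms(2)])
    show "hd ` ?T \<subseteq> S"
    proof
      fix y assume "y \<in> hd ` ?T"
      then obtain v where v: "c v \<noteq> 0" "P v" "y = hd v" by auto
      with assms(4) obtain u where u: "v = y # u" by (cases v) auto
      show "y \<in> S" using v assms(3)[of y u] unfolding u by simp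
    qed
  qed
  finally show ?thesis ..
qed

lemma finite_tails: "finite {v. c v \<noteq> (0::'k::zero)} \<Longrightarrow> finite {u. c (x # u) \<noteq> 0}"
  by (rule finite_subset[of _ "tl ` {v. c v \<noteq> 0}"]) force+

text \<open>Peels off one vertex, so that arguments about the fibres of \<open>f\<close> can proceed
  vertex by vertex. The set \<open>S\<close> may contain heads that do not occur, so one set serves
  all tails.\<close>

lemma chain_map_Cons:
  assumes "finite {v. c v \<noteq> 0}" "finite S" "\<And>x u. c (x # u) \<noteq> 0 \<Longrightarrow> f x = y \<Longrightarrow> x \<in> S"
    "\<And>x. x \<in> S \<Longrightarrow> f x = y"
  shows "chain_map f c (y # w) = (\<Sum>x\<in>S. chain_map f (\<lambda>u. c (x # u)) w)"
  unfolding chain_map_def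
  by (subst sum_split_head[OF assms(1,2)]) (use assms(3,4) in \<open>auto intro!: sum.cong\<close>)

text \<open>Both sides add up \<open>c (x # u)\<close> over all vertices \<open>x\<close> and all
  \<open>u\<close> with \<open>map f u = w\<close>; on the left the vertices are first grouped by
  their image.\<close>

lemma aug_boundary_chain_map:
  assumes c: "finite {v. c v \<noteq> 0}"
  shows "aug_boundary (chain_map f c) w = chain_map f (aug_boundary c) w"
proof -
  let ?V = "vertices c"
  have V: "finite ?V" using c by (rule finite_vertices)
  have V': "x \<in> ?V" if "c (x # u) \<noteq> 0" for x u using that by (meson in_vertices list.set_intros(1))
  have "aug_boundary (chain_map f c) w = (\<Sum>y\<in>f ` ?V. chain_map f c (y # w))"
  proof (rule aug_boundary_eq_sum)
    fix y assume "chain_map f c (y # w) \<noteq> 0"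
    then have "\<exists>v. c v \<noteq> 0 \<and> map f v = y # w" by (rule chain_map_nonzero)
    then obtain v where v: "c v \<noteq> 0" "map f v = y # w" by (elim exE conjE)
    then obtain x u where x: "v = x # u" "y = f x" by (auto simp: map_eq_Cons_conv)
    have "x \<in> ?V" using v(1) V'[of x u] unfolding x by simp
    then show "y \<in> f ` ?V" unfolding x by (rule imageI)
  qed (use V in simp)
  also have "\<dots> = (\<Sum>y\<in>f ` ?V. \<Sum>x | x \<in> ?V \<and> f x = y. chain_map f (\<lambda>u. c (x # u)) w)"
    using V V' c by (intro sum.cong refl chain_map_Cons) auto
  also have "\<dots> = (\<Sum>x\<in>?V. chain_map f (\<lambda>u. c (x # u)) w)"
    using V by (intro sum.group) auto
  also have "\<dots> = (\<Sum>x\<in>?V. \<Sum>u | u \<in> tl ` {v. c v \<noteq> 0} \<and> map f u = w. c (x # u))"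
    using c by (intro sum.cong refl chain_map_eq_sum) force+
  also have "\<dots> = (\<Sum>u | u \<in> tl ` {v. c v \<noteq> 0} \<and> map f u = w. \<Sum>x\<in>?V. c (x # u))"
    by (rule sum.swap)
  also have "\<dots> = (\<Sum>u | u \<in> tl ` {v. c v \<noteq> 0} \<and> map f u = w. aug_boundary c u)"
    using V V' by (intro sum.cong refl aug_boundary_eq_sum[symmetric]) auto
  also have "\<dots> = chain_map f (aug_boundary c) w"
  proof (rule chain_map_eq_sum[symmetric])
    fix u assume "aug_boundary c u \<noteq> 0"
    then obtain x where "c (x # u) \<noteq> 0"
      unfolding aug_boundary_def by (metis (mono_tags, lifting) mem_Collect_eq sum.neutral)
    then show "u \<in> tl ` {v. c v \<noteq> 0}" by (intro image_eqI[of _ _ "x # u"]) auto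
  qed (use c in simp)
  finally show ?thesis .
qed

lemma alternating_chain_map:
  fixes f :: "'v \<Rightarrow> 'w"
  assumes c: "alternating c"
  shows "alternating (chain_map f c)"
  unfolding alternating_iff_permute
proof (intro allI impI)
  fix w :: "'w list" and \<pi> assume \<pi>: "\<pi> permutes {..<length w}"
  have inv: "inv_into UNIV \<pi> permutes {..<length w}" by (rule permutes_inv[OF \<pi>])
  have "chain_map f c (permute_list \<pi> w) = (\<Sum>u | c u \<noteq> 0 \<and> map f u = w. c (permute_list \<pi> u))"
    unfolding chain_map_def
  proof (rule sum.reindex_bij_witness[of _ "permute_list \<pi>" "permute_list (inv_into UNIV \<pi>)"])
    fix v assume "v \<in> {v. c v \<noteq> 0 \<and> map f v = permute_list \<pi> w}"
    then have v: "c v \<noteq> 0" "map f v = permute_list \<pi> w" "length v = length w"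
      by (auto dest: arg_cong[of _ _ length])
    show 1: "permute_list \<pi> (permute_list (inv_into UNIV \<pi>) v) = v"
      using \<pi> v by (metis permute_list_compose permute_list_id permutes_inv_o(2))
    show "c (permute_list \<pi> (permute_list (inv_into UNIV \<pi>) v)) = c v" unfolding 1 ..
    have "c (permute_list (inv_into UNIV \<pi>) v) \<noteq> 0"
      using alternating_permute[OF c, of "inv_into UNIV \<pi>" v] inv v by (simp add: sign_def)
    moreover have "map f (permute_list (inv_into UNIV \<pi>) v) = w"
      using inv v \<pi> by (metis permute_list_map permute_list_compose permute_list_id permutes_inv_o(1))
    ultimately show "permute_list (inv_into UNIV \<pi>) v \<in> {u. c u \<noteq> 0 \<and> map f u = w}" by simp
  next
    fix u assume "u \<in> {u. c u \<noteq> 0 \<and> map f u = w}"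
    then have u: "c u \<noteq> 0" "map f u = w" "length u = length w" by auto
    show "permute_list (inv_into UNIV \<pi>) (permute_list \<pi> u) = u"
      using inv u by (metis permute_list_compose permute_list_id permutes_inv_o(1) \<pi>)
    show "permute_list \<pi> u \<in> {v. c v \<noteq> 0 \<and> map f v = permute_list \<pi> w}"
      using u \<pi> alternating_permute[OF c, of \<pi> u] by (auto simp: sign_def permute_list_map)
  qed
  also have "\<dots> = (\<Sum>u | c u \<noteq> 0 \<and> map f u = w. of_int (sign \<pi>) * c u)"
    using alternating_permute[OF c] \<pi> by (intro sum.cong refl) auto
  finally show "chain_map f c (permute_list \<pi> w) = of_int (sign \<pi>) * chain_map f c w"
    unfolding chain_map_def by (simp add: sum_distrib_left)
qed

text \<open>Simplices that \<open>f\<close> degenerates contribute nothing: the heads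
  \<open>x\<close>, \<open>x'\<close> in the fibre over \<open>y\<close> occur in both orders with
  opposite signs, and equal heads carry the value 0.\<close>

lemma chain_map_repeat:
  assumes c: "c \<in> alt_chains n K"
  shows "chain_map f c (y # y # w) = 0"
proof -
  let ?V = "{x \<in> vertices c. f x = y}"
  have fin: "finite {v. c v \<noteq> 0}" by (rule alt_chainsD(1)[OF c])
  have V: "finite ?V" using finite_vertices[OF fin] by simp
  have V': "x \<in> ?V" if "c v \<noteq> 0" "x \<in> set v" "f x = y" for v x using that in_vertices[of c v x] by simp
  have "chain_map f c (y # y # w) = (\<Sum>x\<in>?V. chain_map f (\<lambda>u. c (x # u)) (y # w))"
    using V V' fin by (intro chain_map_Cons) force+
  also have "\<dots> = (\<Sum>x\<in>?V. \<Sum>x'\<in>?V. chain_map f (\<lambda>u. c (x # x' # u)) w)"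
    using V V' finite_tails[OF fin] by (intro sum.cong refl chain_map_Cons) force+
  also have "\<dots> = 0"
  proof (rule sum_antisymmetric_zero[OF V])
    show "chain_map f (\<lambda>u. c (x # x' # u)) w = - chain_map f (\<lambda>u. c (x' # x # u)) w" for x x'
    proof -
      have "c (x # x' # u) = - c (x' # x # u)" for u
        using alternatingD[OF alt_chainsD(2)[OF c], of "[]" x x' u] by simp
      then show ?thesis unfolding chain_map_def by (simp add: sum_negf)
    qed
    have "c (x # x # u) = 0" for x u using alt_chainsD(4)[OF c, of "x # x # u"] by auto
    then show "chain_map f (\<lambda>u. c (x # x # u)) w = 0" for x unfolding chain_map_def by simp
  qed
  finally show ?thesis .
qed

lemma chain_map_in_alt_chains:
  assumes c: "c \<in> alt_chains n K" and f: "\<And>\<sigma>. \<sigma> \<in> K \<Longrightarrow> f ` \<sigma> \<in> L"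
  shows "chain_map f c \<in> alt_chains n L"
proof (rule alt_chainsI)
  have "{w. chain_map f c w \<noteq> 0} \<subseteq> map f ` {v. c v \<noteq> 0}" using chain_map_nonzero[of f c] by blast
  then show "finite {w. chain_map f c w \<noteq> 0}" using alt_chainsD(1)[OF c] finite_surj by blast
  show alt: "alternating (chain_map f c)" by (rule alternating_chain_map[OF alt_chainsD(2)[OF c]])
  show "length w = n \<and> distinct w \<and> set w \<in> L" if w: "chain_map f c w \<noteq> 0" for w
  proof (intro conjI)
    obtain v where v: "c v \<noteq> 0" "map f v = w" using chain_map_nonzero[OF w] by blast
    show "length w = n" using v alt_chainsD(3)[OF c] by auto
    show "set w \<in> L" using v alt_chainsD(5)[OF c] f by (metis list.set_map)
    show "distinct w"
    proof (rule ccontr)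
      assume "\<not> distinct w"
      \<comment> \<open>A repeated vertex and its double are moved to the front, which changes only
        the sign, so that \<open>chain_map_repeat\<close> applies.\<close>
      then obtain xs ys zs y where "w = xs @ [y] @ ys @ [y] @ zs" by (meson not_distinct_decomp)
      then have w': "w = [] @ xs @ y # ys @ y # zs" by simp
      have "chain_map f c w = (-1) ^ length xs * chain_map f c (y # xs @ ys @ y # zs)"
        unfolding w' alternating_move[OF alt, of "[]" xs] by simp
      also have "chain_map f c (y # xs @ ys @ y # zs) =
          (-1) ^ length (xs @ ys) * chain_map f c (y # y # xs @ ys @ zs)"
        using alternating_move[OF alt, of "[y]" "xs @ ys" y zs] by simp
      finally show False using w chain_map_repeat[OF c, of f y] by simp
    qed
  qed
qed


section \<open>Acyclic carriers\<close>

text \<open>Linearity is asked only for chains of \<open>K\<close>, because the sums behind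
  boundaries, chain maps and lifts are meaningful only for finite support.\<close>

definition chain_operator ::
    "nat \<Rightarrow> 'v set set \<Rightarrow> nat \<Rightarrow> 'w set set \<Rightarrow> (('v list \<Rightarrow> 'k::field) \<Rightarrow> 'w list \<Rightarrow> 'k) \<Rightarrow> bool" where
  "chain_operator m K n L T \<longleftrightarrow> (\<forall>c\<in>alt_chains m K. T c \<in> alt_chains n L) \<and>
    (\<forall>c\<in>alt_chains m K. \<forall>d\<in>alt_chains m K. \<forall>a b.
      T (\<lambda>v. a * c v + b * d v) = (\<lambda>w. a * T c w + b * T d w))"

lemma chain_operatorI:
  assumes "\<And>c. c \<in> alt_chains m K \<Longrightarrow> T c \<in> alt_chains n L"
    "\<And>c d a b w. c \<in> alt_chains m K \<Longrightarrow> d \<in> alt_chains m K \<Longrightarrow>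
      T (\<lambda>v. a * c v + b * d v) w = a * T c w + b * T d w"
  shows "chain_operator m K n L T"
  using assms unfolding chain_operator_def by blast

lemma chain_operatorD:
  assumes "chain_operator m K n L T" "c \<in> alt_chains m K"
  shows chain_operator_closed: "T c \<in> alt_chains n L"
    and chain_operator_lincomb:
      "d \<in> alt_chains m K \<Longrightarrow> T (\<lambda>v. a * c v + b * d v) = (\<lambda>w. a * T c w + b * T d w)"
  using assms unfolding chain_operator_def by blast+

lemma chain_operator_zero: "chain_operator m K n L T \<Longrightarrow> T (\<lambda>_. 0) = (\<lambda>_. 0)"
  using chain_operator_lincomb[of m K n L T "\<lambda>_. 0" "\<lambda>_. 0" 0 0] by simp

lemma chain_operator_diff:
  assumes "chain_operator m K n L T" "c \<in> alt_chains m K" "d \<in> alt_chains m K"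
  shows "T (\<lambda>v. c v - d v) = (\<lambda>w. T c w - T d w)"
  using chain_operator_lincomb[OF assms, of 1 "-1"] by simp

lemma chain_operator_sum:
  assumes T: "chain_operator m K n L T" and f: "\<And>i. i \<in> S \<Longrightarrow> f i \<in> alt_chains m K"
  shows "T (\<lambda>v. \<Sum>i\<in>S. f i v) = (\<lambda>w. \<Sum>i\<in>S. T (f i) w)"
  using f
proof (induction S rule: infinite_finite_induct)
  case (insert x F)
  have "T (\<lambda>v. 1 * f x v + 1 * (\<Sum>i\<in>F. f i v)) = (\<lambda>w. 1 * T (f x) w + 1 * T (\<lambda>v. \<Sum>i\<in>F. f i v) w)"
    by (rule chain_operator_lincomb[OF T]) (use insert.prems in \<open>auto intro: sum_in_alt_chains\<close>)
  moreover have "T (\<lambda>v. \<Sum>i\<in>F. f i v) = (\<lambda>w. \<Sum>i\<in>F. T (f i) w)"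
    using insert.prems by (intro insert.IH) auto
  ultimately show ?case using insert.hyps by simp
qed (simp_all add: chain_operator_zero[OF T])

lemma chain_operator_comp:
  assumes S: "chain_operator m K n L S" and T: "chain_operator n L p M T"
  shows "chain_operator m K p M (\<lambda>c. T (S c))"
proof (rule chain_operatorI)
  show "T (S c) \<in> alt_chains p M" if "c \<in> alt_chains m K" for c
    by (rule chain_operator_closed[OF T chain_operator_closed[OF S that]])
  show "T (S (\<lambda>v. a * c v + b * d v)) w = a * T (S c) w + b * T (S d) w"
    if "c \<in> alt_chains m K" "d \<in> alt_chains m K" for c d a b w
    unfolding chain_operator_lincomb[OF S that]
    by (rule fun_cong[OF chain_operator_lincomb[OF T]])
      (rule chain_operator_closed[OF S that(1)] chain_operator_closed[OF S that(2)])+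
qed

lemma chain_operator_add:
  assumes S: "chain_operator m K n L S" and T: "chain_operator m K n L T"
  shows "chain_operator m K n L (\<lambda>c w. s * S c w + t * T c w)"
proof (rule chain_operatorI)
  show "(\<lambda>w. s * S c w + t * T c w) \<in> alt_chains n L" if "c \<in> alt_chains m K" for c
    by (rule lincomb_in_alt_chains[OF chain_operator_closed[OF S that] chain_operator_closed[OF T that]])
  show "s * S (\<lambda>v. a * c v + b * d v) w + t * T (\<lambda>v. a * c v + b * d v) w =
      a * (s * S c w + t * T c w) + b * (s * S d w + t * T d w)"
    if "c \<in> alt_chains m K" "d \<in> alt_chains m K" for c d a b w
    unfolding chain_operator_lincomb[OF S that] chain_operator_lincomb[OF T that]
    by (simp add: algebra_simps)
qed

lemma chain_operator_minus:
  assumes S: "chain_operator m K n L S" and T: "chain_operator m K n L T"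
  shows "chain_operator m K n L (\<lambda>c w. S c w - T c w)"
  using chain_operator_add[OF assms, of 1 "-1"] by simp

lemma chain_operator_aug_boundary:
  "simplicial K \<Longrightarrow> chain_operator (Suc n) K n K aug_boundary"
  by (rule chain_operatorI)
    (auto intro: aug_boundary_in_alt_chains aug_boundary_lincomb alt_chainsD(1))

lemma chain_operator_chain_map:
  "(\<And>\<sigma>. \<sigma> \<in> K \<Longrightarrow> f ` \<sigma> \<in> L) \<Longrightarrow> chain_operator n K n L (chain_map f)"
  by (rule chain_operatorI)
    (auto intro: chain_map_in_alt_chains chain_map_lincomb alt_chainsD(1))

lemma chain_operator_cone:
  "(\<And>\<tau>. \<tau> \<in> D \<Longrightarrow> insert a \<tau> \<in> B) \<Longrightarrow> chain_operator n D (Suc n) B (cone a)"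
  by (rule chain_operatorI) (auto intro: cone_in_alt_chains cone_lincomb)

text \<open>The clause at \<open>[]\<close> is preservation of the augmentation. It excludes the
  zero map and is the start of the comparison of two maps with a common carrier.\<close>

definition chain_morphism ::
    "'v set set \<Rightarrow> 'w set set \<Rightarrow> (nat \<Rightarrow> ('v list \<Rightarrow> 'k::field) \<Rightarrow> 'w list \<Rightarrow> 'k) \<Rightarrow> bool" where
  "chain_morphism K L f \<longleftrightarrow> (\<forall>n. chain_operator n K n L (f n)) \<and>
    (\<forall>c\<in>alt_chains 0 K. f 0 c [] = c []) \<and>
    (\<forall>n. \<forall>c\<in>alt_chains (Suc n) K. aug_boundary (f (Suc n) c) = f n (aug_boundary c))"

text \<open>Degree 0 is spanned by the empty list, where maps preserving the augmentation agree.
  Hence \<open>h 0\<close> vanishes and the equation starts with one vertex; this is also what lets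
  homotopies act on unreduced homology.\<close>

definition chain_homotopy ::
    "'v set set \<Rightarrow> 'w set set \<Rightarrow> (nat \<Rightarrow> ('v list \<Rightarrow> 'k::field) \<Rightarrow> 'w list \<Rightarrow> 'k)
      \<Rightarrow> (nat \<Rightarrow> ('v list \<Rightarrow> 'k) \<Rightarrow> 'w list \<Rightarrow> 'k) \<Rightarrow> (nat \<Rightarrow> ('v list \<Rightarrow> 'k) \<Rightarrow> 'w list \<Rightarrow> 'k) \<Rightarrow> bool" where
  "chain_homotopy K L f g h \<longleftrightarrow> (\<forall>n. chain_operator n K (Suc n) L (h n)) \<and> (\<forall>c. h 0 c = (\<lambda>_. 0)) \<and>
    (\<forall>n. \<forall>c\<in>alt_chains (Suc n) K. aug_boundary (h (Suc n) c) =
      (\<lambda>w. f (Suc n) c w - g (Suc n) c w - h n (aug_boundary c) w))"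

text \<open>Vanishing reduced homology, witnessed by a linear operator that bounds cycles. Degree 0
  is included: a nonzero multiple of the empty list can be bounded only if there is a
  vertex.\<close>

definition filling :: "'v set set \<Rightarrow> (nat \<Rightarrow> ('v list \<Rightarrow> 'k::field) \<Rightarrow> 'v list \<Rightarrow> 'k) \<Rightarrow> bool" where
  "filling B fill \<longleftrightarrow> (\<forall>m. chain_operator m B (Suc m) B (fill m) \<and>
    (\<forall>z\<in>alt_chains m B. aug_boundary z = (\<lambda>_. 0) \<longrightarrow> aug_boundary (fill m z) = z))"

text \<open>On a cycle the correction term of the cone formula vanishes, so the cone has the cycle
  itself as its boundary.\<close>

lemma filling_cone:
  assumes "\<And>\<tau>. \<tau> \<in> B \<Longrightarrow> insert a \<tau> \<in> B"
  shows "filling B (\<lambda>_. cone a)"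
  unfolding filling_def
proof (intro allI conjI ballI impI)
  show "chain_operator m B (Suc m) B (cone a)" for m
    by (rule chain_operator_cone[OF assms])
  show "aug_boundary (cone a z) = z" if "z \<in> alt_chains m B" "aug_boundary z = (\<lambda>_. 0)" for m z
    using aug_boundary_cone[OF that(1), of a] that(2) by (intro ext) simp
qed

section \<open>Splitting chains over simplices and lifting them through a carrier\<close>

definition chain_part :: "'v set \<Rightarrow> ('v list \<Rightarrow> 'k::field) \<Rightarrow> 'v list \<Rightarrow> 'k" where
  "chain_part \<sigma> c v = (if set v = \<sigma> then c v else 0)"

lemma chain_part_in_alt_chains:
  fixes c :: "'v list \<Rightarrow> 'k::field"
  assumes c: "c \<in> alt_chains n K"
  shows "chain_part \<sigma> c \<in> alt_chains n (K \<inter> Pow \<sigma>)"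
proof (rule alt_chainsI)
  show "finite {v. chain_part \<sigma> c v \<noteq> 0}"
    by (rule finite_subset[OF _ alt_chainsD(1)[OF c]]) (auto simp: chain_part_def)
  show "length v = n \<and> distinct v \<and> set v \<in> K \<inter> Pow \<sigma>" if "chain_part \<sigma> c v \<noteq> 0" for v
    using that alt_chainsD(3-5)[OF c] by (auto simp: chain_part_def split: if_splits)
  show "alternating (chain_part \<sigma> c)" unfolding alternating_def
  proof (intro allI)
    fix xs ys :: "'v list" and x y
    have "set (xs @ x # y # ys) = set (xs @ y # x # ys)" by auto
    then show "chain_part \<sigma> c (xs @ x # y # ys) = - chain_part \<sigma> c (xs @ y # x # ys)"
      unfolding chain_part_def using alternatingD[OF alt_chainsD(2)[OF c], of xs x y ys] by simp
  qed
qed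

lemma sum_chain_part:
  assumes "finite S" "\<And>v. c v \<noteq> 0 \<Longrightarrow> set v \<in> S"
  shows "(\<lambda>v. \<Sum>\<sigma>\<in>S. chain_part \<sigma> c v) = c"
proof
  fix v
  have "(\<Sum>\<sigma>\<in>S. chain_part \<sigma> c v) = (if set v \<in> S then c v else 0)"
    unfolding chain_part_def using assms(1) by (simp add: sum.delta')
  then show "(\<Sum>\<sigma>\<in>S. chain_part \<sigma> c v) = c v" using assms(2) by auto
qed

text \<open>Testing all chains on the full simplex \<open>Pow \<sigma>\<close>, and not only those
  supported on \<open>\<sigma>\<close> itself, makes the property stable under composition with the
  boundary.\<close>

definition carried ::
    "'v set set \<Rightarrow> ('v set \<Rightarrow> 'w set set) \<Rightarrow> nat \<Rightarrow> nat \<Rightarrow> (('v list \<Rightarrow> 'k::field) \<Rightarrow> 'w list \<Rightarrow> 'k) \<Rightarrow> bool" where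
  "carried K B m n G \<longleftrightarrow> (\<forall>\<sigma>\<in>K. \<forall>c\<in>alt_chains m (Pow \<sigma>). G c \<in> alt_chains n (B \<sigma>))"

text \<open>
  Splitting a chain into its parts on the single simplices makes it possible to apply the filling of
  each carrier without choosing an orientation of every simplex.
\<close>

definition carrier_lift ::
    "('v set \<Rightarrow> ('w list \<Rightarrow> 'k::field) \<Rightarrow> 'w list \<Rightarrow> 'k) \<Rightarrow> (('v list \<Rightarrow> 'k) \<Rightarrow> 'w list \<Rightarrow> 'k)
      \<Rightarrow> ('v list \<Rightarrow> 'k) \<Rightarrow> 'w list \<Rightarrow> 'k" where
  "carrier_lift fill G c = (\<lambda>w. \<Sum>\<sigma>\<in>set ` {v. c v \<noteq> 0}. fill \<sigma> (G (chain_part \<sigma> c)) w)"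

text \<open>Fillings are demanded for the nonempty simplices, over which lifts are formed; over the
  empty simplex the map is prescribed by the augmentation.\<close>

locale acyclic_carrier =
  fixes K :: "'v set set" and L :: "'w set set" and B :: "'v set \<Rightarrow> 'w set set"
    and fill :: "'v set \<Rightarrow> nat \<Rightarrow> ('w list \<Rightarrow> 'k::field) \<Rightarrow> 'w list \<Rightarrow> 'k"
  assumes K: "simplicial K" and L: "simplicial L"
    and sub: "\<And>\<sigma>. \<sigma> \<in> K \<Longrightarrow> B \<sigma> \<subseteq> L"
    and empty: "\<And>\<sigma>. \<sigma> \<in> K \<Longrightarrow> {} \<in> B \<sigma>"
    and mono: "\<And>\<rho> \<sigma>. \<sigma> \<in> K \<Longrightarrow> \<rho> \<subseteq> \<sigma> \<Longrightarrow> B \<rho> \<subseteq> B \<sigma>"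
    and fill: "\<And>\<sigma>. \<sigma> \<in> K \<Longrightarrow> \<sigma> \<noteq> {} \<Longrightarrow> filling (B \<sigma>) (fill \<sigma>)"
begin

lemma faces: "\<sigma> \<in> K \<Longrightarrow> \<rho> \<subseteq> \<sigma> \<Longrightarrow> \<rho> \<in> K"
  using K unfolding simplicial_def by blast

lemma fill_operator: "\<sigma> \<in> K \<Longrightarrow> \<sigma> \<noteq> {} \<Longrightarrow> chain_operator m (B \<sigma>) (Suc m) (B \<sigma>) (fill \<sigma> m)"
  using fill unfolding filling_def by blast

lemma chain_part_face: "c \<in> alt_chains n K \<Longrightarrow> chain_part \<sigma> c \<in> alt_chains n (Pow \<sigma>)"
  using chain_part_in_alt_chains alt_chains_mono by blast

lemma supp_sets:
  assumes "c \<in> alt_chains (Suc m) K"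
  shows "finite (set ` {v. c v \<noteq> 0})" "set ` {v. c v \<noteq> 0} \<subseteq> K - {{}}"
  using alt_chainsD[OF assms] by force+

context
  fixes m n and G :: "('v list \<Rightarrow> 'k) \<Rightarrow> 'w list \<Rightarrow> 'k"
  assumes G: "chain_operator (Suc m) K n L G" "carried K B (Suc m) n G"
    and cyc: "\<And>c. c \<in> alt_chains (Suc m) K \<Longrightarrow> aug_boundary (G c) = (\<lambda>_. 0)"
begin

lemma G_part:
  "c \<in> alt_chains (Suc m) K \<Longrightarrow> \<sigma> \<in> K \<Longrightarrow> G (chain_part \<sigma> c) \<in> alt_chains n (B \<sigma>)"
  using G(2) chain_part_face unfolding carried_def by blast

text \<open>The simplices that index the lift depend on the chain. Enlarging the index set lets the
  lifts of two chains and of their combination be compared term by term.\<close>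

lemma carrier_lift_eq_sum:
  assumes c: "c \<in> alt_chains (Suc m) K" and S: "finite S" "set ` {v. c v \<noteq> 0} \<subseteq> S" "S \<subseteq> K - {{}}"
  shows "carrier_lift (\<lambda>\<sigma>. fill \<sigma> n) G c = (\<lambda>w. \<Sum>\<sigma>\<in>S. fill \<sigma> n (G (chain_part \<sigma> c)) w)"
  unfolding carrier_lift_def
proof (intro ext sum.mono_neutral_left ballI)
  fix w \<sigma> assume \<sigma>: "\<sigma> \<in> S - set ` {v. c v \<noteq> 0}"
  then have "chain_part \<sigma> c = (\<lambda>_. 0)" unfolding chain_part_def by (intro ext) auto
  moreover have "\<sigma> \<in> K" "\<sigma> \<noteq> {}" using \<sigma> S by auto
  ultimately show "fill \<sigma> n (G (chain_part \<sigma> c)) w = 0"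
    by (simp add: chain_operator_zero[OF G(1)] chain_operator_zero[OF fill_operator])
qed (use S in auto)

lemma carrier_lift_term:
  assumes c: "c \<in> alt_chains (Suc m) K" and \<sigma>: "\<sigma> \<in> K - {{}}"
  shows "fill \<sigma> n (G (chain_part \<sigma> c)) \<in> alt_chains (Suc n) (B \<sigma>)"
  using \<sigma> by (auto intro!: chain_operator_closed[OF fill_operator G_part[OF c]])

text \<open>The parts of a chain on \<open>\<sigma>\<close> sit on faces of \<open>\<sigma>\<close>,
  and the carriers of faces are contained in that of \<open>\<sigma>\<close>.\<close>

lemma carried_carrier_lift: "carried K B (Suc m) (Suc n) (carrier_lift (\<lambda>\<sigma>. fill \<sigma> n) G)"
  unfolding carried_def
proof (intro ballI)
  fix \<sigma> and c :: "'v list \<Rightarrow> 'k" assume \<sigma>: "\<sigma> \<in> K" and c: "c \<in> alt_chains (Suc m) (Pow \<sigma>)"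
  have cK: "c \<in> alt_chains (Suc m) K" by (rule alt_chains_mono[OF c]) (use \<sigma> faces in auto)
  show "carrier_lift (\<lambda>\<sigma>. fill \<sigma> n) G c \<in> alt_chains (Suc n) (B \<sigma>)"
    unfolding carrier_lift_def
  proof (rule sum_in_alt_chains)
    fix \<rho> assume \<rho>: "\<rho> \<in> set ` {v. c v \<noteq> 0}"
    have "\<rho> \<in> K - {{}}" "\<rho> \<subseteq> \<sigma>" using \<rho> supp_sets(2)[OF cK] alt_chainsD(5)[OF c] by auto
    then show "fill \<rho> n (G (chain_part \<rho> c)) \<in> alt_chains (Suc n) (B \<sigma>)"
      by (rule alt_chains_mono[OF carrier_lift_term[OF cK] mono[OF \<sigma>]])
  qed
qed

lemma chain_operator_carrier_lift:
  "chain_operator (Suc m) K (Suc n) L (carrier_lift (\<lambda>\<sigma>. fill \<sigma> n) G)"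
proof (rule chain_operatorI)
  show "carrier_lift (\<lambda>\<sigma>. fill \<sigma> n) G c \<in> alt_chains (Suc n) L" if c: "c \<in> alt_chains (Suc m) K" for c
    unfolding carrier_lift_def
  proof (rule sum_in_alt_chains)
    fix \<rho> assume \<rho>: "\<rho> \<in> set ` {v. c v \<noteq> 0}"
    have "\<rho> \<in> K - {{}}" "\<rho> \<in> K" using \<rho> supp_sets(2)[OF c] by auto
    then show "fill \<rho> n (G (chain_part \<rho> c)) \<in> alt_chains (Suc n) L"
      by (rule alt_chains_mono[OF carrier_lift_term[OF c] sub])
  qed
  fix c d :: "'v list \<Rightarrow> 'k" and a b w assume cd: "c \<in> alt_chains (Suc m) K" "d \<in> alt_chains (Suc m) K"
  let ?e = "\<lambda>v. a * c v + b * d v"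
  let ?S = "set ` {v. c v \<noteq> 0} \<union> set ` {v. d v \<noteq> 0}"
  have e: "?e \<in> alt_chains (Suc m) K" by (rule lincomb_in_alt_chains[OF cd])
  have S: "finite ?S" "?S \<subseteq> K - {{}}" using supp_sets[OF cd(1)] supp_sets[OF cd(2)] by auto
  have "set ` {v. ?e v \<noteq> 0} \<subseteq> ?S" by auto
  have part: "chain_part \<sigma> ?e = (\<lambda>v. a * chain_part \<sigma> c v + b * chain_part \<sigma> d v)" for \<sigma>
    unfolding chain_part_def by auto
  have "fill \<sigma> n (G (chain_part \<sigma> ?e)) w =
      a * fill \<sigma> n (G (chain_part \<sigma> c)) w + b * fill \<sigma> n (G (chain_part \<sigma> d)) w" if "\<sigma> \<in> ?S" for \<sigma>
  proof -
    have \<sigma>: "\<sigma> \<in> K" "\<sigma> \<noteq> {}" using that S by auto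
    have part_K: "chain_part \<sigma> c' \<in> alt_chains (Suc m) K" if "c' \<in> alt_chains (Suc m) K" for c'
      using chain_part_in_alt_chains[OF that] alt_chains_mono by blast
    show ?thesis
      unfolding part chain_operator_lincomb[OF G(1) part_K[OF cd(1)] part_K[OF cd(2)]]
        chain_operator_lincomb[OF fill_operator[OF \<sigma>] G_part[OF cd(1) \<sigma>(1)] G_part[OF cd(2) \<sigma>(1)]] ..
  qed
  then show "carrier_lift (\<lambda>\<sigma>. fill \<sigma> n) G ?e w =
      a * carrier_lift (\<lambda>\<sigma>. fill \<sigma> n) G c w + b * carrier_lift (\<lambda>\<sigma>. fill \<sigma> n) G d w"
    using carrier_lift_eq_sum[OF cd(1) S(1) _ S(2)] carrier_lift_eq_sum[OF cd(2) S(1) _ S(2)]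
      carrier_lift_eq_sum[OF e S(1) \<open>set ` {v. ?e v \<noteq> 0} \<subseteq> ?S\<close> S(2)]
    by (simp add: sum.distrib sum_distrib_left)
qed

text \<open>Each \<open>G (chain_part \<sigma> c)\<close> is a cycle in its carrier and is bounded
  by the filling; linearity of \<open>G\<close> adds the parts up to \<open>G c\<close>.\<close>

lemma aug_boundary_carrier_lift:
  assumes c: "c \<in> alt_chains (Suc m) K"
  shows "aug_boundary (carrier_lift (\<lambda>\<sigma>. fill \<sigma> n) G c) = G c"
proof -
  let ?S = "set ` {v. c v \<noteq> 0}"
  have S: "\<sigma> \<in> K" "\<sigma> \<noteq> {}" if "\<sigma> \<in> ?S" for \<sigma> using supp_sets(2)[OF c] that by auto
  have part: "chain_part \<sigma> c \<in> alt_chains (Suc m) K" for \<sigma>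
    using chain_part_in_alt_chains[OF c] alt_chains_mono by blast
  have "aug_boundary (carrier_lift (\<lambda>\<sigma>. fill \<sigma> n) G c) =
      (\<lambda>w. \<Sum>\<sigma>\<in>?S. aug_boundary (fill \<sigma> n (G (chain_part \<sigma> c))) w)"
    unfolding carrier_lift_def
  proof (rule chain_operator_sum[OF chain_operator_aug_boundary[OF L]])
    show "fill \<sigma> n (G (chain_part \<sigma> c)) \<in> alt_chains (Suc n) L" if "\<sigma> \<in> ?S" for \<sigma>
      using S[OF that] by (intro alt_chains_mono[OF carrier_lift_term[OF c] sub]) auto
  qed
  also have "\<dots> = (\<lambda>w. \<Sum>\<sigma>\<in>?S. G (chain_part \<sigma> c) w)"
  proof (intro ext sum.cong refl)
    fix w \<sigma> assume "\<sigma> \<in> ?S"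
    from fill[OF S[OF this]] G_part[OF c S(1)[OF this]] cyc[OF part]
    show "aug_boundary (fill \<sigma> n (G (chain_part \<sigma> c))) w = G (chain_part \<sigma> c) w"
      unfolding filling_def by simp
  qed
  also have "\<dots> = G (\<lambda>v. \<Sum>\<sigma>\<in>?S. chain_part \<sigma> c v)"
    by (rule chain_operator_sum[OF G(1) part, symmetric])
  also have "(\<lambda>v. \<Sum>\<sigma>\<in>?S. chain_part \<sigma> c v) = c"
    by (rule sum_chain_part) (use supp_sets[OF c] in auto)
  finally show ?thesis .
qed

end

lemma carried_aug_boundary:
  fixes G :: "('v list \<Rightarrow> 'k) \<Rightarrow> 'w list \<Rightarrow> 'k"
  assumes "carried K B m n G"
  shows "carried K B (Suc m) n (\<lambda>c. G (aug_boundary c))"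
  unfolding carried_def
proof (intro ballI)
  fix \<sigma> and c :: "'v list \<Rightarrow> 'k" assume "\<sigma> \<in> K" "c \<in> alt_chains (Suc m) (Pow \<sigma>)"
  moreover have "simplicial (Pow \<sigma>)" unfolding simplicial_def by auto
  ultimately show "G (aug_boundary c) \<in> alt_chains n (B \<sigma>)"
    using assms aug_boundary_in_alt_chains unfolding carried_def by blast
qed

lemma chain_operator_after_boundary:
  "chain_operator m K n L T \<Longrightarrow> chain_operator (Suc m) K n L (\<lambda>c. T (aug_boundary c))"
  by (rule chain_operator_comp[OF chain_operator_aug_boundary[OF K]])

lemma aug_boundary_boundary: "c \<in> alt_chains n K \<Longrightarrow> aug_boundary (aug_boundary c) = (\<lambda>_. 0)"
  using aug_boundary_aug_boundary by blast

text \<open>The start preserves the augmentation. Each further degree solves the chain map equation: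
  the boundary of the new value is prescribed by the previous degree and is filled inside the
  carrier.\<close>

primrec carried_map :: "nat \<Rightarrow> ('v list \<Rightarrow> 'k) \<Rightarrow> 'w list \<Rightarrow> 'k" where
  "carried_map 0 c = (\<lambda>w. if w = [] then c [] else 0)"
| "carried_map (Suc n) c = carrier_lift (\<lambda>\<sigma>. fill \<sigma> n) (\<lambda>d. carried_map n (aug_boundary d)) c"

lemma carried_map_0_in_alt_chains: "{} \<in> M \<Longrightarrow> (\<lambda>w. if w = [] then x else 0) \<in> alt_chains 0 M"
  by (rule alt_chainsI) (auto simp: alternating_def split: if_splits)

lemma carried_map_zero: "carried_map k (\<lambda>_. 0) = (\<lambda>_. 0)"
  by (cases k) (auto simp: carrier_lift_def)

text \<open>The claims are proved together, because a lift needs linearity and the carrier of the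
  previous degree, and also its chain map equation to know that the chains to be filled are cycles.
  Below degree 0 there is nothing, whence the case \<open>0\<close>.\<close>

lemma carried_map_props:
  "chain_operator n K n L (carried_map n) \<and> carried K B n n (carried_map n) \<and>
    (\<forall>c\<in>alt_chains n K. aug_boundary (carried_map n c) =
      (case n of 0 \<Rightarrow> \<lambda>_. 0 | Suc k \<Rightarrow> carried_map k (aug_boundary c)))"
proof (induction n)
  case 0
  have "{} \<in> L" if "c \<in> alt_chains 0 K" "c [] \<noteq> 0" for c :: "'v list \<Rightarrow> 'k"
    using alt_chainsD(5)[OF that] empty sub by auto
  then have "(\<lambda>w. if w = [] then c [] else 0) \<in> alt_chains 0 L" if "c \<in> alt_chains 0 K"
    for c :: "'v list \<Rightarrow> 'k"
    using that by (cases "c [] = 0") (auto intro: carried_map_0_in_alt_chains simp: if_distrib cong: if_cong)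
  then have "chain_operator 0 K 0 L (carried_map 0)" by (intro chain_operatorI) auto
  moreover have "carried K B 0 0 (carried_map 0)"
    by (auto simp: carried_def intro: carried_map_0_in_alt_chains empty)
  moreover have "aug_boundary (carried_map 0 c) = (\<lambda>_. 0)" for c unfolding aug_boundary_def by simp
  ultimately show ?case by (simp del: carried_map.simps)
next
  case (Suc n)
  let ?G = "\<lambda>d. carried_map n (aug_boundary d)"
  from Suc have IH: "chain_operator n K n L (carried_map n)" "carried K B n n (carried_map n)"
    "\<And>c. c \<in> alt_chains n K \<Longrightarrow> aug_boundary (carried_map n c) =
      (case n of 0 \<Rightarrow> \<lambda>_. 0 | Suc k \<Rightarrow> carried_map k (aug_boundary c))" by auto
  have 1: "chain_operator (Suc n) K n L ?G" by (rule chain_operator_after_boundary[OF IH(1)])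
  have 2: "carried K B (Suc n) n ?G" by (rule carried_aug_boundary[OF IH(2)])
  \<comment> \<open>The previous chain map equation turns the boundary of \<open>?G c\<close> into
    the image of a double boundary.\<close>
  have 3: "aug_boundary (?G c) = (\<lambda>_. 0)" if c: "c \<in> alt_chains (Suc n) K" for c
  proof (cases n)
    case 0
    then show ?thesis
      using IH(3)[OF aug_boundary_in_alt_chains[OF c K]] by simp
  next
    case (Suc k)
    then show ?thesis
      using IH(3)[OF aug_boundary_in_alt_chains[OF c K]]
      by (simp add: aug_boundary_boundary[OF c] carried_map_zero del: carried_map.simps)
  qed
  have "carried_map (Suc n) = carrier_lift (\<lambda>\<sigma>. fill \<sigma> n) ?G" by (intro ext) simp
  then show ?case
    using chain_operator_carrier_lift[OF 1 2 3] carried_carrier_lift[OF 1 2 3] aug_boundary_carrier_lift[OF 1 2 3]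
    by simp
qed

lemma chain_morphism_carried_map: "chain_morphism K L carried_map"
  unfolding chain_morphism_def
proof (intro conjI allI ballI)
  show "aug_boundary (carried_map (Suc n) c) = carried_map n (aug_boundary c)"
    if "c \<in> alt_chains (Suc n) K" for n c
    using carried_map_props[of "Suc n"] that by (simp del: carried_map.simps)
qed (use carried_map_props in auto)

lemma carried_carried_map: "carried K B n n (carried_map n)"
  using carried_map_props by blast

text \<open>Each degree solves the homotopy equation by filling \<open>f - g\<close> minus the
  previous homotopy on the boundary. The filling is the one in degree \<open>Suc n\<close>, since
  the right-hand side has \<open>Suc n\<close> vertices.\<close>

primrec carried_homotopy ::
    "(nat \<Rightarrow> ('v list \<Rightarrow> 'k) \<Rightarrow> 'w list \<Rightarrow> 'k) \<Rightarrow> (nat \<Rightarrow> ('v list \<Rightarrow> 'k) \<Rightarrow> 'w list \<Rightarrow> 'k)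
      \<Rightarrow> nat \<Rightarrow> ('v list \<Rightarrow> 'k) \<Rightarrow> 'w list \<Rightarrow> 'k" where
  "carried_homotopy f g 0 c = (\<lambda>_. 0)"
| "carried_homotopy f g (Suc n) c = carrier_lift (\<lambda>\<sigma>. fill \<sigma> (Suc n))
    (\<lambda>d w. f (Suc n) d w - g (Suc n) d w - carried_homotopy f g n (aug_boundary d) w) c"

lemma carried_homotopy_zero: "carried_homotopy f g k (\<lambda>_. 0) = (\<lambda>_. 0)"
  by (cases k) (auto simp: carrier_lift_def)

context
  fixes f g :: "nat \<Rightarrow> ('v list \<Rightarrow> 'k) \<Rightarrow> 'w list \<Rightarrow> 'k"
  assumes f: "chain_morphism K L f" "\<And>n. carried K B n n (f n)"
    and g: "chain_morphism K L g" "\<And>n. carried K B n n (g n)"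
begin

lemma morphism_0_eq:
  assumes "c \<in> alt_chains 0 K" shows "f 0 c = g 0 c"
proof
  fix w
  have "f 0 c \<in> alt_chains 0 L" "g 0 c \<in> alt_chains 0 L"
    using f(1) g(1) assms chain_operator_closed unfolding chain_morphism_def by blast+
  from alt_chainsD(3)[OF this(1), of w] alt_chainsD(3)[OF this(2), of w]
  have "f 0 c w = 0 \<and> g 0 c w = 0" if "w \<noteq> []" using that by blast
  moreover have "f 0 c [] = g 0 c []" using f(1) g(1) assms unfolding chain_morphism_def by simp
  ultimately show "f 0 c w = g 0 c w" by (cases "w = []") auto
qed

lemma carried_homotopy_props:
  "chain_operator n K (Suc n) L (carried_homotopy f g n) \<and> carried K B n (Suc n) (carried_homotopy f g n) \<and>
    (\<forall>c\<in>alt_chains n K. aug_boundary (carried_homotopy f g n c) =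
      (\<lambda>w. f n c w - g n c w - (case n of 0 \<Rightarrow> 0 | Suc k \<Rightarrow> carried_homotopy f g k (aug_boundary c) w)))"
proof (induction n)
  case 0
  show ?case
    by (auto intro!: chain_operatorI simp: carried_def morphism_0_eq aug_boundary_def)
next
  case (Suc n)
  let ?h = "carried_homotopy f g"
  let ?G = "\<lambda>d w. f (Suc n) d w - g (Suc n) d w - ?h n (aug_boundary d) w"
  from Suc have IH: "chain_operator n K (Suc n) L (?h n)" "carried K B n (Suc n) (?h n)"
    "\<And>c. c \<in> alt_chains n K \<Longrightarrow> aug_boundary (?h n c) =
      (\<lambda>w. f n c w - g n c w - (case n of 0 \<Rightarrow> 0 | Suc k \<Rightarrow> ?h k (aug_boundary c) w))" by auto
  have fg: "chain_operator (Suc n) K (Suc n) L (f (Suc n))" "chain_operator (Suc n) K (Suc n) L (g (Suc n))"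
    using f(1) g(1) unfolding chain_morphism_def by auto
  have 1: "chain_operator (Suc n) K (Suc n) L ?G"
    by (intro chain_operator_minus fg chain_operator_after_boundary IH(1))
  have 2: "carried K B (Suc n) (Suc n) ?G"
    using carried_aug_boundary[OF IH(2)] f(2)[of "Suc n"] g(2)[of "Suc n"]
    unfolding carried_def by (auto intro!: diff_in_alt_chains)
  \<comment> \<open>The boundary of the previous homotopy, applied to the boundary of
    \<open>c\<close>, is the difference of \<open>f\<close> and \<open>g\<close> there, up to a term
    with a double boundary; it cancels the boundary of \<open>f - g\<close>.\<close>
  have 3: "aug_boundary (?G c) = (\<lambda>_. 0)" if c: "c \<in> alt_chains (Suc n) K" for c
  proof -
    note bd = chain_operator_diff[OF chain_operator_aug_boundary[OF L, of n]]
    have bc: "aug_boundary c \<in> alt_chains n K" by (rule aug_boundary_in_alt_chains[OF c K])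
    have "aug_boundary (?G c) = (\<lambda>w. aug_boundary (f (Suc n) c) w - aug_boundary (g (Suc n) c) w -
        aug_boundary (?h n (aug_boundary c)) w)"
      using chain_operator_closed[OF fg(1) c] chain_operator_closed[OF fg(2) c] chain_operator_closed[OF IH(1) bc]
      by (simp add: bd diff_in_alt_chains)
    moreover have "aug_boundary (f (Suc n) c) = f n (aug_boundary c)" "aug_boundary (g (Suc n) c) = g n (aug_boundary c)"
      using f(1) g(1) c unfolding chain_morphism_def by auto
    ultimately show ?thesis
      unfolding IH(3)[OF bc] aug_boundary_boundary[OF c]
      by (cases n) (simp_all add: carried_homotopy_zero del: carried_homotopy.simps)
  qed
  have "?h (Suc n) = carrier_lift (\<lambda>\<sigma>. fill \<sigma> (Suc n)) ?G" by (intro ext) simp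
  then show ?case
    using chain_operator_carrier_lift[OF 1 2 3] carried_carrier_lift[OF 1 2 3] aug_boundary_carrier_lift[OF 1 2 3]
    by simp
qed

lemma chain_homotopy_carried_homotopy: "chain_homotopy K L f g (carried_homotopy f g)"
  unfolding chain_homotopy_def
proof (intro conjI allI ballI)
  show "aug_boundary (carried_homotopy f g (Suc n) c) =
      (\<lambda>w. f (Suc n) c w - g (Suc n) c w - carried_homotopy f g n (aug_boundary c) w)"
    if "c \<in> alt_chains (Suc n) K" for n c
    using carried_homotopy_props[of "Suc n"] that by (simp del: carried_homotopy.simps)
qed (use carried_homotopy_props in auto)

end

end


section \<open>The fibre lemma and bicliques\<close>

lemma chain_morphism_id: "K \<subseteq> L \<Longrightarrow> chain_morphism K L (\<lambda>_ c. c)"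
  unfolding chain_morphism_def by (auto intro!: chain_operatorI intro: alt_chains_mono)

lemma chain_map_Nil: "chain_map f c [] = c []"
proof -
  have "{v. c v \<noteq> 0 \<and> map f v = []} = (if c [] \<noteq> 0 then {[]} else {})" by auto
  then show ?thesis unfolding chain_map_def by simp
qed

lemma chain_morphism_chain_map:
  assumes "\<And>\<sigma>. \<sigma> \<in> K \<Longrightarrow> f ` \<sigma> \<in> L"
  shows "chain_morphism K L (\<lambda>_. chain_map f)"
  unfolding chain_morphism_def
  by (auto intro!: chain_operator_chain_map assms aug_boundary_chain_map simp: chain_map_Nil alt_chainsD(1))

lemma chain_morphismD:
  assumes "chain_morphism K L f"
  shows "chain_operator n K n L (f n)"
    and "c \<in> alt_chains (Suc n) K \<Longrightarrow> aug_boundary (f (Suc n) c) = f n (aug_boundary c)"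
    and "c \<in> alt_chains 0 K \<Longrightarrow> f 0 c [] = c []"
  using assms unfolding chain_morphism_def by auto

lemma chain_morphism_comp:
  assumes f: "chain_morphism K L f" and g: "chain_morphism L M g"
  shows "chain_morphism K M (\<lambda>n c. g n (f n c))"
  unfolding chain_morphism_def
proof (intro conjI allI ballI)
  show "chain_operator n K n M (\<lambda>c. g n (f n c))" for n
    by (rule chain_operator_comp[OF chain_morphismD(1)[OF f] chain_morphismD(1)[OF g]])
  note fL = chain_operator_closed[OF chain_morphismD(1)[OF f]]
  show "g 0 (f 0 c) [] = c []" if "c \<in> alt_chains 0 K" for c
    using chain_morphismD(3)[OF f that] chain_morphismD(3)[OF g fL[OF that]] by simp
  show "aug_boundary (g (Suc n) (f (Suc n) c)) = g n (f n (aug_boundary c))"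
    if "c \<in> alt_chains (Suc n) K" for n c
    using chain_morphismD(2)[OF f that] chain_morphismD(2)[OF g fL[OF that]] by simp
qed

text \<open>A carrier whose values are full simplices is filled by coning from any vertex; this
  covers all contiguity arguments.\<close>

lemma acyclic_carrier_simplex:
  fixes L :: "'w set set"
  assumes "simplicial K" "simplicial L" "\<And>\<sigma>. \<sigma> \<in> K \<Longrightarrow> A \<sigma> \<in> L"
    "\<And>\<rho> \<sigma>. \<sigma> \<in> K \<Longrightarrow> \<rho> \<subseteq> \<sigma> \<Longrightarrow> A \<rho> \<subseteq> A \<sigma>" "\<And>\<sigma>. \<sigma> \<in> K \<Longrightarrow> \<sigma> \<noteq> {} \<Longrightarrow> A \<sigma> \<noteq> {}"
  shows "acyclic_carrier K L (\<lambda>\<sigma>. Pow (A \<sigma>))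
    (\<lambda>\<sigma> _. cone (SOME a. a \<in> A \<sigma>) :: ('w list \<Rightarrow> 'k::field) \<Rightarrow> 'w list \<Rightarrow> 'k)"
proof
  show "filling (Pow (A \<sigma>)) (\<lambda>_. cone (SOME a. a \<in> A \<sigma>) :: ('w list \<Rightarrow> 'k) \<Rightarrow> 'w list \<Rightarrow> 'k)"
    if "\<sigma> \<in> K" "\<sigma> \<noteq> {}" for \<sigma>
  proof (rule filling_cone)
    have "(SOME a. a \<in> A \<sigma>) \<in> A \<sigma>" using assms(5)[OF that] by (simp add: some_in_eq)
    then show "insert (SOME a. a \<in> A \<sigma>) \<tau> \<in> Pow (A \<sigma>)" if "\<tau> \<in> Pow (A \<sigma>)" for \<tau> using that by auto
  qed
  show "Pow (A \<sigma>) \<subseteq> L" if "\<sigma> \<in> K" for \<sigma>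
    using assms(2) assms(3)[OF that] unfolding simplicial_def by auto
  show "Pow (A \<rho>) \<subseteq> Pow (A \<sigma>)" if "\<sigma> \<in> K" "\<rho> \<subseteq> \<sigma>" for \<rho> \<sigma>
    using assms(4)[OF that] by auto
qed (use assms in auto)

text \<open>The identity and \<open>g\<close> are contiguous, and \<open>g\<close> maps into a cone with apex \<open>a\<close>.\<close>

lemma filling_contractible:
  fixes B :: "'v set set"
  assumes B: "simplicial B" and g: "\<And>S. S \<in> B \<Longrightarrow> S \<union> g ` S \<in> B" and a: "\<And>S. S \<in> B \<Longrightarrow> insert a (g ` S) \<in> B"
  shows "\<exists>fill :: nat \<Rightarrow> ('v list \<Rightarrow> 'k::field) \<Rightarrow> 'v list \<Rightarrow> 'k. filling B fill"
proof -
  let ?id = "\<lambda>(_::nat) c :: 'v list \<Rightarrow> 'k. c" and ?g = "\<lambda>_::nat. chain_map g :: ('v list \<Rightarrow> 'k) \<Rightarrow> 'v list \<Rightarrow> 'k"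
  \<comment> \<open>The simplices that may be joined with \<open>a\<close>: \<open>g\<close> maps
    \<open>B\<close> into this family, and coning leads from it back into \<open>B\<close>.\<close>
  let ?D = "{\<tau>. insert a \<tau> \<in> B}"
  \<comment> \<open>Each simplex together with its image under \<open>g\<close> spans a simplex of
    \<open>B\<close>, so these full simplices carry both the identity and \<open>g\<close>.\<close>
  interpret acyclic_carrier B B "\<lambda>\<sigma>. Pow (\<sigma> \<union> g ` \<sigma>)"
    "\<lambda>\<sigma> _. cone (SOME a. a \<in> \<sigma> \<union> g ` \<sigma>) :: ('v list \<Rightarrow> 'k) \<Rightarrow> 'v list \<Rightarrow> 'k"
    by (rule acyclic_carrier_simplex) (use B g in auto)
  define h where "h = carried_homotopy ?id ?g"
  have gB: "g ` \<sigma> \<in> B" if "\<sigma> \<in> B" for \<sigma>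
    using B g[OF that] unfolding simplicial_def by blast
  have h: "chain_homotopy B B ?id ?g h"
    unfolding h_def
  proof (rule chain_homotopy_carried_homotopy)
    show "chain_morphism B B ?id" "chain_morphism B B ?g"
      by (auto intro!: chain_morphism_id chain_morphism_chain_map gB)
    show "carried B (\<lambda>\<sigma>. Pow (\<sigma> \<union> g ` \<sigma>)) n n (?id n)" for n
      unfolding carried_def by (auto elim!: alt_chains_mono)
    show "carried B (\<lambda>\<sigma>. Pow (\<sigma> \<union> g ` \<sigma>)) n n (?g n)" for n
      unfolding carried_def by (auto intro!: chain_map_in_alt_chains)
  qed
  have op_h: "chain_operator m B (Suc m) B (h m)" for m using h unfolding chain_homotopy_def by blast
  have op_g: "chain_operator m B m ?D (chain_map g)" for m by (rule chain_operator_chain_map) (use a in auto)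
  have op_c: "chain_operator m ?D (Suc m) B (cone a)" for m by (rule chain_operator_cone) auto
  \<comment> \<open>The homotopy bounds the difference of \<open>z\<close> and its image under
    \<open>g\<close>, and the cone bounds that image; together they bound \<open>z\<close>.\<close>
  define fl where "fl m z = (\<lambda>w. h m z w + cone a (chain_map g z) w)" for m z
  have "filling B fl"
    unfolding filling_def
  proof (intro allI conjI ballI impI)
    fix m
    show "chain_operator m B (Suc m) B (fl m)"
      using chain_operator_add[OF op_h[of m] chain_operator_comp[OF op_g op_c, of m], of 1 1] unfolding fl_def by simp
    fix z :: "'v list \<Rightarrow> 'k" assume z: "z \<in> alt_chains m B" "aug_boundary z = (\<lambda>_. 0)"
    have gz: "chain_map g z \<in> alt_chains m ?D" by (rule chain_operator_closed[OF op_g z(1)])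
    have 1: "aug_boundary (cone a (chain_map g z)) = chain_map g z"
    proof
      fix w
      have "aug_boundary (chain_map g z) = (\<lambda>_. 0)"
        using aug_boundary_chain_map[OF alt_chainsD(1)[OF z(1)], of g] z(2) by (intro ext) (simp add: chain_map_def)
      then show "aug_boundary (cone a (chain_map g z)) w = chain_map g z w"
        using aug_boundary_cone[OF gz, of a w] by simp
    qed
    have 2: "aug_boundary (h m z) = (\<lambda>w. z w - chain_map g z w)"
    proof (cases m)
      \<comment> \<open>The homotopy vanishes in degree 0, and \<open>g\<close> fixes the empty
        list, so the equation reads \<open>0 = z - z\<close>.\<close>
      case 0
      then have "z v = 0" "chain_map g z v = 0" if "v \<noteq> []" for v
        using that alt_chainsD(3)[OF z(1), of v] alt_chainsD(3)[OF gz, of v] by auto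
      then have "z v = chain_map g z v" for v by (cases "v = []") (simp_all add: chain_map_Nil)
      moreover have "h m z = (\<lambda>_. 0)" using h 0 unfolding chain_homotopy_def by auto
      ultimately show ?thesis by (simp add: aug_boundary_def fun_eq_iff)
    next
      case (Suc k)
      then have "aug_boundary (h m z) = (\<lambda>w. z w - chain_map g z w - h k (\<lambda>_. 0) w)"
        using h z unfolding chain_homotopy_def by metis
      then show ?thesis by (simp add: chain_operator_zero[OF op_h])
    qed
    show "aug_boundary (fl m z) = z"
    proof
      fix w
      have "aug_boundary (fl m z) w = 1 * aug_boundary (h m z) w + 1 * aug_boundary (cone a (chain_map g z)) w"
        using aug_boundary_lincomb[OF alt_chainsD(1)[OF chain_operator_closed[OF op_h z(1)]]
          alt_chainsD(1)[OF chain_operator_closed[OF op_c gz]], of 1 1 w] unfolding fl_def by simp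
      then show "aug_boundary (fl m z) w = z w" unfolding 1 2 by simp
    qed
  qed
  then show ?thesis by blast
qed

text \<open>The inverse \<open>s\<close> comes from a carrier and not from a vertex map, so it is a
  family of operators indexed by the degree.\<close>

definition homotopy_inverse ::
    "'v set set \<Rightarrow> 'w set set \<Rightarrow> ('v \<Rightarrow> 'w) \<Rightarrow> (nat \<Rightarrow> ('w list \<Rightarrow> 'k::field) \<Rightarrow> 'v list \<Rightarrow> 'k) \<Rightarrow> bool" where
  "homotopy_inverse M N f s \<longleftrightarrow> chain_morphism N M s \<and>
    (\<exists>h. chain_homotopy N N (\<lambda>n c. chain_map f (s n c)) (\<lambda>_ c. c) h) \<and>
    (\<exists>h. chain_homotopy M M (\<lambda>n c. s n (chain_map f c)) (\<lambda>_ c. c) h)"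

text \<open>Quillen's fibre lemma, with the contractibility of the fibres witnessed by fillings.\<close>

lemma homotopy_inverse_exists:
  fixes M :: "'v set set" and N :: "'w set set"
  assumes M: "simplicial M" "{} \<in> M" and N: "simplicial N" and f: "\<And>S. S \<in> M \<Longrightarrow> f ` S \<in> N"
    and fib: "\<And>\<sigma>. \<sigma> \<in> N \<Longrightarrow> \<sigma> \<noteq> {} \<Longrightarrow>
      \<exists>fill :: nat \<Rightarrow> ('v list \<Rightarrow> 'k::field) \<Rightarrow> 'v list \<Rightarrow> 'k. filling {S \<in> M. f ` S \<subseteq> \<sigma>} fill"
  shows "\<exists>s :: nat \<Rightarrow> ('w list \<Rightarrow> 'k::field) \<Rightarrow> 'v list \<Rightarrow> 'k. homotopy_inverse M N f s"
proof -
  let ?B = "\<lambda>\<sigma>. {S \<in> M. f ` S \<subseteq> \<sigma>}"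
  define fl :: "'w set \<Rightarrow> nat \<Rightarrow> ('v list \<Rightarrow> 'k) \<Rightarrow> 'v list \<Rightarrow> 'k" where "fl \<sigma> = (SOME fill. filling (?B \<sigma>) fill)" for \<sigma>
  have fl: "filling (?B \<sigma>) (fl \<sigma>)" if "\<sigma> \<in> N" "\<sigma> \<noteq> {}" for \<sigma>
    unfolding fl_def by (rule someI_ex[OF fib[OF that]])
  \<comment> \<open>The fibre over each simplex serves as its carrier; the carried map is the
    inverse.\<close>
  interpret A: acyclic_carrier N M ?B fl
    by standard (use M N fl in auto)
  \<comment> \<open>A chain on a simplex is lifted into the fibre and projected back into the same
    simplex, so full simplices carry both the composite on \<open>N\<close> and the
    identity.\<close>
  interpret P: acyclic_carrier N N Pow "\<lambda>\<sigma> _. cone (SOME a. a \<in> \<sigma>) :: ('w list \<Rightarrow> 'k) \<Rightarrow> 'w list \<Rightarrow> 'k"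
    by (rule acyclic_carrier_simplex) (use N in auto)
  \<comment> \<open>The fibre over the image of \<open>S\<close> contains \<open>S\<close> and its
    faces as well as all lifts of chains on that image, so it carries both the composite on
    \<open>M\<close> and the identity.\<close>
  interpret Q: acyclic_carrier M M "\<lambda>S. ?B (f ` S)" "\<lambda>S. fl (f ` S)"
  proof
    show "?B (f ` \<rho>) \<subseteq> ?B (f ` \<sigma>)" if "\<rho> \<subseteq> \<sigma>" for \<rho> \<sigma>
      using image_mono[OF that, of f] by blast
  qed (use M fl f in auto)
  let ?s = A.carried_map
  have s: "chain_morphism N M ?s" by (rule A.chain_morphism_carried_map)
  have F: "chain_morphism M N (\<lambda>_. chain_map f :: ('v list \<Rightarrow> 'k) \<Rightarrow> _)" by (rule chain_morphism_chain_map[OF f])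
  have "chain_homotopy N N (\<lambda>n c. chain_map f (?s n c)) (\<lambda>_ c. c) (P.carried_homotopy (\<lambda>n c. chain_map f (?s n c)) (\<lambda>_ c. c))"
  proof (rule P.chain_homotopy_carried_homotopy)
    show "carried N Pow n n (\<lambda>c. chain_map f (?s n c))" for n
      using A.carried_carried_map[of n] unfolding carried_def by (auto intro!: chain_map_in_alt_chains)
    show "carried N Pow n n (\<lambda>c :: 'w list \<Rightarrow> 'k. c)" for n unfolding carried_def by simp
  qed (use chain_morphism_comp[OF s F] chain_morphism_id in auto)
  moreover have "chain_homotopy M M (\<lambda>n c. ?s n (chain_map f c)) (\<lambda>_ c. c) (Q.carried_homotopy (\<lambda>n c. ?s n (chain_map f c)) (\<lambda>_ c. c))"
  proof (rule Q.chain_homotopy_carried_homotopy)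
    show "carried M (\<lambda>S. ?B (f ` S)) n n (\<lambda>c. ?s n (chain_map f c))" for n
      unfolding carried_def
    proof (intro ballI)
      fix S and c :: "'v list \<Rightarrow> 'k" assume "S \<in> M" "c \<in> alt_chains n (Pow S)"
      then have "f ` S \<in> N" "chain_map f c \<in> alt_chains n (Pow (f ` S))"
        using f by (auto intro!: chain_map_in_alt_chains)
      then show "?s n (chain_map f c) \<in> alt_chains n (?B (f ` S))"
        using A.carried_carried_map[of n] unfolding carried_def by blast
    qed
    show "carried M (\<lambda>S. ?B (f ` S)) n n (\<lambda>c :: 'v list \<Rightarrow> 'k. c)" for n
      unfolding carried_def using Q.faces by (auto elim!: alt_chains_mono)
  qed (use chain_morphism_comp[OF F s] chain_morphism_id in auto)
  ultimately have "homotopy_inverse M N f ?s" using s unfolding homotopy_inverse_def by blast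
  then show ?thesis by blast
qed

section \<open>Dowker complexes and the contractible fibres of the two projections\<close>

definition dowker :: "('a \<times> 'b) set \<Rightarrow> 'a set set" where
  "dowker R = {\<sigma>. finite \<sigma> \<and> (\<exists>y. \<forall>x\<in>\<sigma>. (x, y) \<in> R)}"

definition bicliques :: "('a \<times> 'b) set \<Rightarrow> ('a \<times> 'b) set set" where
  "bicliques R = {S. finite S \<and> fst ` S \<times> snd ` S \<subseteq> R}"

lemma simplicial_dowker: "simplicial (dowker R)"
  unfolding simplicial_def dowker_def using finite_subset by blast

lemma simplicial_bicliques: "simplicial (bicliques R)"
  unfolding simplicial_def bicliques_def
proof (intro ballI allI impI)
  fix S T assume S: "S \<in> {S. finite S \<and> fst ` S \<times> snd ` S \<subseteq> R}" and T: "T \<subseteq> S"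
  then have "fst ` T \<times> snd ` T \<subseteq> fst ` S \<times> snd ` S" by (intro Sigma_mono image_mono)
  with S T show "T \<in> {S. finite S \<and> fst ` S \<times> snd ` S \<subseteq> R}" using finite_subset[of T S] by blast
qed

lemma bicliques_fst:
  assumes "S \<in> bicliques R" shows "fst ` S \<in> dowker R"
proof (cases "S = {}")
  case False
  then obtain p where "p \<in> S" by blast
  with assms have "(x, snd p) \<in> R" if "x \<in> fst ` S" for x
    using that unfolding bicliques_def by blast
  with assms show ?thesis unfolding bicliques_def dowker_def by auto
qed (simp add: dowker_def)

lemma bicliques_snd:
  assumes "S \<in> bicliques R" shows "snd ` S \<in> dowker (R\<inverse>)"
proof (cases "S = {}")
  case False
  then obtain p where "p \<in> S" by blast
  with assms have "(fst p, y) \<in> R" if "y \<in> snd ` S" for y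
    using that unfolding bicliques_def by blast
  with assms show ?thesis unfolding bicliques_def dowker_def by auto
qed (simp add: dowker_def)

lemma in_bicliques_mono:
  assumes "finite T" "fst ` T \<subseteq> A" "snd ` T \<subseteq> C" "A \<times> C \<subseteq> R"
  shows "T \<in> bicliques R"
  using assms Sigma_mono[of "fst ` T" A "\<lambda>_. snd ` T" "\<lambda>_. C"] unfolding bicliques_def by blast

text \<open>A common witness \<open>y\<close> of \<open>\<sigma>\<close> contracts the fibre.
  Replacing all second coordinates by \<open>y\<close> is contiguous to the identity, since adding
  \<open>y\<close> to the second side keeps a biclique over \<open>\<sigma>\<close> inside
  \<open>R\<close>; the result lies in the full simplex on \<sigma> times
  {\<open>y\<close>}.\<close>

lemma dowker_fst_equivalence:
  fixes R :: "('a \<times> 'b) set"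
  shows "\<exists>s :: nat \<Rightarrow> ('a list \<Rightarrow> 'k::field) \<Rightarrow> ('a \<times> 'b) list \<Rightarrow> 'k.
    homotopy_inverse (bicliques R) (dowker R) fst s"
proof (rule homotopy_inverse_exists[OF simplicial_bicliques _ simplicial_dowker bicliques_fst])
  fix \<sigma> assume "\<sigma> \<in> dowker R" "\<sigma> \<noteq> {}"
  then obtain x y where x: "x \<in> \<sigma>" and y: "\<And>x. x \<in> \<sigma> \<Longrightarrow> (x, y) \<in> R" unfolding dowker_def by blast
  let ?g = "\<lambda>p. (fst p, y)"
  show "\<exists>fill :: nat \<Rightarrow> (('a \<times> 'b) list \<Rightarrow> 'k) \<Rightarrow> ('a \<times> 'b) list \<Rightarrow> 'k.
      filling {S \<in> bicliques R. fst ` S \<subseteq> \<sigma>} fill"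
  proof (rule filling_contractible[where g = ?g and a = "(x, y)"])
    show "simplicial {S \<in> bicliques R. fst ` S \<subseteq> \<sigma>}"
      using simplicial_bicliques[of R] unfolding simplicial_def by blast
    fix S assume S: "S \<in> {S \<in> bicliques R. fst ` S \<subseteq> \<sigma>}"
    have "fst ` S \<times> insert y (snd ` S) \<subseteq> R" using S y unfolding bicliques_def by blast
    then have "S \<union> ?g ` S \<in> bicliques R"
      by (rule in_bicliques_mono[rotated -1]) (use S in \<open>force simp: bicliques_def\<close>)+
    then show "S \<union> ?g ` S \<in> {S \<in> bicliques R. fst ` S \<subseteq> \<sigma>}" using S by auto
    have "\<sigma> \<times> {y} \<subseteq> R" using y by blast
    then have "insert (x, y) (?g ` S) \<in> bicliques R"
      by (rule in_bicliques_mono[rotated -1]) (use S x in \<open>force simp: bicliques_def\<close>)+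
    then show "insert (x, y) (?g ` S) \<in> {S \<in> bicliques R. fst ` S \<subseteq> \<sigma>}" using S x by auto
  qed
qed (auto simp: bicliques_def)

text \<open>The same contraction with the roles exchanged: a common index \<open>x\<close> replaces
  all first coordinates.\<close>

lemma dowker_snd_equivalence:
  fixes R :: "('a \<times> 'b) set"
  shows "\<exists>s :: nat \<Rightarrow> ('b list \<Rightarrow> 'k::field) \<Rightarrow> ('a \<times> 'b) list \<Rightarrow> 'k.
    homotopy_inverse (bicliques R) (dowker (R\<inverse>)) snd s"
proof (rule homotopy_inverse_exists[OF simplicial_bicliques _ simplicial_dowker bicliques_snd])
  fix \<sigma> assume "\<sigma> \<in> dowker (R\<inverse>)" "\<sigma> \<noteq> {}"
  then obtain x y where y: "y \<in> \<sigma>" and x: "\<And>y. y \<in> \<sigma> \<Longrightarrow> (x, y) \<in> R" unfolding dowker_def by blast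
  let ?g = "\<lambda>p. (x, snd p)"
  show "\<exists>fill :: nat \<Rightarrow> (('a \<times> 'b) list \<Rightarrow> 'k) \<Rightarrow> ('a \<times> 'b) list \<Rightarrow> 'k.
      filling {S \<in> bicliques R. snd ` S \<subseteq> \<sigma>} fill"
  proof (rule filling_contractible[where g = ?g and a = "(x, y)"])
    show "simplicial {S \<in> bicliques R. snd ` S \<subseteq> \<sigma>}"
      using simplicial_bicliques[of R] unfolding simplicial_def by blast
    fix S assume S: "S \<in> {S \<in> bicliques R. snd ` S \<subseteq> \<sigma>}"
    have "insert x (fst ` S) \<times> snd ` S \<subseteq> R" using S x unfolding bicliques_def by blast
    then have "S \<union> ?g ` S \<in> bicliques R"
      by (rule in_bicliques_mono[rotated -1]) (use S in \<open>force simp: bicliques_def\<close>)+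
    then show "S \<union> ?g ` S \<in> {S \<in> bicliques R. snd ` S \<subseteq> \<sigma>}" using S by auto
    have "{x} \<times> \<sigma> \<subseteq> R" using x by blast
    then have "insert (x, y) (?g ` S) \<in> bicliques R"
      by (rule in_bicliques_mono[rotated -1]) (use S y in \<open>force simp: bicliques_def\<close>)+
    then show "insert (x, y) (?g ` S) \<in> {S \<in> bicliques R. snd ` S \<subseteq> \<sigma>}" using S y by auto
  qed
qed (auto simp: bicliques_def)


section \<open>Homology classes and induced maps\<close>

lemma chains_eq_alt_chains_augmented: "{} \<in> K \<Longrightarrow> chains n K = alt_chains (Suc n) K"
  by (simp add: chains_eq_alt_chains insert_absorb)

text \<open>All chain groups entering \<open>homology\<close> consist of functions on nonempty
  lists, so nerves and co-nerves may be completed by the empty simplex.\<close>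

lemma homology_insert_empty: "homology n (insert {} K) = homology n K"
  "homology_map n (insert {} K) f = homology_map n K f"
  by (simp_all add: homology_def homology_map_def cycle_space_def cycles_def boundaries_def
      chains_eq_alt_chains fun_eq_iff)

lemma boundary_eq_aug_boundary: "boundary c w = (if w = [] then 0 else aug_boundary c w)"
  by (simp add: boundary_def aug_boundary_def)

text \<open>The two boundaries differ only at \<open>[]\<close>, where \<open>aug_boundary\<close>
  reads off single vertices; chains on two or more vertices have value 0 there.\<close>

lemma boundary_chain_eq:
  assumes "c \<in> alt_chains (Suc (Suc n)) K" shows "boundary c = aug_boundary c"
proof
  have "c [x] = 0" for x using alt_chainsD(3)[OF assms, of "[x]"] by auto
  then show "boundary c w = aug_boundary c w" for w
    by (simp add: boundary_eq_aug_boundary) (simp add: aug_boundary_def)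
qed

lemma boundary_0_chain:
  assumes "c \<in> alt_chains (Suc 0) K" shows "boundary c = (\<lambda>_. 0)"
proof
  have "c (x # w) = 0" if "w \<noteq> []" for x w using that alt_chainsD(3)[OF assms, of "x # w"] by auto
  then show "boundary c w = 0" for w by (simp add: boundary_def)
qed

text \<open>The coset of the boundaries through \<open>z\<close> as an explicit set; its members are
  cycles whenever \<open>z\<close> is one and the complex is augmented.\<close>

definition homology_class :: "nat \<Rightarrow> 'v set set \<Rightarrow> ('v list \<Rightarrow> 'k::field) \<Rightarrow> ('v list \<Rightarrow> 'k) set" where
  "homology_class n K z = {w. (\<lambda>v. w v - z v) \<in> boundaries n K}"

lemma coset_eq_homology_class: "boundaries n K +>\<^bsub>cycle_space n K\<^esub> z = homology_class n K z"
proof (intro equalityI subsetI)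
  fix w assume "w \<in> boundaries n K +>\<^bsub>cycle_space n K\<^esub> z"
  then obtain b where "b \<in> boundaries n K" "w = (\<lambda>v. b v + z v)"
    unfolding a_r_coset_def' by (auto simp: cycle_space_def)
  then show "w \<in> homology_class n K z" by (simp add: homology_class_def)
next
  fix w assume "w \<in> homology_class n K z"
  then show "w \<in> boundaries n K +>\<^bsub>cycle_space n K\<^esub> z"
    unfolding a_r_coset_def' homology_class_def
    by (auto simp: cycle_space_def intro!: bexI[of _ "\<lambda>v. w v - z v"])
qed

lemma carrier_homology: "carrier (homology n K) = homology_class n K ` cycles n K"
  unfolding homology_def quotient_space_def A_RCOSETS_def'
  by (auto simp: coset_eq_homology_class) (auto simp: cycle_space_def)

lemma homology_map_eq: "homology_map n L f A = (\<Union>z\<in>A. homology_class n L (chain_map f z))"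
  unfolding homology_map_def coset_eq_homology_class ..

lemma boundary_lincomb:
  assumes "c \<in> chains n K" "d \<in> chains n K"
  shows "boundary (\<lambda>v. a * c v + b * d v) = (\<lambda>w. a * boundary c w + b * boundary d w)"
  using assms unfolding chains_eq_alt_chains
  by (intro ext) (simp add: boundary_eq_aug_boundary aug_boundary_lincomb alt_chainsD(1))

lemma boundaries_lincomb:
  assumes "z \<in> boundaries n K" "w \<in> boundaries n K"
  shows "(\<lambda>v. a * z v + b * w v) \<in> boundaries n K"
proof -
  from assms obtain c d where c: "c \<in> chains (Suc n) K" "d \<in> chains (Suc n) K"
    and z: "z = boundary c" "w = boundary d" unfolding boundaries_def by blast
  have "(\<lambda>v. a * c v + b * d v) \<in> chains (Suc n) K"
    using c unfolding chains_eq_alt_chains by (rule lincomb_in_alt_chains)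
  then show ?thesis using boundary_lincomb[OF c, of a b] z unfolding boundaries_def by force
qed

lemma zero_in_boundaries: "(\<lambda>_. 0) \<in> (boundaries n K :: ('v list \<Rightarrow> 'k::field) set)"
proof -
  have "boundary (\<lambda>_. 0) = (\<lambda>_ :: 'v list. 0 :: 'k)" by (simp add: boundary_def fun_eq_iff)
  moreover have "(\<lambda>_. 0) \<in> chains (Suc n) K" by (simp add: chains_eq_alt_chains)
  ultimately show ?thesis unfolding boundaries_def by (intro image_eqI[of _ _ "\<lambda>_. 0"]) simp_all
qed

lemma boundaries_add: "z \<in> boundaries n K \<Longrightarrow> w \<in> boundaries n K \<Longrightarrow> (\<lambda>v. z v + w v) \<in> boundaries n K"
  using boundaries_lincomb[of z n K w 1 1] by simp

lemma boundaries_diff: "z \<in> boundaries n K \<Longrightarrow> w \<in> boundaries n K \<Longrightarrow> (\<lambda>v. z v - w v) \<in> boundaries n K"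
  using boundaries_lincomb[of z n K w 1 "-1"] by simp

lemma boundaries_scale: "z \<in> boundaries n K \<Longrightarrow> (\<lambda>v. a * z v) \<in> boundaries n K"
  using boundaries_lincomb[of z n K z a 0] by simp

lemma cycles_lincomb:
  assumes "z \<in> cycles n K" "w \<in> cycles n K"
  shows "(\<lambda>v. a * z v + b * w v) \<in> cycles n K"
proof -
  have c: "z \<in> chains n K" "w \<in> chains n K" "boundary z = (\<lambda>_. 0)" "boundary w = (\<lambda>_. 0)"
    using assms unfolding cycles_def by auto
  moreover have "(\<lambda>v. a * z v + b * w v) \<in> chains n K"
    using c(1,2) unfolding chains_eq_alt_chains by (rule lincomb_in_alt_chains)
  ultimately show ?thesis unfolding cycles_def by (simp add: boundary_lincomb)
qed

lemma zero_in_cycles: "(\<lambda>_. 0) \<in> cycles n K"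
  unfolding cycles_def by (simp add: chains_eq_alt_chains boundary_def fun_eq_iff)

lemma cycles_add: "z \<in> cycles n K \<Longrightarrow> w \<in> cycles n K \<Longrightarrow> (\<lambda>v. z v + w v) \<in> cycles n K"
  using cycles_lincomb[of z n K w 1 1] by simp

lemma cycles_scale: "z \<in> cycles n K \<Longrightarrow> (\<lambda>v. a * z v) \<in> cycles n K"
  using cycles_lincomb[of z n K z a 0] by simp

lemma self_in_homology_class: "z \<in> homology_class n K z"
  unfolding homology_class_def by (simp add: zero_in_boundaries)

lemma homology_class_eq_iff:
  "homology_class n K z = homology_class n K w \<longleftrightarrow> (\<lambda>v. z v - w v) \<in> boundaries n K"
proof
  assume "homology_class n K z = homology_class n K w"
  then have "z \<in> homology_class n K w" using self_in_homology_class by blast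
  then show "(\<lambda>v. z v - w v) \<in> boundaries n K" unfolding homology_class_def by simp
next
  assume zw: "(\<lambda>v. z v - w v) \<in> boundaries n K"
  have "(\<lambda>v. u v - z v) \<in> boundaries n K \<longleftrightarrow> (\<lambda>v. u v - w v) \<in> boundaries n K" for u
    using boundaries_add[OF _ zw, of "\<lambda>v. u v - z v"] boundaries_diff[OF _ zw, of "\<lambda>v. u v - w v"] by auto
  then show "homology_class n K z = homology_class n K w" unfolding homology_class_def by simp
qed

lemma homology_zero: "zero (homology n K) = homology_class n K (\<lambda>_. 0)"
  unfolding homology_def quotient_space_def homology_class_def by simp

lemma homology_add:
  "add (homology n K) (homology_class n K z) (homology_class n K w) = homology_class n K (\<lambda>v. z v + w v)"
proof -
  have "add (homology n K) (homology_class n K z) (homology_class n K w) =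
      {\<lambda>v. a v + b v | a b. a \<in> homology_class n K z \<and> b \<in> homology_class n K w}"
    unfolding homology_def quotient_space_def by (auto simp: set_add_def' cycle_space_def)
  also have "\<dots> = homology_class n K (\<lambda>v. z v + w v)"
  proof (intro equalityI subsetI)
    fix u assume "u \<in> {\<lambda>v. a v + b v | a b. a \<in> homology_class n K z \<and> b \<in> homology_class n K w}"
    then obtain a b where u: "u = (\<lambda>v. a v + b v)" and
      "(\<lambda>v. a v - z v) \<in> boundaries n K" "(\<lambda>v. b v - w v) \<in> boundaries n K"
      unfolding homology_class_def by blast
    from boundaries_add[OF this(2,3)] show "u \<in> homology_class n K (\<lambda>v. z v + w v)"
      unfolding homology_class_def u by (simp add: algebra_simps)
  next
    fix u assume u: "u \<in> homology_class n K (\<lambda>v. z v + w v)"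
    have "(\<lambda>v. u v - w v) \<in> homology_class n K z"
      using u unfolding homology_class_def by (simp add: algebra_simps)
    then show "u \<in> {\<lambda>v. a v + b v | a b. a \<in> homology_class n K z \<and> b \<in> homology_class n K w}"
      using self_in_homology_class[of w n K]
      by (intro CollectI exI[of _ "\<lambda>v. u v - w v"] exI[of _ w]) simp
  qed
  finally show ?thesis .
qed

lemma homology_smult:
  "smult (homology n K) a (homology_class n K z) = homology_class n K (\<lambda>v. a * z v)"
proof -
  have "smult (homology n K) a (homology_class n K z) =
      (\<Union>x\<in>homology_class n K z. homology_class n K (\<lambda>v. a * x v))"
    unfolding homology_def quotient_space_def coset_eq_homology_class by (simp add: cycle_space_def)
  also have "\<dots> = homology_class n K (\<lambda>v. a * z v)"
  proof -
    have "homology_class n K (\<lambda>v. a * x v) = homology_class n K (\<lambda>v. a * z v)"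
      if "x \<in> homology_class n K z" for x
      using boundaries_scale[of "\<lambda>v. x v - z v" n K a] that
      unfolding homology_class_eq_iff by (simp add: homology_class_def algebra_simps)
    then show ?thesis using self_in_homology_class by blast
  qed
  finally show ?thesis .
qed

lemma homology_carrierE:
  assumes "A \<in> carrier (homology n K)"
  obtains z where "z \<in> cycles n K" "A = homology_class n K z"
  using assms unfolding carrier_homology by blast

lemma homology_class_in_carrier: "z \<in> cycles n K \<Longrightarrow> homology_class n K z \<in> carrier (homology n K)"
  unfolding carrier_homology by blast

lemma vectorspace_homology: "vectorspace class_ring (homology n K :: ('k::field, ('v list \<Rightarrow> 'k) set) module)"
proof -
  let ?H = "homology n K :: ('k, ('v list \<Rightarrow> 'k) set) module"
  note rules = homology_add homology_smult homology_zero
  have "abelian_group ?H"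
  proof (rule abelian_groupI)
    fix A assume "A \<in> carrier ?H"
    then obtain z where z: "z \<in> cycles n K" "A = homology_class n K z" by (rule homology_carrierE)
    then show "\<exists>B\<in>carrier ?H. B \<oplus>\<^bsub>?H\<^esub> A = \<zero>\<^bsub>?H\<^esub>"
      using cycles_scale[OF z(1), of "-1"]
      by (intro bexI[of _ "homology_class n K (\<lambda>v. -1 * z v)"]) (auto simp: rules carrier_homology)
  qed (auto elim!: homology_carrierE simp: rules carrier_homology algebra_simps intro: cycles_add zero_in_cycles)
  then have "module class_ring ?H"
    by (intro moduleI class_field[THEN field.axioms(1), THEN domain.axioms(1)])
      (auto elim!: homology_carrierE simp: rules carrier_homology algebra_simps intro: cycles_scale)
  then show ?thesis by (intro vectorspace.intro class_field)
qed

text \<open>Operators on cycles that descend to homology. Working with representatives keeps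
  composites and strict equalities of chain maps available, while comparisons are made between
  classes.\<close>

definition homology_operator ::
    "nat \<Rightarrow> 'v set set \<Rightarrow> 'w set set \<Rightarrow> (('v list \<Rightarrow> 'k::field) \<Rightarrow> 'w list \<Rightarrow> 'k) \<Rightarrow> bool" where
  "homology_operator n K L T \<longleftrightarrow> (\<forall>z\<in>cycles n K. T z \<in> cycles n L) \<and>
    (\<forall>z\<in>cycles n K. \<forall>w\<in>cycles n K. \<forall>a b. T (\<lambda>v. a * z v + b * w v) = (\<lambda>u. a * T z u + b * T w u)) \<and>
    (\<forall>z\<in>cycles n K. \<forall>w\<in>cycles n K. homology_class n K z = homology_class n K w \<longrightarrow>
      homology_class n L (T z) = homology_class n L (T w))"

lemma homology_operatorD:
  assumes "homology_operator n K L T" "z \<in> cycles n K"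
  shows "T z \<in> cycles n L"
    and "w \<in> cycles n K \<Longrightarrow> T (\<lambda>v. a * z v + b * w v) = (\<lambda>u. a * T z u + b * T w u)"
    and "w \<in> cycles n K \<Longrightarrow> homology_class n K z = homology_class n K w \<Longrightarrow>
      homology_class n L (T z) = homology_class n L (T w)"
  using assms unfolding homology_operator_def by blast+

lemma homology_operator_comp:
  fixes S :: "('v list \<Rightarrow> 'k::field) \<Rightarrow> 'w list \<Rightarrow> 'k"
  assumes S: "homology_operator n K L S" and T: "homology_operator n L M T"
  shows "homology_operator n K M (\<lambda>z. T (S z))"
  unfolding homology_operator_def
proof (intro conjI ballI allI impI)
  fix z :: "'v list \<Rightarrow> 'k" assume z: "z \<in> cycles n K"
  note Sz = homology_operatorD[OF S z]
  show "T (S z) \<in> cycles n M" by (rule homology_operatorD(1)[OF T Sz(1)])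
  fix w :: "'v list \<Rightarrow> 'k" assume w: "w \<in> cycles n K"
  note Sw = homology_operatorD(1)[OF S w]
  show "T (S (\<lambda>v. a * z v + b * w v)) = (\<lambda>u. a * T (S z) u + b * T (S w) u)" for a b
    unfolding Sz(2)[OF w] by (rule homology_operatorD(2)[OF T Sz(1) Sw])
  assume "homology_class n K z = homology_class n K w"
  then show "homology_class n M (T (S z)) = homology_class n M (T (S w))"
    by (rule homology_operatorD(3)[OF T Sz(1) Sw Sz(3)[OF w]])
qed

text \<open>Extends \<open>homology_map\<close> to operators without an underlying vertex map, such
  as the inverses of the projections.\<close>

definition induced_map ::
    "nat \<Rightarrow> 'w set set \<Rightarrow> (('v list \<Rightarrow> 'k::field) \<Rightarrow> 'w list \<Rightarrow> 'k) \<Rightarrow> ('v list \<Rightarrow> 'k) set \<Rightarrow> ('w list \<Rightarrow> 'k) set" where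
  "induced_map n L T A = (\<Union>z\<in>A. homology_class n L (T z))"

lemma homology_map_eq_induced_map: "homology_map n L f = induced_map n L (chain_map f)"
  unfolding homology_map_eq induced_map_def by blast

definition augmented_complex :: "'v set set \<Rightarrow> bool" where
  "augmented_complex K \<longleftrightarrow> simplicial K \<and> {} \<in> K"

lemma boundaries_subset_cycles:
  assumes "augmented_complex K" shows "boundaries n K \<subseteq> cycles n K"
proof
  have K: "simplicial K" "{} \<in> K" using assms unfolding augmented_complex_def by auto
  fix z assume "z \<in> boundaries n K"
  then obtain b where b: "b \<in> alt_chains (Suc (Suc n)) K" "z = boundary b"
    unfolding boundaries_def chains_eq_alt_chains_augmented[OF K(2)] by blast
  have z: "z = aug_boundary b" using b boundary_chain_eq by blast
  have "z \<in> alt_chains (Suc n) K" unfolding z by (rule aug_boundary_in_alt_chains[OF b(1) K(1)])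
  moreover have "boundary z = (\<lambda>_. 0)"
    using aug_boundary_aug_boundary[OF b(1)] by (intro ext) (simp add: boundary_eq_aug_boundary z)
  ultimately show "z \<in> cycles n K" unfolding cycles_def chains_eq_alt_chains_augmented[OF K(2)] by simp
qed

lemma homology_class_subset_cycles:
  assumes "augmented_complex K" "z \<in> cycles n K" "w \<in> homology_class n K z"
  shows "w \<in> cycles n K"
proof -
  have "(\<lambda>v. w v - z v) \<in> cycles n K"
    using assms boundaries_subset_cycles unfolding homology_class_def by blast
  from cycles_add[OF this assms(2)] show ?thesis by simp
qed

lemma homology_class_eqI: "w \<in> homology_class n K z \<Longrightarrow> homology_class n K w = homology_class n K z"
  unfolding homology_class_eq_iff by (simp add: homology_class_def)

text \<open>All representatives of the class contribute the same set to the union.\<close>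

lemma induced_map_class:
  assumes K: "augmented_complex K" and T: "homology_operator n K L T" and z: "z \<in> cycles n K"
  shows "induced_map n L T (homology_class n K z) = homology_class n L (T z)"
proof -
  have "homology_class n L (T w) = homology_class n L (T z)" if "w \<in> homology_class n K z" for w
    by (rule homology_operatorD(3)[OF T homology_class_subset_cycles[OF K z that] z homology_class_eqI[OF that]])
  then show ?thesis unfolding induced_map_def using self_in_homology_class[of z n K] by blast
qed

lemma linear_map_induced_map:
  fixes T :: "('v list \<Rightarrow> 'k::field) \<Rightarrow> 'w list \<Rightarrow> 'k"
  assumes K: "augmented_complex K" and T: "homology_operator n K L T"
  shows "linear_map class_ring (homology n K) (homology n L) (induced_map n L T)"
proof -
  note ind = induced_map_class[OF K T]
  have add: "T (\<lambda>v. z v + w v) = (\<lambda>u. T z u + T w u)" if "z \<in> cycles n K" "w \<in> cycles n K" for z w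
    using homology_operatorD(2)[OF T that, of 1 1] by simp
  have scale: "T (\<lambda>v. a * z v) = (\<lambda>u. a * T z u)" if "z \<in> cycles n K" for z a
    using homology_operatorD(2)[OF T that that, of a 0] by simp
  have "induced_map n L T \<in> LinearCombinations.module_hom class_ring (homology n K) (homology n L)"
    unfolding LinearCombinations.module_hom_def
    by (auto elim!: homology_carrierE simp: ind homology_add homology_smult add scale cycles_add cycles_scale
        intro!: homology_class_in_carrier homology_operatorD(1)[OF T])
  moreover have V: "vectorspace class_ring (homology n K :: ('k, ('v list \<Rightarrow> 'k) set) module)"
    "vectorspace class_ring (homology n L :: ('k, ('w list \<Rightarrow> 'k) set) module)"
    by (rule vectorspace_homology)+
  ultimately show ?thesis
    unfolding linear_map_def mod_hom_def mod_hom_axioms_def by (simp add: vectorspace_def)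
qed

lemma chain_morphism_homology_operator:
  fixes f :: "nat \<Rightarrow> ('v list \<Rightarrow> 'k::field) \<Rightarrow> 'w list \<Rightarrow> 'k"
  assumes K: "augmented_complex K" and L: "augmented_complex L" and f: "chain_morphism K L f"
  shows "homology_operator n K L (f (Suc n))"
proof -
  have KL: "{} \<in> K" "{} \<in> L" using K L unfolding augmented_complex_def by auto
  note op = chain_morphismD(1)[OF f] and bd = chain_morphismD(2)[OF f]
  have cyc: "z \<in> cycles n K \<longleftrightarrow> z \<in> alt_chains (Suc n) K \<and> boundary z = (\<lambda>_. 0)" for z :: "'v list \<Rightarrow> 'k"
    unfolding cycles_def chains_eq_alt_chains_augmented[OF KL(1)] by simp
  have closed: "f (Suc n) z \<in> cycles n L" if z: "z \<in> cycles n K" for z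
  proof -
    have fz: "f (Suc n) z \<in> alt_chains (Suc n) L" using z op chain_operator_closed unfolding cyc by blast
    have "boundary (f (Suc n) z) = (\<lambda>_. 0)"
    proof (cases n)
      \<comment> \<open>Homology is unreduced: in dimension 0 every chain is a cycle, even if its
        augmentation is nonzero.\<close>
      case 0
      then show ?thesis using fz boundary_0_chain by simp
    next
      case (Suc k)
      have z': "z \<in> alt_chains (Suc (Suc k)) K" using z Suc unfolding cyc by simp
      then have "aug_boundary z = (\<lambda>_. 0)" using z boundary_chain_eq[OF z'] unfolding cyc by simp
      then have "aug_boundary (f (Suc n) z) = (\<lambda>_. 0)"
        using bd[of z n] z op[of n] chain_operator_zero unfolding cyc by metis
      then show ?thesis using boundary_chain_eq fz Suc by metis
    qed
    with fz show ?thesis unfolding cycles_def chains_eq_alt_chains_augmented[OF KL(2)] by simp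
  qed
  have bnd: "f (Suc n) z \<in> boundaries n L" if z: "z \<in> boundaries n K" for z
  proof -
    from z obtain b where b: "b \<in> alt_chains (Suc (Suc n)) K" "z = boundary b"
      unfolding boundaries_def chains_eq_alt_chains_augmented[OF KL(1)] by blast
    have fb: "f (Suc (Suc n)) b \<in> alt_chains (Suc (Suc n)) L" by (rule chain_operator_closed[OF op b(1)])
    have "f (Suc n) z = boundary (f (Suc (Suc n)) b)"
      using b bd[OF b(1)] boundary_chain_eq[OF b(1)] boundary_chain_eq[OF fb] by simp
    with fb show ?thesis unfolding boundaries_def chains_eq_alt_chains_augmented[OF KL(2)] by blast
  qed
  have "homology_class n L (f (Suc n) z) = homology_class n L (f (Suc n) w)"
    if zw: "z \<in> cycles n K" "w \<in> cycles n K" "homology_class n K z = homology_class n K w" for z w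
  proof -
    have "f (Suc n) (\<lambda>v. z v - w v) = (\<lambda>u. f (Suc n) z u - f (Suc n) w u)"
      using chain_operator_diff[OF op] zw(1,2) unfolding cyc by blast
    with bnd[of "\<lambda>v. z v - w v"] zw(3) show ?thesis unfolding homology_class_eq_iff by simp
  qed
  moreover have "f (Suc n) (\<lambda>v. a * z v + b * w v) = (\<lambda>u. a * f (Suc n) z u + b * f (Suc n) w u)"
    if "z \<in> cycles n K" "w \<in> cycles n K" for z w a b
    using chain_operator_lincomb[OF op] that unfolding cyc by blast
  ultimately show ?thesis using closed unfolding homology_operator_def by blast
qed

text \<open>On a cycle the homotopy equation leaves the difference of the two images as a
  boundary.\<close>

lemma chain_homotopy_class_eq:
  assumes K: "{} \<in> K" and L: "{} \<in> L" and h: "chain_homotopy K L f g h" and z: "z \<in> cycles n K"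
  shows "homology_class n L (f (Suc n) z) = homology_class n L (g (Suc n) z)"
proof -
  have z': "z \<in> alt_chains (Suc n) K" "boundary z = (\<lambda>_. 0)"
    using z unfolding cycles_def chains_eq_alt_chains_augmented[OF K] by auto
  have op: "chain_operator m K (Suc m) L (h m)" for m using h unfolding chain_homotopy_def by blast
  have "h n (aug_boundary z) = (\<lambda>_. 0)"
  proof (cases n)
    \<comment> \<open>Here the augmentation of \<open>z\<close> need not vanish; the term disappears
      because \<open>h 0\<close> is zero.\<close>
    case 0
    then show ?thesis using h unfolding chain_homotopy_def by simp
  next
    case (Suc k)
    then have "aug_boundary z = (\<lambda>_. 0)" using z' boundary_chain_eq by metis
    then show ?thesis using chain_operator_zero[OF op] by simp
  qed
  then have "aug_boundary (h (Suc n) z) = (\<lambda>w. f (Suc n) z w - g (Suc n) z w)"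
    using h z'(1) unfolding chain_homotopy_def by simp
  moreover have hz: "h (Suc n) z \<in> alt_chains (Suc (Suc n)) L" by (rule chain_operator_closed[OF op z'(1)])
  ultimately have "(\<lambda>w. f (Suc n) z w - g (Suc n) z w) = boundary (h (Suc n) z)"
    using boundary_chain_eq[OF hz] by simp
  then show ?thesis
    unfolding homology_class_eq_iff boundaries_def chains_eq_alt_chains_augmented[OF L] using hz by blast
qed


section \<open>Dowker duality and approximations\<close>

lemma augmented_dowker: "augmented_complex (dowker R)"
  unfolding augmented_complex_def by (simp add: simplicial_dowker) (simp add: dowker_def)

lemma augmented_bicliques: "augmented_complex (bicliques R)"
  unfolding augmented_complex_def by (simp add: simplicial_bicliques) (simp add: bicliques_def)

lemma homotopy_inverse_class:
  assumes "homotopy_inverse M N f s" "augmented_complex M" "augmented_complex N" and f: "\<forall>S\<in>M. f ` S \<in> N"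
  shows "homology_operator n N M (s (Suc n))" "homology_operator n M N (chain_map f)"
    and "z \<in> cycles n N \<Longrightarrow> homology_class n N (chain_map f (s (Suc n) z)) = homology_class n N z"
    and "w \<in> cycles n M \<Longrightarrow> homology_class n M (s (Suc n) (chain_map f w)) = homology_class n M w"
proof -
  have empty: "{} \<in> M" "{} \<in> N" using assms unfolding augmented_complex_def by auto
  obtain h h' where s: "chain_morphism N M s"
    and h: "chain_homotopy N N (\<lambda>n c. chain_map f (s n c)) (\<lambda>_ c. c) h"
    and h': "chain_homotopy M M (\<lambda>n c. s n (chain_map f c)) (\<lambda>_ c. c) h'"
    using assms(1) unfolding homotopy_inverse_def by blast
  show "homology_operator n N M (s (Suc n))"
    by (rule chain_morphism_homology_operator[OF assms(3,2) s])
  show "homology_operator n M N (chain_map f)"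
    by (rule chain_morphism_homology_operator[OF assms(2,3) chain_morphism_chain_map[OF bspec[OF f]]])
  show "homology_class n N (chain_map f (s (Suc n) z)) = homology_class n N z" if "z \<in> cycles n N"
    using chain_homotopy_class_eq[OF empty(2,2) h that] .
  show "homology_class n M (s (Suc n) (chain_map f w)) = homology_class n M w" if "w \<in> cycles n M"
    using chain_homotopy_class_eq[OF empty(1,1) h' that] .
qed

text \<open>An arbitrary choice for each relation, so sections of different relations commute with
  refinements in homology only.\<close>

definition dowker_section_fst :: "('a \<times> 'b) set \<Rightarrow> nat \<Rightarrow> ('a list \<Rightarrow> 'k::field) \<Rightarrow> ('a \<times> 'b) list \<Rightarrow> 'k" where
  "dowker_section_fst R = (SOME s. homotopy_inverse (bicliques R) (dowker R) fst s)"

definition dowker_section_snd :: "('a \<times> 'b) set \<Rightarrow> nat \<Rightarrow> ('b list \<Rightarrow> 'k::field) \<Rightarrow> ('a \<times> 'b) list \<Rightarrow> 'k" where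
  "dowker_section_snd R = (SOME s. homotopy_inverse (bicliques R) (dowker (R\<inverse>)) snd s)"

text \<open>The zigzag from indices over bicliques to points, with the first projection inverted.
  \<open>Suc\<close> passes from the dimension to the number of vertices.\<close>

definition dowker_map :: "nat \<Rightarrow> ('a \<times> 'b) set \<Rightarrow> ('a list \<Rightarrow> 'k::field) \<Rightarrow> 'b list \<Rightarrow> 'k" where
  "dowker_map n R z = chain_map snd (dowker_section_fst R (Suc n) z)"

definition dowker_map_inv :: "nat \<Rightarrow> ('a \<times> 'b) set \<Rightarrow> ('b list \<Rightarrow> 'k::field) \<Rightarrow> 'a list \<Rightarrow> 'k" where
  "dowker_map_inv n R z = chain_map fst (dowker_section_snd R (Suc n) z)"

lemma bicliques_fst_ball: "\<forall>S\<in>bicliques R. fst ` S \<in> dowker R"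
  using bicliques_fst by blast

lemma bicliques_snd_ball: "\<forall>S\<in>bicliques R. snd ` S \<in> dowker (R\<inverse>)"
  using bicliques_snd by blast

lemmas section_fst = homotopy_inverse_class[OF someI_ex[OF dowker_fst_equivalence, folded dowker_section_fst_def]
    augmented_bicliques augmented_dowker bicliques_fst_ball]

lemmas section_snd = homotopy_inverse_class[OF someI_ex[OF dowker_snd_equivalence, folded dowker_section_snd_def]
    augmented_bicliques augmented_dowker bicliques_snd_ball]

lemma homology_operator_dowker_map:
  "homology_operator n (dowker R) (dowker (R\<inverse>)) (dowker_map n R)"
  unfolding dowker_map_def by (rule homology_operator_comp[OF section_fst(1) section_snd(2)])

lemma homology_operator_dowker_map_inv:
  "homology_operator n (dowker (R\<inverse>)) (dowker R) (dowker_map_inv n R)"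
  unfolding dowker_map_inv_def by (rule homology_operator_comp[OF section_snd(1) section_fst(2)])

text \<open>In the composite, the second section cancels against the second projection in the
  homology of bicliques; then the first projection cancels against the first section.\<close>

lemma dowker_map_inv_dowker_map:
  assumes z: "z \<in> cycles n (dowker R)"
  shows "homology_class n (dowker R) (dowker_map_inv n R (dowker_map n R z)) = homology_class n (dowker R) z"
proof -
  let ?w = "dowker_section_fst R (Suc n) z"
  have w: "?w \<in> cycles n (bicliques R)" by (rule homology_operatorD(1)[OF section_fst(1) z])
  have w': "dowker_section_snd R (Suc n) (chain_map snd ?w) \<in> cycles n (bicliques R)"
    by (rule homology_operatorD(1)[OF section_snd(1) homology_operatorD(1)[OF section_snd(2) w]])
  have "homology_class n (dowker R) (dowker_map_inv n R (dowker_map n R z)) =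
      homology_class n (dowker R) (chain_map fst ?w)"
    unfolding dowker_map_def dowker_map_inv_def
    by (rule homology_operatorD(3)[OF section_fst(2) w' w section_snd(4)[OF w]])
  then show ?thesis unfolding section_fst(3)[OF z] .
qed

lemma dowker_map_dowker_map_inv:
  assumes z: "z \<in> cycles n (dowker (R\<inverse>))"
  shows "homology_class n (dowker (R\<inverse>)) (dowker_map n R (dowker_map_inv n R z)) = homology_class n (dowker (R\<inverse>)) z"
proof -
  let ?w = "dowker_section_snd R (Suc n) z"
  have w: "?w \<in> cycles n (bicliques R)" by (rule homology_operatorD(1)[OF section_snd(1) z])
  have w': "dowker_section_fst R (Suc n) (chain_map fst ?w) \<in> cycles n (bicliques R)"
    by (rule homology_operatorD(1)[OF section_fst(1) homology_operatorD(1)[OF section_fst(2) w]])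
  have "homology_class n (dowker (R\<inverse>)) (dowker_map n R (dowker_map_inv n R z)) =
      homology_class n (dowker (R\<inverse>)) (chain_map snd ?w)"
    unfolding dowker_map_def dowker_map_inv_def
    by (rule homology_operatorD(3)[OF section_snd(2) w' w section_fst(4)[OF w]])
  then show ?thesis unfolding section_snd(3)[OF z] .
qed

lemma homology_operator_chain_map:
  "augmented_complex K \<Longrightarrow> augmented_complex L \<Longrightarrow> (\<And>\<sigma>. \<sigma> \<in> K \<Longrightarrow> f ` \<sigma> \<in> L) \<Longrightarrow> homology_operator n K L (chain_map f)"
  by (rule chain_morphism_homology_operator[OF _ _ chain_morphism_chain_map])

lemma cycles_finite: "z \<in> cycles n K \<Longrightarrow> finite {v. z v \<noteq> 0}"
  unfolding cycles_def chains_def by blast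

text \<open>\<open>map_prod f id\<close> acts on bicliques. It covers \<open>f\<close> under the
  first projection and leaves the second projection unchanged, which is why no map is applied on the
  right-hand side.\<close>

lemma dowker_map_natural:
  assumes f: "\<And>x y. (x, y) \<in> R \<Longrightarrow> (f x, y) \<in> R'" and z: "z \<in> cycles n (dowker R)"
  shows "homology_class n (dowker (R'\<inverse>)) (dowker_map n R' (chain_map f z)) =
    homology_class n (dowker (R'\<inverse>)) (dowker_map n R z)"
proof -
  let ?w = "dowker_section_fst R (Suc n) z" and ?m = "chain_map (map_prod f id)"
  have w: "?w \<in> cycles n (bicliques R)" by (rule homology_operatorD(1)[OF section_fst(1) z])
  have "homology_operator n (bicliques R) (bicliques R') ?m"
  proof (rule homology_operator_chain_map[OF augmented_bicliques augmented_bicliques])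
    show "map_prod f id ` S \<in> bicliques R'" if "S \<in> bicliques R" for S
      using that f unfolding bicliques_def by fastforce
  qed
  note mw = homology_operatorD(1)[OF this w]
  have fR: "homology_operator n (dowker R) (dowker R') (chain_map f)"
    by (rule homology_operator_chain_map[OF augmented_dowker augmented_dowker])
      (use f in \<open>unfold dowker_def, blast\<close>)
  note pw = homology_operatorD(1)[OF section_fst(2) w]
  \<comment> \<open>Up to homology \<open>z\<close> is the first projection of a biclique cycle, so
    its image comes from the image of that cycle.\<close>
  have "homology_class n (dowker R') (chain_map f z) = homology_class n (dowker R') (chain_map f (chain_map fst ?w))"
    by (rule homology_operatorD(3)[OF fR z pw]) (simp add: section_fst(3)[OF z])
  also have "chain_map f (chain_map fst ?w) = chain_map fst (?m ?w)"
    by (simp add: chain_map_comp[OF cycles_finite[OF w]] fst_comp_map_prod)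
  finally have eq: "homology_class n (dowker R') (chain_map f z) = homology_class n (dowker R') (chain_map fst (?m ?w))" .
  have fz: "chain_map f z \<in> cycles n (dowker R')" by (rule homology_operatorD(1)[OF fR z])
  have pmw: "chain_map fst (?m ?w) \<in> cycles n (dowker R')" by (rule homology_operatorD(1)[OF section_fst(2) mw])
  \<comment> \<open>The section chosen for \<open>R'\<close> need not commute with \<open>f\<close>,
    but it undoes the first projection in homology and thus returns the class of the transported
    biclique cycle.\<close>
  have "homology_class n (bicliques R') (dowker_section_fst R' (Suc n) (chain_map f z)) =
      homology_class n (bicliques R') (?m ?w)"
    using homology_operatorD(3)[OF section_fst(1) fz pmw eq] section_fst(4)[OF mw] by simp
  then have "homology_class n (dowker (R'\<inverse>)) (dowker_map n R' (chain_map f z)) =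
      homology_class n (dowker (R'\<inverse>)) (chain_map snd (?m ?w))"
    unfolding dowker_map_def
    by (rule homology_operatorD(3)[OF section_snd(2) homology_operatorD(1)[OF section_fst(1) fz] mw])
  also have "chain_map snd (?m ?w) = chain_map snd ?w"
    by (simp add: chain_map_comp[OF cycles_finite[OF w]] snd_comp_map_prod)
  finally show ?thesis unfolding dowker_map_def .
qed

section \<open>Homology of persistent complexes as a persistence module\<close>

definition homology_persistence ::
    "nat \<Rightarrow> (real \<Rightarrow> 'v set set) \<Rightarrow> (real \<Rightarrow> real \<Rightarrow> 'v \<Rightarrow> 'v) \<Rightarrow> ('k::field, ('v list \<Rightarrow> 'k) set) persistence_module" where
  "homology_persistence n K f = \<lparr>space_at = (\<lambda>r. homology n (K r)), space_map = (\<lambda>r s. homology_map n (K s) (f r s))\<rparr>"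

locale persistent_complex =
  fixes K :: "real \<Rightarrow> 'v set set" and f :: "real \<Rightarrow> real \<Rightarrow> 'v \<Rightarrow> 'v"
  assumes complex: "0 \<le> r \<Longrightarrow> augmented_complex (K r)"
    and simplicial_map: "0 \<le> r \<Longrightarrow> r \<le> s \<Longrightarrow> \<sigma> \<in> K r \<Longrightarrow> f r s ` \<sigma> \<in> K s"
    and identity: "0 \<le> r \<Longrightarrow> \<sigma> \<in> K r \<Longrightarrow> x \<in> \<sigma> \<Longrightarrow> f r r x = x"
    and composition: "0 \<le> r \<Longrightarrow> r \<le> s \<Longrightarrow> s \<le> t \<Longrightarrow> \<sigma> \<in> K r \<Longrightarrow> x \<in> \<sigma> \<Longrightarrow> f s t (f r s x) = f r t x"

lemma cycles_simplex: "augmented_complex K \<Longrightarrow> z \<in> cycles n K \<Longrightarrow> z v \<noteq> 0 \<Longrightarrow> set v \<in> K"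
  unfolding cycles_def chains_def by blast

lemma persistent_operator:
  assumes K: "persistent_complex K f" and "0 \<le> r" "r \<le> s"
  shows "homology_operator n (K r) (K s) (chain_map (f r s))"
  using assms by (intro homology_operator_chain_map persistent_complex.complex[OF K] persistent_complex.simplicial_map[OF K]) auto

lemma persistent_space_map:
  assumes K: "persistent_complex K f" and rs: "0 \<le> r" "r \<le> s" and z: "z \<in> cycles n (K r)"
  shows "homology_map n (K s) (f r s) (homology_class n (K r) z) = homology_class n (K s) (chain_map (f r s) z)"
  unfolding homology_map_eq_induced_map
  by (rule induced_map_class[OF persistent_complex.complex[OF K rs(1)] persistent_operator[OF K rs] z])

lemma chain_map_identity:
  assumes K: "persistent_complex K f" and r: "0 \<le> r" and z: "z \<in> cycles n (K r)"
  shows "chain_map (f r r) z = z"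
proof -
  have "map (f r r) v = map id v" if "z v \<noteq> 0" for v
    using persistent_complex.identity[OF K r cycles_simplex[OF persistent_complex.complex[OF K r] z that]]
    by (auto intro: map_idI)
  then have "chain_map (f r r) z = chain_map id z" by (rule chain_map_cong)
  then show ?thesis by simp
qed

lemma is_persistence_module_homology:
  assumes K: "persistent_complex K f"
  shows "is_persistence_module (homology_persistence n K f :: ('k::field, ('v list \<Rightarrow> 'k) set) persistence_module)"
  unfolding is_persistence_module_def homology_persistence_def persistence_module.simps
proof (intro conjI allI impI ballI; (elim conjE)?)
  show "vectorspace class_ring (homology n (K r))" for r by (rule vectorspace_homology)
  show "linear_map class_ring (homology n (K r)) (homology n (K s)) (homology_map n (K s) (f r s))"
    if "0 \<le> r" "r \<le> s" for r s
    unfolding homology_map_eq_induced_map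
    by (rule linear_map_induced_map[OF persistent_complex.complex[OF K that(1)] persistent_operator[OF K that]])
  show "homology_map n (K r) (f r r) A = A" if r: "0 \<le> r" and "A \<in> carrier (homology n (K r))"
    for r and A :: "('v list \<Rightarrow> 'k) set"
    using that(2)
  proof (rule homology_carrierE)
    fix z assume z: "z \<in> cycles n (K r)" "A = homology_class n (K r) z"
    show ?thesis
      using persistent_space_map[OF K r order_refl z(1)] chain_map_identity[OF K r z(1)] z(2) by simp
  qed
  show "homology_map n (K t) (f s t) (homology_map n (K s) (f r s) A) = homology_map n (K t) (f r t) A"
    if rst: "0 \<le> r" "r \<le> s" "s \<le> t" and "A \<in> carrier (homology n (K r))" for r s t and A :: "('v list \<Rightarrow> 'k) set"
    using that(4)
  proof (rule homology_carrierE)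
    fix z assume z: "z \<in> cycles n (K r)" "A = homology_class n (K r) z"
    have 1: "chain_map (f s t) (chain_map (f r s) z) = chain_map (f r t) z"
      unfolding chain_map_comp[OF cycles_finite[OF z(1)]]
      by (rule chain_map_cong)
        (use cycles_simplex[OF persistent_complex.complex[OF K rst(1)] z(1)] persistent_complex.composition[OF K rst] in auto)
    have s: "0 \<le> s" "r \<le> t" using rst by auto
    show ?thesis
      unfolding z(2) persistent_space_map[OF K rst(1,2) z(1)] persistent_space_map[OF K rst(1) s(2) z(1)]
        persistent_space_map[OF K s(1) rst(3) homology_operatorD(1)[OF persistent_operator[OF K rst(1,2)] z(1)]] 1 ..
  qed
qed

section \<open>Composing approximations and building them from operators on cycles\<close>

lemma scale_facts:
  fixes c :: real
  assumes "1 \<le> c" "0 \<le> r" "r \<le> s"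
  shows "0 \<le> c * r" "c * r \<le> c * s" "r \<le> c\<^sup>2 * r" "c * (c * r) = c\<^sup>2 * r"
  using assms mult_right_mono[OF one_le_power[OF assms(1), of 2] assms(2)]
  by (auto simp: mult_left_mono power2_eq_square mult.assoc)

lemma approximated_sym: "approximated c F G \<Longrightarrow> approximated c G F"
  unfolding approximated_def by blast

lemma linear_map_comp:
  assumes "linear_map R A B f" "linear_map R B C g"
  shows "linear_map R A C (g \<circ> f)"
  using assms unfolding linear_map_def mod_hom_def mod_hom_axioms_def LinearCombinations.module_hom_def
  by (auto simp: Pi_iff)

lemma rescale_1: "rescale 1 F = F"
  by (simp add: rescale_def)

lemma natural_transformationD:
  assumes "natural_transformation F G \<phi>" "0 \<le> r"
  shows "linear_map class_ring (space_at F r) (space_at G r) (\<phi> r)"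
    and "x \<in> carrier (space_at F r) \<Longrightarrow> \<phi> r x \<in> carrier (space_at G r)"
    and "r \<le> s \<Longrightarrow> x \<in> carrier (space_at F r) \<Longrightarrow> \<phi> s (space_map F r s x) = space_map G r s (\<phi> r x)"
  using assms unfolding natural_transformation_def
  by (auto simp: linear_map_def mod_hom_def mod_hom_axioms_def LinearCombinations.module_hom_def Pi_iff)

lemma is_persistence_moduleD:
  assumes "is_persistence_module F" "0 \<le> r"
  shows "r \<le> s \<Longrightarrow> x \<in> carrier (space_at F r) \<Longrightarrow> space_map F r s x \<in> carrier (space_at F s)"
    and "x \<in> carrier (space_at F r) \<Longrightarrow> space_map F r r x = x"
  using assms unfolding is_persistence_module_def
  by (auto simp: linear_map_def mod_hom_def mod_hom_axioms_def LinearCombinations.module_hom_def Pi_iff)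

text \<open>A \<open>1\<close>-approximation is a natural isomorphism.\<close>

lemma approximated_iso_trans:
  assumes c: "1 \<le> c" and iso: "approximated 1 F G" and GH: "approximated c G H"
  shows "approximated c F H"
proof -
  obtain \<alpha> \<beta> where FG: "is_persistence_module F" "is_persistence_module G"
    and \<alpha>: "natural_transformation F G \<alpha>" and \<beta>: "natural_transformation G F \<beta>"
    and \<beta>\<alpha>: "\<And>r x. 0 \<le> r \<Longrightarrow> x \<in> carrier (space_at F r) \<Longrightarrow> \<beta> r (\<alpha> r x) = space_map F r r x"
    and \<alpha>\<beta>: "\<And>r y. 0 \<le> r \<Longrightarrow> y \<in> carrier (space_at G r) \<Longrightarrow> \<alpha> r (\<beta> r y) = space_map G r r y"
    using iso unfolding approximated_def rescale_1 by auto
  obtain \<phi> \<psi> where H: "is_persistence_module H"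
    and \<phi>: "natural_transformation G (rescale c H) \<phi>" and \<psi>: "natural_transformation H (rescale c G) \<psi>"
    and \<psi>\<phi>: "\<And>r x. 0 \<le> r \<Longrightarrow> x \<in> carrier (space_at G r) \<Longrightarrow> \<psi> (c * r) (\<phi> r x) = space_map G r (c\<^sup>2 * r) x"
    and \<phi>\<psi>: "\<And>r y. 0 \<le> r \<Longrightarrow> y \<in> carrier (space_at H r) \<Longrightarrow> \<phi> (c * r) (\<psi> r y) = space_map H r (c\<^sup>2 * r) y"
    using GH unfolding approximated_def by auto
  note c0 = scale_facts[OF c]
  have nat1: "natural_transformation F (rescale c H) (\<lambda>r. \<phi> r \<circ> \<alpha> r)"
    unfolding natural_transformation_def
  proof (intro conjI allI impI ballI; (elim conjE)?)
    show "linear_map class_ring (space_at F r) (space_at (rescale c H) r) (\<phi> r \<circ> \<alpha> r)" if "0 \<le> r" for r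
      by (rule linear_map_comp[OF natural_transformationD(1)[OF \<alpha> that] natural_transformationD(1)[OF \<phi> that]])
    show "(\<phi> s \<circ> \<alpha> s) (space_map F r s x) = space_map (rescale c H) r s ((\<phi> r \<circ> \<alpha> r) x)"
      if "0 \<le> r" "r \<le> s" "x \<in> carrier (space_at F r)" for r s x
      using natural_transformationD[OF \<alpha> that(1)] natural_transformationD(3)[OF \<phi> that(1)] that by simp
  qed
  \<comment> \<open>\<open>\<psi> r\<close> ends at parameter \<open>c * r\<close>, so the
    isomorphism back to \<open>F\<close> is taken there.\<close>
  have nat2: "natural_transformation H (rescale c F) (\<lambda>r. \<beta> (c * r) \<circ> \<psi> r)"
    unfolding natural_transformation_def
  proof (intro conjI allI impI ballI; (elim conjE)?)
    show "linear_map class_ring (space_at H r) (space_at (rescale c F) r) (\<beta> (c * r) \<circ> \<psi> r)" if "0 \<le> r" for r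
      using linear_map_comp[OF natural_transformationD(1)[OF \<psi> that] ]
        natural_transformationD(1)[OF \<beta> c0(1)[OF that order_refl]] by (simp add: rescale_def)
    show "(\<beta> (c * s) \<circ> \<psi> s) (space_map H r s x) = space_map (rescale c F) r s ((\<beta> (c * r) \<circ> \<psi> r) x)"
      if "0 \<le> r" "r \<le> s" "x \<in> carrier (space_at H r)" for r s x
      using natural_transformationD(2,3)[OF \<psi> that(1)] natural_transformationD(3)[OF \<beta> c0(1)[OF that(1,2)] c0(2)[OF that(1,2)]] that
      by (simp add: rescale_def)
  qed
  \<comment> \<open>The inner composite is a structure map of \<open>G\<close>; naturality carries
    it through \<open>\<beta>\<close>, after which \<open>\<beta>\<close> and
    \<open>\<alpha>\<close> cancel at \<open>r\<close>.\<close>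
  have 1: "(\<beta> (c * (c * r)) \<circ> \<psi> (c * r)) ((\<phi> r \<circ> \<alpha> r) x) = space_map F r (c\<^sup>2 * r) x"
    if r: "0 \<le> r" and x: "x \<in> carrier (space_at F r)" for r x
  proof -
    have ax: "\<alpha> r x \<in> carrier (space_at G r)" by (rule natural_transformationD(2)[OF \<alpha> r x])
    have "(\<beta> (c * (c * r)) \<circ> \<psi> (c * r)) ((\<phi> r \<circ> \<alpha> r) x) = \<beta> (c\<^sup>2 * r) (space_map G r (c\<^sup>2 * r) (\<alpha> r x))"
      by (simp add: \<psi>\<phi>[OF r ax] c0(4)[OF r order_refl])
    also have "\<dots> = space_map F r (c\<^sup>2 * r) (\<beta> r (\<alpha> r x))"
      by (rule natural_transformationD(3)[OF \<beta> r c0(3)[OF r order_refl] ax])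
    finally show ?thesis using \<beta>\<alpha>[OF r x] is_persistence_moduleD(2)[OF FG(1) r x] by simp
  qed
  \<comment> \<open>The isomorphism and its inverse meet at parameter \<open>c * r\<close> and
    cancel.\<close>
  have 2: "(\<phi> (c * r) \<circ> \<alpha> (c * r)) ((\<beta> (c * r) \<circ> \<psi> r) y) = space_map H r (c\<^sup>2 * r) y"
    if r: "0 \<le> r" and y: "y \<in> carrier (space_at H r)" for r y
  proof -
    have "\<psi> r y \<in> carrier (space_at G (c * r))"
      using natural_transformationD(2)[OF \<psi> r y] by (simp add: rescale_def)
    then show ?thesis
      using \<alpha>\<beta>[OF c0(1)[OF r order_refl]] is_persistence_moduleD(2)[OF FG(2) c0(1)[OF r order_refl]] \<phi>\<psi>[OF r y] by simp
  qed
  show ?thesis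
    unfolding approximated_def using FG(1) H nat1 nat2 1 2 by blast
qed

text \<open>All conditions of an approximation are stated for representing cycles, so that the
  treatment of cosets and induced maps happens only here.\<close>

lemma approximated_homology:
  fixes \<Phi> :: "real \<Rightarrow> ('v list \<Rightarrow> 'k::field) \<Rightarrow> 'w list \<Rightarrow> 'k"
  assumes c: "1 \<le> c" and K: "persistent_complex K f" and L: "persistent_complex L g"
    and \<Phi>: "\<And>r. 0 \<le> r \<Longrightarrow> homology_operator n (K r) (L (c * r)) (\<Phi> r)"
    and \<Psi>: "\<And>r. 0 \<le> r \<Longrightarrow> homology_operator n (L r) (K (c * r)) (\<Psi> r)"
    and \<Phi>_nat: "\<And>r s z. 0 \<le> r \<Longrightarrow> r \<le> s \<Longrightarrow> z \<in> cycles n (K r) \<Longrightarrow>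
      homology_class n (L (c * s)) (\<Phi> s (chain_map (f r s) z)) =
      homology_class n (L (c * s)) (chain_map (g (c * r) (c * s)) (\<Phi> r z))"
    and \<Psi>_nat: "\<And>r s z. 0 \<le> r \<Longrightarrow> r \<le> s \<Longrightarrow> z \<in> cycles n (L r) \<Longrightarrow>
      homology_class n (K (c * s)) (\<Psi> s (chain_map (g r s) z)) =
      homology_class n (K (c * s)) (chain_map (f (c * r) (c * s)) (\<Psi> r z))"
    and \<Psi>\<Phi>: "\<And>r z. 0 \<le> r \<Longrightarrow> z \<in> cycles n (K r) \<Longrightarrow>
      homology_class n (K (c\<^sup>2 * r)) (\<Psi> (c * r) (\<Phi> r z)) = homology_class n (K (c\<^sup>2 * r)) (chain_map (f r (c\<^sup>2 * r)) z)"
    and \<Phi>\<Psi>: "\<And>r z. 0 \<le> r \<Longrightarrow> z \<in> cycles n (L r) \<Longrightarrow>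
      homology_class n (L (c\<^sup>2 * r)) (\<Phi> (c * r) (\<Psi> r z)) = homology_class n (L (c\<^sup>2 * r)) (chain_map (g r (c\<^sup>2 * r)) z)"
  shows "approximated c (homology_persistence n K f :: ('k, _) persistence_module) (homology_persistence n L g)"
proof -
  let ?\<phi> = "\<lambda>r. induced_map n (L (c * r)) (\<Phi> r)" and ?\<psi> = "\<lambda>r. induced_map n (K (c * r)) (\<Psi> r)"
  note c0 = scale_facts(1,2)[OF c] and c2 = scale_facts(3,4)[OF c _ order_refl]
  note cK = induced_map_class[OF persistent_complex.complex[OF K] \<Phi>] and cL = induced_map_class[OF persistent_complex.complex[OF L] \<Psi>]
  note mK = persistent_space_map[OF K] and mL = persistent_space_map[OF L]
  note oK = homology_operatorD(1)[OF persistent_operator[OF K]] and oL = homology_operatorD(1)[OF persistent_operator[OF L]]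
  have 1: "natural_transformation (homology_persistence n K f) (rescale c (homology_persistence n L g)) ?\<phi>"
    unfolding natural_transformation_def homology_persistence_def rescale_def persistence_module.simps
  proof (intro conjI allI impI ballI; (elim conjE)?)
    show "linear_map class_ring (homology n (K r)) (homology n (L (c * r))) (?\<phi> r)" if "0 \<le> r" for r
      by (rule linear_map_induced_map[OF persistent_complex.complex[OF K that] \<Phi>[OF that]])
    fix r s and A :: "('v list \<Rightarrow> 'k) set" assume rs: "0 \<le> r" "r \<le> s" and "A \<in> carrier (homology n (K r))"
    from this(3) obtain z where z: "z \<in> cycles n (K r)" "A = homology_class n (K r) z" by (rule homology_carrierE)
    have s: "0 \<le> s" using rs by simp
    show "?\<phi> s (homology_map n (K s) (f r s) A) = homology_map n (L (c * s)) (g (c * r) (c * s)) (?\<phi> r A)"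
      unfolding z(2) mK[OF rs z(1)] cK[OF s s oK[OF rs z(1)]] cK[OF rs(1,1) z(1)]
        mL[OF c0[OF rs] homology_operatorD(1)[OF \<Phi>[OF rs(1)] z(1)]] by (rule \<Phi>_nat[OF rs z(1)])
  qed
  have 2: "natural_transformation (homology_persistence n L g) (rescale c (homology_persistence n K f)) ?\<psi>"
    unfolding natural_transformation_def homology_persistence_def rescale_def persistence_module.simps
  proof (intro conjI allI impI ballI; (elim conjE)?)
    show "linear_map class_ring (homology n (L r)) (homology n (K (c * r))) (?\<psi> r)" if "0 \<le> r" for r
      by (rule linear_map_induced_map[OF persistent_complex.complex[OF L that] \<Psi>[OF that]])
    fix r s and A :: "('w list \<Rightarrow> 'k) set" assume rs: "0 \<le> r" "r \<le> s" and "A \<in> carrier (homology n (L r))"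
    from this(3) obtain z where z: "z \<in> cycles n (L r)" "A = homology_class n (L r) z" by (rule homology_carrierE)
    have s: "0 \<le> s" using rs by simp
    show "?\<psi> s (homology_map n (L s) (g r s) A) = homology_map n (K (c * s)) (f (c * r) (c * s)) (?\<psi> r A)"
      unfolding z(2) mL[OF rs z(1)] cL[OF s s oL[OF rs z(1)]] cL[OF rs(1,1) z(1)]
        mK[OF c0[OF rs] homology_operatorD(1)[OF \<Psi>[OF rs(1)] z(1)]] by (rule \<Psi>_nat[OF rs z(1)])
  qed
  have 3: "?\<psi> (c * r) (?\<phi> r A) = homology_map n (K (c\<^sup>2 * r)) (f r (c\<^sup>2 * r)) A"
    if r: "0 \<le> r" and "A \<in> carrier (homology n (K r))" for r and A :: "('v list \<Rightarrow> 'k) set"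
    using that(2)
  proof (rule homology_carrierE)
    fix z assume z: "z \<in> cycles n (K r)" "A = homology_class n (K r) z"
    note cr = c0(1)[OF r order_refl]
    show ?thesis
      unfolding z(2) cK[OF r r z(1)] cL[OF cr cr homology_operatorD(1)[OF \<Phi>[OF r] z(1)]]
      \<comment> \<open>The composite arrives at \<open>c * (c * r)\<close>, the structure map at
        \<open>c\<^sup>2 * r\<close>; the parameters are identified only after the classes have been
        computed.\<close>
      unfolding c2(2)[OF r] mK[OF r c2(1)[OF r] z(1)] by (rule \<Psi>\<Phi>[OF r z(1)])
  qed
  have 4: "?\<phi> (c * r) (?\<psi> r A) = homology_map n (L (c\<^sup>2 * r)) (g r (c\<^sup>2 * r)) A"
    if r: "0 \<le> r" and "A \<in> carrier (homology n (L r))" for r and A :: "('w list \<Rightarrow> 'k) set"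
    using that(2)
  proof (rule homology_carrierE)
    fix z assume z: "z \<in> cycles n (L r)" "A = homology_class n (L r) z"
    note cr = c0(1)[OF r order_refl]
    show ?thesis
      unfolding z(2) cL[OF r r z(1)] cK[OF cr cr homology_operatorD(1)[OF \<Psi>[OF r] z(1)]]
      unfolding c2(2)[OF r] mL[OF r c2(1)[OF r] z(1)] by (rule \<Phi>\<Psi>[OF r z(1)])
  qed
  show ?thesis
    unfolding approximated_def
    by (intro conjI is_persistence_module_homology K L exI[of _ ?\<phi>] exI[of _ ?\<psi>] 1 2 allI impI ballI)
      (simp_all add: homology_persistence_def 3 4)
qed

section \<open>Covers as relations, and the two comparisons of persistence modules\<close>

definition incidence :: "('i, 'a) cover \<Rightarrow> ('i \<times> 'a) set" where
  "incidence U = {(i, x). i \<in> index_set U \<and> x \<in> member U i}"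

text \<open>A point in the intersection of the members is a common witness for their
  indices.\<close>

lemma insert_empty_nerve: "insert {} (nerve U) = dowker (incidence U)"
proof (rule Set.set_eqI)
  fix \<sigma>
  show "\<sigma> \<in> insert {} (nerve U) \<longleftrightarrow> \<sigma> \<in> dowker (incidence U)"
    by (cases "\<sigma> = {}") (auto simp: nerve_def dowker_def incidence_def)
qed

text \<open>A common witness is an index whose member contains the set; the cover hypothesis places
  that member inside \<open>X\<close>.\<close>

lemma insert_empty_conerve:
  assumes "is_cover X U" shows "insert {} (conerve X U) = dowker ((incidence U)\<inverse>)"
proof (rule Set.set_eqI)
  fix \<sigma>
  show "\<sigma> \<in> insert {} (conerve X U) \<longleftrightarrow> \<sigma> \<in> dowker ((incidence U)\<inverse>)"
    using assms by (cases "\<sigma> = {}") (auto simp: conerve_def dowker_def incidence_def is_cover_def)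
qed

lemma homology_nerve_eq:
  "homology_nerve n U = homology_persistence n (\<lambda>r. dowker (incidence (cover_at U r))) (cover_map U)"
  unfolding homology_nerve_def homology_persistence_def insert_empty_nerve[symmetric] homology_insert_empty ..

text \<open>Co-nerves are kept in this form because their equality with a Dowker complex needs a
  cover, which is available only for \<open>r \<ge> 0\<close>.\<close>

lemma homology_conerve_eq:
  "homology_conerve n X U = homology_persistence n (\<lambda>r. insert {} (conerve X (cover_at U r))) (\<lambda>_ _. id)"
  unfolding homology_conerve_def homology_persistence_def homology_insert_empty ..

lemma refinement_incidence:
  "refinement_map U V f \<Longrightarrow> (i, x) \<in> incidence U \<Longrightarrow> (f i, x) \<in> incidence V"
  unfolding refinement_map_def incidence_def by auto

text \<open>The conclusion does not mention \<open>f\<close>: on co-nerves only the existence of a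
  refinement map matters.\<close>

lemma conerve_mono: "refinement_map U V f \<Longrightarrow> conerve X U \<subseteq> conerve X V"
  unfolding refinement_map_def conerve_def by blast

lemma persistent_coverD:
  assumes "is_persistent_cover X U" "0 \<le> r"
  shows "is_cover X (cover_at U r)"
    and "r \<le> s \<Longrightarrow> refinement_map (cover_at U r) (cover_at U s) (cover_map U r s)"
    and "i \<in> index_set (cover_at U r) \<Longrightarrow> cover_map U r r i = i"
    and "r \<le> s \<Longrightarrow> s \<le> t \<Longrightarrow> i \<in> index_set (cover_at U r) \<Longrightarrow>
      cover_map U s t (cover_map U r s i) = cover_map U r t i"
  using assms unfolding is_persistent_cover_def by simp_all

lemma persistent_complex_nerve:
  assumes "is_persistent_cover X U"
  shows "persistent_complex (\<lambda>r. dowker (incidence (cover_at U r))) (cover_map U)"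
proof -
  have index: "i \<in> index_set (cover_at U r)" if "\<sigma> \<in> dowker (incidence (cover_at U r))" "i \<in> \<sigma>" for \<sigma> i r
    using that unfolding dowker_def incidence_def by auto
  show ?thesis
  proof
    show "cover_map U r s ` \<sigma> \<in> dowker (incidence (cover_at U s))"
      if "0 \<le> r" "r \<le> s" "\<sigma> \<in> dowker (incidence (cover_at U r))" for r s \<sigma>
      using refinement_incidence[OF persistent_coverD(2)[OF assms that(1,2)]] that(3) unfolding dowker_def by blast
  qed (use persistent_coverD(3,4)[OF assms] index augmented_dowker in auto)
qed

lemma augmented_conerve: "is_cover X U \<Longrightarrow> augmented_complex (insert {} (conerve X U))"
  by (simp add: insert_empty_conerve augmented_dowker)

lemma persistent_complex_conerve:
  assumes U: "is_persistent_cover X U"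
  shows "persistent_complex (\<lambda>r. insert {} (conerve X (cover_at U r))) (\<lambda>_ _. id)"
proof -
  have "augmented_complex (insert {} (conerve X (cover_at U r)))" if "0 \<le> r" for r
    by (rule augmented_conerve[OF persistent_coverD(1)[OF U that]])
  moreover have "conerve X (cover_at U r) \<subseteq> conerve X (cover_at U s)" if "0 \<le> r" "r \<le> s" for r s
    by (rule conerve_mono[OF persistent_coverD(2)[OF U that]])
  ultimately show ?thesis by unfold_locales auto
qed

text \<open>All maps involved are inclusions and fix every cycle, so naturality and both composition
  laws are identities.\<close>

lemma approximated_conerve:
  assumes c: "1 \<le> c" and U: "is_persistent_cover X U" and V: "is_persistent_cover X V"
    and UV: "approximated_up_to_contiguity c U V"
  shows "approximated c (homology_conerve n X U :: ('k::field, _) persistence_module) (homology_conerve n X V)"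
proof -
  have op: "homology_operator n (insert {} (conerve X (cover_at W r))) (insert {} (conerve X (cover_at W' (c * r))))
      (\<lambda>z :: 'a list \<Rightarrow> 'k. z)"
    if "is_persistent_cover X W" "is_persistent_cover X W'"
      "\<exists>h. refinement_map (cover_at W r) (cover_at W' (c * r)) h" "0 \<le> r"
    for W :: "('x, 'a) persistent_cover" and W' :: "('y, 'a) persistent_cover" and r
  proof (rule chain_morphism_homology_operator[where f = "\<lambda>_ z. z"])
    have "0 \<le> c * r" using c that by simp
    then show "augmented_complex (insert {} (conerve X (cover_at W r)))" "augmented_complex (insert {} (conerve X (cover_at W' (c * r))))"
      by (intro augmented_conerve persistent_coverD(1) that)+
    show "chain_morphism (insert {} (conerve X (cover_at W r))) (insert {} (conerve X (cover_at W' (c * r)))) (\<lambda>_ z :: 'a list \<Rightarrow> 'k. z)"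
      using that(3) conerve_mono by (intro chain_morphism_id) blast
  qed
  have UV': "\<exists>h. refinement_map (cover_at U r) (cover_at V (c * r)) h"
    "\<exists>h. refinement_map (cover_at V r) (cover_at U (c * r)) h" if "0 \<le> r" for r
    using UV that unfolding approximated_up_to_contiguity_def by auto
  show ?thesis
    unfolding homology_conerve_eq
    by (rule approximated_homology[OF c persistent_complex_conerve[OF U] persistent_complex_conerve[OF V],
          where \<Phi> = "\<lambda>_ z. z" and \<Psi> = "\<lambda>_ z. z"])
      (use c in \<open>auto intro: op[OF U V UV'(1)] op[OF V U UV'(2)]\<close>)
qed

text \<open>The Dowker maps at each \<open>r\<close> are mutually inverse on homology. Their
  naturality makes them a 1-approximation, whose shifts are trivial.\<close>

lemma nerve_iso_conerve:
  assumes U: "is_persistent_cover X U"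
  shows "approximated 1 (homology_nerve n U :: ('k::field, _) persistence_module) (homology_conerve n X U)"
proof -
  let ?R = "\<lambda>r. incidence (cover_at U r)"
  let ?N = "\<lambda>r. dowker (?R r)" and ?C = "\<lambda>r. insert {} (conerve X (cover_at U r))"
  have C: "?C r = dowker ((?R r)\<inverse>)" if "0 \<le> r" for r
    by (rule insert_empty_conerve[OF persistent_coverD(1)[OF U that]])
  have ref: "(cover_map U r s i, x) \<in> ?R s" if "(i, x) \<in> ?R r" "0 \<le> r" "r \<le> s" for r s i x
    by (rule refinement_incidence[OF persistent_coverD(2)[OF U that(2,3)] that(1)])
  have N: "persistent_complex ?N (cover_map U)" by (rule persistent_complex_nerve[OF U])
  have opN: "homology_operator n (?N r) (?N s) (chain_map (cover_map U r s))" if "0 \<le> r" "r \<le> s" for r s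
    by (rule persistent_operator[OF N that])
  have opC: "homology_operator n (?C r) (?C s) (chain_map id)" if "0 \<le> r" "r \<le> s" for r s
    by (rule persistent_operator[OF persistent_complex_conerve[OF U] that])
  let ?T = "\<lambda>r. dowker_map n (?R r)" and ?T' = "\<lambda>r. dowker_map_inv n (?R r)"
  have nat: "homology_class n (?C s) (?T s (chain_map (cover_map U r s) z)) = homology_class n (?C s) (?T r z)"
    if "0 \<le> r" "r \<le> s" "z \<in> cycles n (?N r)" for r s and z :: "'b list \<Rightarrow> 'k"
    using C[of s] dowker_map_natural[OF ref[OF _ that(1,2)] that(3)] that by simp
  \<comment> \<open>The inverse of a natural isomorphism is natural: up to homology \<open>z\<close>
    is the image of \<open>?T' r z\<close>, naturality moves this to \<open>s\<close>, and
    \<open>?T' s\<close> cancels \<open>?T s\<close>.\<close>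
  have nat': "homology_class n (?N s) (?T' s z) = homology_class n (?N s) (chain_map (cover_map U r s) (?T' r z))"
    if rs: "0 \<le> r" "r \<le> s" and z: "z \<in> cycles n (?C r)" for r s and z :: "'a list \<Rightarrow> 'k"
  proof -
    have s: "0 \<le> s" using rs by simp
    note T = homology_operator_dowker_map[of n "?R s"] and T' = homology_operator_dowker_map_inv[of n "?R s"]
    let ?y = "?T' r z"
    have z': "z \<in> cycles n (dowker ((?R r)\<inverse>))" using z C[OF rs(1)] by simp
    have y: "?y \<in> cycles n (?N r)" by (rule homology_operatorD(1)[OF homology_operator_dowker_map_inv z'])
    have Ty: "?T r ?y \<in> cycles n (?C r)"
      using homology_operatorD(1)[OF homology_operator_dowker_map y] C[OF rs(1)] by simp
    have zs: "z \<in> cycles n (?C s)" using homology_operatorD(1)[OF opC[OF rs] z] by simp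
    have Tys: "?T r ?y \<in> cycles n (?C s)" using homology_operatorD(1)[OF opC[OF rs] Ty] by simp
    have fy: "chain_map (cover_map U r s) ?y \<in> cycles n (?N s)" by (rule homology_operatorD(1)[OF opN[OF rs] y])
    have "homology_class n (?C r) z = homology_class n (?C r) (?T r ?y)"
      using dowker_map_dowker_map_inv[OF z'] C[OF rs(1)] by simp
    then have "homology_class n (?C s) z = homology_class n (?C s) (?T r ?y)"
      using homology_operatorD(3)[OF opC[OF rs] z Ty] by simp
    also have "\<dots> = homology_class n (?C s) (?T s (chain_map (cover_map U r s) ?y))"
      by (rule nat[OF rs y, symmetric])
    finally have "homology_class n (?N s) (?T' s z) = homology_class n (?N s) (?T' s (?T s (chain_map (cover_map U r s) ?y)))"
      using homology_operatorD(3)[OF T' _ homology_operatorD(1)[OF T fy]] zs C[OF s] by simp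
    then show ?thesis using dowker_map_inv_dowker_map[OF fy] by simp
  qed
  have id: "homology_class n (?N r) (chain_map (cover_map U r r) z) = homology_class n (?N r) z"
    if "0 \<le> r" "z \<in> cycles n (?N r)" for r and z :: "'b list \<Rightarrow> 'k"
  using chain_map_identity[OF N that] by simp
  show ?thesis
    unfolding homology_nerve_eq homology_conerve_eq
  proof (rule approximated_homology[OF _ N persistent_complex_conerve[OF U], where \<Phi> = ?T and \<Psi> = ?T'])
    show "homology_operator n (?N r) (?C (1 * r)) (?T r)" if "0 \<le> r" for r
      using homology_operator_dowker_map[of n "?R r"] C[OF that] by simp
    show "homology_operator n (?C r) (?N (1 * r)) (?T' r)" if "0 \<le> r" for r
      using homology_operator_dowker_map_inv[of n "?R r"] C[OF that] by simp
    show "homology_class n (?C (1 * s)) (?T s (chain_map (cover_map U r s) z)) =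
        homology_class n (?C (1 * s)) (chain_map id (?T r z))"
      if "0 \<le> r" "r \<le> s" "z \<in> cycles n (?N r)" for r s and z :: "'b list \<Rightarrow> 'k"
      using nat[OF that] by simp
    show "homology_class n (?N (1 * s)) (?T' s (chain_map id z)) =
        homology_class n (?N (1 * s)) (chain_map (cover_map U (1 * r) (1 * s)) (?T' r z))"
      if "0 \<le> r" "r \<le> s" "z \<in> cycles n (?C r)" for r s and z :: "'a list \<Rightarrow> 'k"
      using nat'[OF that] by simp
    show "homology_class n (?N (1\<^sup>2 * r)) (?T' (1 * r) (?T r z)) =
        homology_class n (?N (1\<^sup>2 * r)) (chain_map (cover_map U r (1\<^sup>2 * r)) z)"
      if "0 \<le> r" "z \<in> cycles n (?N r)" for r and z :: "'b list \<Rightarrow> 'k"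
      using id[OF that] dowker_map_inv_dowker_map[OF that(2)] by simp
    show "homology_class n (?C (1\<^sup>2 * r)) (?T (1 * r) (?T' r z)) = homology_class n (?C (1\<^sup>2 * r)) (chain_map id z)"
      if "0 \<le> r" "z \<in> cycles n (?C r)" for r and z :: "'a list \<Rightarrow> 'k"
      using dowker_map_dowker_map_inv[of z n "?R r"] that C[OF that(1)] by simp
  qed simp
qed

theorem theorem3p11:
  fixes X :: "'a set" and c :: real
    and U :: "('i, 'a) persistent_cover" and V :: "('j, 'a) persistent_cover"
  assumes "1 \<le> c"
    and "is_persistent_cover X U" and "is_persistent_cover X V"
    and "approximated_up_to_contiguity c U V"
  shows "(\<forall>n. approximated c
           (homology_nerve n U :: ('k::field, ('i list \<Rightarrow> 'k) set) persistence_module)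
           (homology_nerve n V :: ('k, ('j list \<Rightarrow> 'k) set) persistence_module)) \<and>
         (\<forall>n. approximated c
           (homology_conerve n X U :: ('k, ('a list \<Rightarrow> 'k) set) persistence_module)
           (homology_conerve n X V :: ('k, ('a list \<Rightarrow> 'k) set) persistence_module)) \<and>
         (\<forall>n. approximated c
           (homology_nerve n U :: ('k, ('i list \<Rightarrow> 'k) set) persistence_module)
           (homology_conerve n X V :: ('k, ('a list \<Rightarrow> 'k) set) persistence_module))"
proof -
  have 2: "approximated c (homology_conerve n X U :: ('k, ('a list \<Rightarrow> 'k) set) persistence_module) (homology_conerve n X V)" for n
    by (rule approximated_conerve[OF assms])
  \<comment> \<open>Duality is applied to \<open>U\<close> only; the change from \<open>U\<close> to
    \<open>V\<close> takes place among co-nerves.\<close>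
  have 3: "approximated c (homology_nerve n U :: ('k, ('i list \<Rightarrow> 'k) set) persistence_module) (homology_conerve n X V)" for n
    by (rule approximated_iso_trans[OF assms(1) nerve_iso_conerve[OF assms(2)] 2])
  \<comment> \<open>Duality for \<open>V\<close> is composed with the reversed statement (3);
    reversing the result avoids any direct comparison of refinement maps on nerves.\<close>
  have 1: "approximated c (homology_nerve n U :: ('k, ('i list \<Rightarrow> 'k) set) persistence_module) (homology_nerve n V)" for n
    by (rule approximated_sym[OF approximated_iso_trans[OF assms(1) nerve_iso_conerve[OF assms(3)] approximated_sym[OF 3]]])
  show ?thesis using 1 2 3 by blast
qed

end
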